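(* Let $t_1,t_2\in\mathbb{R}$ and $s_1,s_2>0$, let $\mathbf{W}_\Phi=[W_\Phi(t_1,s_1)\ W_\Phi(t_2,s_2)]^\top$, assume that $\Gamma=\mathbb{E}[\mathbf{W}_\Phi\mathbf{W}_\Phi^*]$ is invertible, and put $x=\frac{|\Gamma_{12}|^2}{\Gamma_{11}\Gamma_{22}}\in[0,1)$. Then $$\mathrm{Cov}\left(|W_\Phi(t_1,s_1)|,|W_\Phi(t_2,s_2)|\right)=\frac\pi4\sqrt{\Gamma_{11}\Gamma_{22}}\left[(1-x)^2\,{}_2F_1\left(\tfrac32,\tfrac32;1;x\right)-1\right],$$ and the correlation coefficient is $$\mathrm{Corr}\left(|W_\Phi(t_1,s_1)|,|W_\Phi(t_2,s_2)|\right)=\left(\frac4\pi-1\right)^{-1}\left[(1-x)^2\,{}_2F_1\left(\tfrac32,\tfrac32;1;x\right)-1\right].$$ Moreover, when $x\to0$, $$\mathrm{Corr}\left(|W_\Phi(t_1,s_1)|,|W_\Phi(t_2,s_2)|\right)\sim\left(\frac{16}{\pi}-4\right)^{-1}\frac{|\Gamma_{12}|^2}{\Gamma_{11}\Gamma_{22}},$$ i.e. the ratio of the two sides, viewed as functions of $x$, tends to $1$ as $x\to0$, $x>0$.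
   Context: The function $\psi:\mathbb{R}\to\mathbb{C}$ belongs to $L^1(\mathbb{R})\cap L^2(\mathbb{R})$, with Fourier transform $\widehat\psi(\omega)=\int_{\mathbb{R}}e^{-it\omega}\psi(t)\,dt$. It is an analytic mother wavelet: $\widehat\psi(\omega)=0$ for $\omega\le0$; moreover $|\widehat\psi|$ is unimodal with a unique maximum point in $(0,\infty)$. The noise $\Phi=\{\Phi(t)\}_{t\in\mathbb{R}}$ is a real-valued stationary Gaussian process with constant mean and covariance function $C_\Phi(t_1-t_2)=\mathrm{Cov}(\Phi(t_1),\Phi(t_2))$, which has the spectral representation $C_\Phi(t)=\int_{\mathbb{R}}e^{i\lambda t}F(d\lambda)$ with $F$ a nonnegative measure, $F(\mathbb{R})=C_\Phi(0)$. The analytic wavelet transform of $\Phi$ is $W_\Phi(t,s)=\int_{\mathbb{R}}\Phi(\tau)\frac{1}{\sqrt s}\overline{\psi\left(\frac{\tau-t}{s}\right)}d\tau$, $t\in\mathbb{R}$, $s>0$; it has mean zero because $\widehat\psi(0)=0$. The entries of $\Gamma$ are $\Gamma_{\ell\ell'}=\mathbb{E}[W_\Phi(t_\ell,s_\ell)\overline{W_\Phi(t_{\ell'},s_{\ell'})}]=\sqrt{s_\ell s_{\ell'}}\int_{\mathbb{R}}e^{i(t_\ell-t_{\ell'})\lambda}\overline{\widehat\psi(s_\ell\lambda)}\widehat\psi(s_{\ell'}\lambda)F(d\lambda)$. The hypergeometric function is ${}_2F_1(a,b;c;x)=\frac{\Gamma(c)}{\Gamma(a)\Gamma(b)}\sum_{k=0}^\infty\frac{\Gamma(k+a)\Gamma(k+b)}{\Gamma(k+c)}\frac{x^k}{k!}$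 for $x\in[0,1)$, $a,b,c>0$, where here $\Gamma(\cdot)$ is the Gamma function. *)

theory Defs
  imports "HOL-Probability.Probability"
begin

definition fourier :: "(real \<Rightarrow> complex) \<Rightarrow> real \<Rightarrow> complex" where
  "fourier f w = (\<integral>t. exp (- (\<i> * of_real (t * w))) * f t \<partial>lebesgue)"

text \<open>
  "Unimodal" is taken in the weak sense (nondecreasing, then nonincreasing); the uniqueness of
  the maximum point is a separate condition.
\<close>

locale analytic_mother_wavelet =
  fixes \<psi> :: "real \<Rightarrow> complex"
  assumes L1: "integrable lebesgue \<psi>"
    and L2: "integrable lebesgue (\<lambda>t. (cmod (\<psi> t))\<^sup>2)"
    and analytic: "\<And>w. w \<le> 0 \<Longrightarrow> fourier \<psi> w = 0"
    and unimodal: "\<exists>w0>0. mono_on {0<..w0} (\<lambda>w. cmod (fourier \<psi> w))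
      \<and> antimono_on {w0..} (\<lambda>w. cmod (fourier \<psi> w))
      \<and> (\<forall>w>0. w \<noteq> w0 \<longrightarrow> cmod (fourier \<psi> w) < cmod (fourier \<psi> w0))"

definition covariance :: "'a measure \<Rightarrow> ('a \<Rightarrow> real) \<Rightarrow> ('a \<Rightarrow> real) \<Rightarrow> real" where
  "covariance M X Y =
    (\<integral>\<omega>. (X \<omega> - (\<integral>\<omega>'. X \<omega>' \<partial>M)) * (Y \<omega> - (\<integral>\<omega>'. Y \<omega>' \<partial>M)) \<partial>M)"

definition correlation :: "'a measure \<Rightarrow> ('a \<Rightarrow> real) \<Rightarrow> ('a \<Rightarrow> real) \<Rightarrow> real" where
  "correlation M X Y = covariance M X Y / sqrt (covariance M X X * covariance M Y Y)"

text \<open>Gaussian real random variables; the second disjunct is the degenerate case of variance 0.\<close>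

definition gaussian_rv :: "'a measure \<Rightarrow> ('a \<Rightarrow> real) \<Rightarrow> bool" where
  "gaussian_rv M X \<longleftrightarrow> X \<in> borel_measurable M \<and>
    ((\<exists>\<mu> \<sigma>. \<sigma> > 0 \<and> distributed M lborel X (normal_density \<mu> \<sigma>)) \<or> (\<exists>\<mu>. AE \<omega> in M. X \<omega> = \<mu>))"

definition gaussian_process :: "'a measure \<Rightarrow> (real \<Rightarrow> 'a \<Rightarrow> real) \<Rightarrow> bool" where
  "gaussian_process M \<Phi> \<longleftrightarrow>
    (\<forall>I a. finite I \<longrightarrow> gaussian_rv M (\<lambda>\<omega>. \<Sum>t\<in>I. a t * \<Phi> t \<omega>))"

text \<open>
  Joint measurability makes the pathwise integral defining the wavelet transform meaningful.
  A Gaussian process whose mean is constant and whose covariance depends on the time difference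
  only is strictly stationary, so nothing further is required for stationarity.
\<close>

locale stationary_gaussian_noise = prob_space M
  for M :: "'a measure" +
  fixes \<Phi> :: "real \<Rightarrow> 'a \<Rightarrow> real" and C :: "real \<Rightarrow> real" and F :: "real measure"
  assumes jointly_measurable: "(\<lambda>(t, \<omega>). \<Phi> t \<omega>) \<in> borel_measurable (borel \<Otimes>\<^sub>M M)"
    and gaussian: "gaussian_process M \<Phi>"
    and constant_mean: "\<And>t t'. (\<integral>\<omega>. \<Phi> t \<omega> \<partial>M) = (\<integral>\<omega>. \<Phi> t' \<omega> \<partial>M)"
    and stationary_covariance: "\<And>t1 t2. covariance M (\<Phi> t1) (\<Phi> t2) = C (t1 - t2)"
    and spectral_sets: "sets F = sets borel"
    and spectral_mass: "emeasure F UNIV = ennreal (C 0)"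
    and spectral_representation:
      "\<And>t. complex_of_real (C t) = (\<integral>l. exp (\<i> * of_real (l * t)) \<partial>F)"

definition awt :: "(real \<Rightarrow> complex) \<Rightarrow> (real \<Rightarrow> 'a \<Rightarrow> real) \<Rightarrow> real \<Rightarrow> real \<Rightarrow> 'a \<Rightarrow> complex" where
  "awt \<psi> \<Phi> t s \<omega> =
    (\<integral>\<tau>. of_real (\<Phi> \<tau> \<omega>) * of_real (1 / sqrt s) * cnj (\<psi> ((\<tau> - t) / s)) \<partial>lebesgue)"

text \<open>The matrix of the entrywise expectations of \<open>W W\<^sup>*\<close>, for a complex random vector \<open>W\<close>.\<close>

definition second_moment_matrix :: "'a measure \<Rightarrow> ('a \<Rightarrow> complex ^ 'n) \<Rightarrow> complex ^ 'n ^ 'n" where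
  "second_moment_matrix M W = (\<chi> i j. \<integral>\<omega>. W \<omega> $ i * cnj (W \<omega> $ j) \<partial>M)"

definition awt_gamma :: "'a measure \<Rightarrow> (real \<Rightarrow> complex) \<Rightarrow> (real \<Rightarrow> 'a \<Rightarrow> real)
    \<Rightarrow> real \<Rightarrow> real \<Rightarrow> real \<Rightarrow> real \<Rightarrow> complex ^ 2 ^ 2" where
  "awt_gamma M \<psi> \<Phi> t1 s1 t2 s2 =
    second_moment_matrix M (\<lambda>\<omega>. vector [awt \<psi> \<Phi> t1 s1 \<omega>, awt \<psi> \<Phi> t2 s2 \<omega>])"

text \<open>The diagonal entries of a second moment matrix are real, so \<open>Re\<close> is merely a coercion.\<close>

definition coherence :: "complex ^ 2 ^ 2 \<Rightarrow> real" where
  "coherence G = (cmod (G $ 1 $ 2))\<^sup>2 / (Re (G $ 1 $ 1) * Re (G $ 2 $ 2))"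

text \<open>Intended for \<open>a, b, c > 0\<close> and \<open>0 \<le> x < 1\<close>, where the series converges.\<close>

definition hyp2F1 :: "real \<Rightarrow> real \<Rightarrow> real \<Rightarrow> real \<Rightarrow> real" where
  "hyp2F1 a b c x = Gamma c / (Gamma a * Gamma b) *
    (\<Sum>k. Gamma (real k + a) * Gamma (real k + b) / Gamma (real k + c) * (x ^ k / fact k))"

end

theory Submission
  imports Defs "HOL-Real_Asymp.Real_Asymp"
begin

text \<open>
  The two wavelet coefficients form a mean-zero, circular, jointly Gaussian pair, and for such a pair
  the mean of the product of the moduli is an explicit function of the three second moments.
  
  Circularity is where analyticity enters. A coefficient is a linear functional
  \<open>W = \<integral> \<Phi>(\<tau>) g(\<tau>) d\<tau>\<close> whose kernel \<open>g\<close> has its spectrum on one half line. For complex \<open>c1\<close>,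
  \<open>c2\<close> the real random variable \<open>Re (c1 W1 + c2 W2)\<close> is the functional with kernel
  \<open>h = Re (c1 g1 + c2 g2)\<close>. The spectrum of a real part consists of the given spectrum and of its
  mirror image; these do not overlap, so no cross term appears and the variance is Hermitian in
  \<open>(c1, c2)\<close>. The mean vanishes because the spectrum vanishes at \<open>0\<close>. Gaussianity
  (\<open>char_linear_functional\<close>) comes from Riemann sums, which are finite linear combinations
  of the noise: the spectral representation makes the covariance function continuous, so the sums
  converge in \<open>L\<^sup>1\<close> and the characteristic functions converge. The outcome,
  \<open>circular_gaussian_pair_of_filters\<close>, is the joint characteristic function
  \<open>E exp (i Re (c1 W1 + c2 W2)) = exp (- (\<bar>c1\<bar>\<^sup>2 A + \<bar>c2\<bar>\<^sup>2 B + 2 Re (c1 cnj c2 D)) / 4)\<close>.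
  
  All that follows uses only this formula, which forms the locale \<open>circular_gaussian_pair\<close>. The formula identifies \<open>A\<close>, \<open>B\<close>, \<open>D\<close> with the
  entries of the second moment matrix. Writing \<open>exp (- X\<^sup>2 / 2)\<close> as a Gaussian average of
  \<open>exp (i t X)\<close> turns it into the Laplace transform of the squared moduli
  (\<open>laplace_transform\<close>),
  \<open>E exp (- r\<^sup>2 \<bar>W1\<bar>\<^sup>2 - s\<^sup>2 \<bar>W2\<bar>\<^sup>2) = 1 / ((1 + A r\<^sup>2) (1 + B s\<^sup>2) - r\<^sup>2 s\<^sup>2 \<bar>D\<bar>\<^sup>2)\<close>.
  The moduli themselves are recovered from
  \<open>sqrt \<pi> * \<bar>y\<bar> = \<integral> (1 - exp (- r\<^sup>2 y\<^sup>2)) / r\<^sup>2 dr\<close> over \<open>r \<ge> 0\<close>. The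
  right-hand side of the Laplace transform expands as a geometric series whose terms are products of
  a function of \<open>r\<close> and a function of \<open>s\<close>. Every term is nonnegative, so the integrations
  can be done term by term, and with \<open>x = \<bar>D\<bar>\<^sup>2 / (A B)\<close>
  \<open>E (\<bar>W1\<bar> \<bar>W2\<bar>) = \<pi>/4 sqrt (A B) \<Sum>k. (pochhammer (-1/2) k / k!)\<^sup>2 x^k\<close>,
  where the series is \<open>2F1(-1/2, -1/2; 1; x)\<close>. Euler's transformation (\<open>euler_transformation\<close>)
  rewrites it as \<open>(1 - x)\<^sup>2 2F1(3/2, 3/2; 1; x)\<close>. The constant term is the product of the two means, and
  the coefficient \<open>1/4\<close> of \<open>x\<close> gives the behaviour as \<open>x\<close> tends to \<open>0\<close>.
\<close>

section \<open>Euler's transformation of the hypergeometric series\<close>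

lemma pochhammer_three_halves_le: "pochhammer (3/2::real) k / fact k \<le> real k + 1"
proof (induction k)
  case (Suc k)
  have "pochhammer (3/2::real) (Suc k) / fact (Suc k) = pochhammer (3/2) k / fact k * ((3/2 + real k) / (real k + 1))"
    by (simp add: pochhammer_Suc field_simps)
  also have "\<dots> \<le> (real k + 1) * ((3/2 + real k) / (real k + 1))"
    by (intro mult_right_mono Suc) auto
  also have "\<dots> \<le> real (Suc k) + 1" by (simp add: field_simps)
  finally show ?case .
qed simp

lemma summable_three_halves:
  assumes "\<bar>x\<bar> < 1"
  shows "summable (\<lambda>k. (pochhammer (3/2::real) k / fact k)\<^sup>2 * x ^ k)"
proof (rule summable_comparison_test')
  have "summable (\<lambda>k. diffs (\<lambda>_. 1) k * y ^ k)" if "norm y < 1" for y :: real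
    by (rule termdiff_converges[OF that]) (simp add: summable_geometric)
  from termdiff_converges[OF _ this, of "\<bar>x\<bar>"]
  show "summable (\<lambda>k. diffs (diffs (\<lambda>_. 1)) k * \<bar>x\<bar> ^ k)"
    using assms by simp
  fix k :: nat
  have "(pochhammer (3/2::real) k / fact k)\<^sup>2 \<le> (real k + 1)\<^sup>2"
    by (intro power_mono pochhammer_three_halves_le) (auto simp: pochhammer_nonneg)
  also have "\<dots> \<le> diffs (diffs (\<lambda>_. 1)) k"
    by (simp add: diffs_def power2_eq_square algebra_simps)
  finally have "(pochhammer (3/2::real) k / fact k)\<^sup>2 \<le> diffs (diffs (\<lambda>_. 1)) k" .
  thus "norm ((pochhammer (3/2::real) k / fact k)\<^sup>2 * x ^ k) \<le> diffs (diffs (\<lambda>_. 1)) k * \<bar>x\<bar> ^ k"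
    unfolding real_norm_def abs_mult power_abs[of x] abs_power2 by (rule mult_right_mono) simp
qed

lemma hyp2F1_three_halves:
  assumes x: "\<bar>x\<bar> < 1"
  shows "hyp2F1 (3/2) (3/2) 1 x = (\<Sum>k. (pochhammer (3/2) k / fact k)\<^sup>2 * x ^ k)"
proof -
  have nz: "(3/2::real) \<notin> \<int>\<^sub>\<le>\<^sub>0"
    using nonpos_Ints_nonpos[of "3/2::real"] by auto
  have G: "Gamma (real k + 3/2) = Gamma (3/2) * pochhammer (3/2) k" for k
    using pochhammer_Gamma[OF nz, of k] Gamma_eq_zero_iff[of "3/2::real"] nz
    by (simp add: field_simps add.commute)
  have F: "Gamma (real k + 1) = fact k" for k
    using Gamma_fact[of k, where 'a=real] by (simp add: add.commute)
  have g0: "Gamma (3/2::real) \<noteq> 0" using Gamma_eq_zero_iff[of "3/2::real"] nz by simp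
  have H: "Gamma (real k + 3/2) * Gamma (real k + 3/2) / Gamma (real k + 1) * (x ^ k / fact k)
     = (Gamma (3/2) * Gamma (3/2)) * ((pochhammer (3/2) k / fact k)\<^sup>2 * x ^ k)" for k
    unfolding G F by (simp add: power2_eq_square)
  have g1: "Gamma (1::real) = 1" using F[of 0] by simp
  have ne: "Gamma (3/2::real) * Gamma (3/2) \<noteq> 0" using g0 by simp
  show ?thesis
    unfolding hyp2F1_def H suminf_mult[OF summable_three_halves[OF x]] using ne g1 by simp
qed

text \<open>
  The coefficients of \<open>2F1(-1/2, -1/2; 1; x)\<close>.
\<close>

definition euler_coeff :: "nat \<Rightarrow> real" where
  "euler_coeff k = (pochhammer (-1/2) k / fact k)\<^sup>2"

lemma euler_coeff_Suc: "euler_coeff (Suc k) = 1/4 * (pochhammer (1/2) k / fact (Suc k))\<^sup>2"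
  unfolding euler_coeff_def by (simp add: pochhammer_rec power_divide power_mult_distrib power2_eq_square)

text \<open>
  Multiplying a power series by \<open>(1 - x)\<^sup>2\<close> takes second differences of its coefficients. Here
  both sides are a common factor times a polynomial in \<open>k\<close>, and the polynomial on the left
  collapses to the constant \<open>1/16\<close>.
\<close>

lemma euler_coeff_difference:
  fixes b defines "b \<equiv> \<lambda>k. (pochhammer (3/2::real) k / fact k)\<^sup>2"
  shows "b (Suc (Suc k)) - 2 * b (Suc k) + b k = euler_coeff (Suc (Suc k))"
proof -
  define p :: real where "p = pochhammer (3/2) k"
  define n :: real where "n = real k"
  define f :: real where "f = fact k"
  have e: "pochhammer (-1/2::real) (Suc (Suc k)) = - 1/4 * p"
    unfolding p_def by (simp only: pochhammer_rec) simp
  have n: "n \<ge> 0" "n + 1 \<noteq> 0" "n + 2 \<noteq> 0" by (auto simp: n_def)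
  have f: "f \<noteq> 0" by (simp add: f_def)
  have f1: "fact (Suc k) = (n + 1) * f" "fact (Suc (Suc k)) = (n + 2) * ((n + 1) * f)"
    by (simp_all add: f_def n_def algebra_simps)
  have p1: "pochhammer (3/2::real) (Suc k) = p * (n + 3/2)"
    "pochhammer (3/2::real) (Suc (Suc k)) = p * (n + 3/2) * (n + 5/2)"
    unfolding p_def n_def by (simp_all add: pochhammer_Suc algebra_simps)
  have "(p * (n + 3/2) * (n + 5/2) / ((n + 2) * ((n + 1) * f)))\<^sup>2 
     - 2 * (p * (n + 3/2) / ((n + 1) * f))\<^sup>2 + (p / f)\<^sup>2
    = (p / f)\<^sup>2 / ((n+1)\<^sup>2 * (n+2)\<^sup>2) * (((n + 3/2) * (n + 5/2))\<^sup>2 - 2 * ((n + 3/2) * (n+2))\<^sup>2 + ((n+1)*(n+2))\<^sup>2)"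
    using n f by (simp add: power_divide power_mult_distrib divide_simps) (simp add: algebra_simps)
  also have "((n + 3/2) * (n + 5/2))\<^sup>2 - 2 * ((n + 3/2) * (n+2))\<^sup>2 + ((n+1)*(n+2))\<^sup>2 = 1/16"
    by (simp add: power2_eq_square field_simps)
  also have "(p / f)\<^sup>2 / ((n+1)\<^sup>2 * (n+2)\<^sup>2) * (1/16) = (- 1/4 * p / ((n + 2) * ((n + 1) * f)))\<^sup>2"
    by (simp add: power_divide power_mult_distrib power2_eq_square)
  finally show ?thesis
    unfolding b_def euler_coeff_def e f1 p1 p_def[symmetric] f_def[symmetric] .
qed

lemma euler_transformation:
  assumes x: "\<bar>x\<bar> < 1"
  shows "(\<lambda>k. euler_coeff k * x ^ k) sums ((1 - x)\<^sup>2 * hyp2F1 (3/2) (3/2) 1 x)"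
proof -
  define b where "b k = (pochhammer (3/2::real) k / fact k)\<^sup>2" for k
  define H where "H = hyp2F1 (3/2) (3/2) 1 x"
  have s0: "(\<lambda>k. b k * x ^ k) sums H"
    unfolding b_def H_def hyp2F1_three_halves[OF x] by (rule summable_sums[OF summable_three_halves[OF x]])
  have s1: "(\<lambda>k. b (Suc k) * x ^ Suc k) sums (H - 1)"
    using s0 by (subst sums_Suc_iff) (simp add: b_def)
  have s2: "(\<lambda>k. b (Suc (Suc k)) * x ^ Suc (Suc k)) sums (H - 1 - 9/4 * x)"
    using s1 by (subst sums_Suc_iff) (simp add: b_def power2_eq_square)
  have "(\<lambda>k. b (Suc (Suc k)) * x ^ Suc (Suc k) - 2 * x * (b (Suc k) * x ^ Suc k) + x\<^sup>2 * (b k * x ^ k))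
     sums (H - 1 - 9/4 * x - 2 * x * (H - 1) + x\<^sup>2 * H)"
    by (intro sums_add sums_diff sums_mult s0 s1 s2)
  also have "(\<lambda>k. b (Suc (Suc k)) * x ^ Suc (Suc k) - 2 * x * (b (Suc k) * x ^ Suc k) + x\<^sup>2 * (b k * x ^ k))
     = (\<lambda>k. euler_coeff (Suc (Suc k)) * x ^ Suc (Suc k))"
    unfolding euler_coeff_difference[symmetric] b_def[symmetric]
    by (simp add: fun_eq_iff algebra_simps power2_eq_square)
  also have "H - 1 - 9/4 * x - 2 * x * (H - 1) + x\<^sup>2 * H = (1 - x)\<^sup>2 * H - 1 - 1/4 * x"
    by (simp add: power2_eq_square algebra_simps)
  finally have "(\<lambda>k. euler_coeff (Suc k) * x ^ Suc k) sums ((1 - x)\<^sup>2 * H - 1)"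
    by (subst (asm) sums_Suc_iff) (simp add: euler_coeff_def power2_eq_square)
  thus ?thesis unfolding H_def[symmetric]
    by (subst (asm) sums_Suc_iff) (simp add: euler_coeff_def)
qed

lemma euler_limit:
  "((\<lambda>y. ((1 - y)\<^sup>2 * hyp2F1 (3/2) (3/2) 1 y - 1) / y) \<longlongrightarrow> 1/4) (at 0)"
proof -
  have s: "(\<lambda>k. euler_coeff (Suc k) * y ^ k) sums (((1 - y)\<^sup>2 * hyp2F1 (3/2) (3/2) 1 y - 1) / y)"
    if "norm y < 1" "y \<noteq> 0" for y :: real
  proof -
    have "(\<lambda>k. euler_coeff k * y ^ k) sums ((1 - y)\<^sup>2 * hyp2F1 (3/2) (3/2) 1 y)"
      using that by (intro euler_transformation) auto
    hence "(\<lambda>k. euler_coeff (Suc k) * y ^ Suc k) sums ((1 - y)\<^sup>2 * hyp2F1 (3/2) (3/2) 1 y - 1)"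
      by (subst sums_Suc_iff) (simp add: euler_coeff_def)
    from sums_divide[OF this, of y] show ?thesis using that by simp
  qed
  have "((\<lambda>y. ((1 - y)\<^sup>2 * hyp2F1 (3/2) (3/2) 1 y - 1) / y) \<longlongrightarrow> euler_coeff (Suc 0)) (at 0)"
    by (rule powser_limit_0_strong[OF _ s]) auto
  thus ?thesis by (simp add: euler_coeff_Suc)
qed

section \<open>Real integrals\<close>

lemma nn_integral_gauss_half_line:
  fixes b :: real
  assumes "b > 0"
  shows "(\<integral>\<^sup>+r. ennreal (exp (- (b * r)\<^sup>2)) * indicator {0..} r \<partial>lborel) = ennreal (sqrt pi / (2 * b))"
proof -
  have "(\<integral>\<^sup>+r. ennreal (indicator {0..} r *\<^sub>R exp (- r\<^sup>2)) \<partial>lborel) = ennreal (sqrt pi / 2)"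
    using gaussian_moment_0 by (subst nn_integral_eq_integral) (auto simp: has_bochner_integral_iff)
  also have "(\<integral>\<^sup>+r. ennreal (indicator {0..} r *\<^sub>R exp (- r\<^sup>2)) \<partial>lborel)
     = ennreal b * (\<integral>\<^sup>+r. ennreal (exp (- (b * r)\<^sup>2)) * indicator {0..} r \<partial>lborel)"
    using assms
    by (subst nn_integral_real_affine[where c=b and t=0])
       (auto simp: indicator_def zero_le_mult_iff intro!: nn_integral_cong arg_cong2[where f="(*)"])
  finally have "ennreal (1/b) * (ennreal b * (\<integral>\<^sup>+r. ennreal (exp (- (b * r)\<^sup>2)) * indicator {0..} r \<partial>lborel))
    = ennreal (1/b) * ennreal (sqrt pi / 2)" by simp
  thus ?thesis using assms
    by (simp add: mult.assoc[symmetric] ennreal_mult[symmetric])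
qed

text \<open>
  The integrand is \<open>\<integral> 2 b exp (- b\<^sup>2 r\<^sup>2) db\<close> over \<open>b\<close> from \<open>0\<close> to \<open>y\<close>. After
  exchanging the integrals, the Gaussian integral in \<open>r\<close> equals \<open>sqrt \<pi> / (2 b)\<close>, which the factor
  \<open>2 b\<close> cancels.
\<close>

lemma nn_integral_exp_kernel:
  fixes y :: real
  assumes y: "y \<ge> 0"
  shows "(\<integral>\<^sup>+r. ennreal ((1 - exp (- (r * y)\<^sup>2)) / r\<^sup>2) * indicator {0..} r \<partial>lborel) = ennreal (sqrt pi * y)"
proof -
  define f where "f r b = ennreal (2 * b * exp (- (b * r)\<^sup>2)) * indicator {0..y} b * indicator {0..} r" for r b :: real
  have [measurable]: "(\<lambda>(r, b). f r b) \<in> borel_measurable (lborel \<Otimes>\<^sub>M lborel)"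
    unfolding f_def by measurable
  have r: "(\<integral>\<^sup>+b. f r b \<partial>lborel) = ennreal ((1 - exp (- (r * y)\<^sup>2)) / r\<^sup>2) * indicator {0..} r" if "r \<noteq> 0" for r
  proof -
    have "(\<integral>\<^sup>+b. f r b \<partial>lborel) = (\<integral>\<^sup>+b. ennreal (2 * b * exp (- (b * r)\<^sup>2)) * indicator {0..y} b \<partial>lborel) * indicator {0..} r"
      unfolding f_def by (rule nn_integral_multc) measurable
    also have "(\<integral>\<^sup>+b. ennreal (2 * b * exp (- (b * r)\<^sup>2)) * indicator {0..y} b \<partial>lborel)
      = ennreal (- exp (- (y * r)\<^sup>2) / r\<^sup>2 - (- exp (- (0 * r)\<^sup>2) / r\<^sup>2))"
      using y that by (intro nn_integral_FTC_Icc)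
        (auto intro!: derivative_eq_intros simp: power2_eq_square field_simps)
    also have "- exp (- (y * r)\<^sup>2) / r\<^sup>2 - (- exp (- (0 * r)\<^sup>2) / r\<^sup>2) = (1 - exp (- (r * y)\<^sup>2)) / r\<^sup>2"
      by (simp add: diff_divide_distrib mult.commute)
    finally show ?thesis .
  qed
  have b: "(\<integral>\<^sup>+r. f r b \<partial>lborel) = ennreal (sqrt pi) * indicator {0..y} b" if "b \<noteq> 0" for b
  proof (cases "b \<in> {0..y}")
    case True
    with that have "b > 0" by auto
    have "(\<integral>\<^sup>+r. f r b \<partial>lborel) = (\<integral>\<^sup>+r. ennreal (2 * b) * (ennreal (exp (- (b * r)\<^sup>2)) * indicator {0..} r) \<partial>lborel)"
      unfolding f_def using True \<open>b > 0\<close> by (intro nn_integral_cong) (simp add: ennreal_mult mult.assoc)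
    also have "\<dots> = ennreal (2 * b) * ennreal (sqrt pi / (2 * b))"
      using \<open>b > 0\<close> by (simp add: nn_integral_cmult nn_integral_gauss_half_line)
    also have "\<dots> = ennreal (sqrt pi)" using \<open>b > 0\<close> by (simp add: ennreal_mult[symmetric])
    finally show ?thesis using True by simp
  qed (simp add: f_def)
  have "(\<integral>\<^sup>+r. ennreal ((1 - exp (- (r * y)\<^sup>2)) / r\<^sup>2) * indicator {0..} r \<partial>lborel)
     = (\<integral>\<^sup>+r. (\<integral>\<^sup>+b. f r b \<partial>lborel) \<partial>lborel)"
    using AE_lborel_singleton[of 0] by (intro nn_integral_cong_AE) (auto elim!: eventually_mono simp: r)
  also have "\<dots> = (\<integral>\<^sup>+b. (\<integral>\<^sup>+r. f r b \<partial>lborel) \<partial>lborel)"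
    by (rule lborel_pair.Fubini') measurable
  also have "\<dots> = (\<integral>\<^sup>+b. ennreal (sqrt pi) * indicator {0..y} b \<partial>lborel)"
    using AE_lborel_singleton[of 0] by (intro nn_integral_cong_AE) (auto elim!: eventually_mono simp: b)
  also have "\<dots> = ennreal (sqrt pi * y)"
    using y by (simp add: nn_integral_cmult ennreal_mult)
  finally show ?thesis .
qed

lemma nn_integral_lorentzian:
  fixes A :: real
  assumes "A > 0"
  shows "(\<integral>\<^sup>+r. ennreal (A / (1 + A * r\<^sup>2)) * indicator {0..} r \<partial>lborel) = ennreal (sqrt A * (pi / 2))"
proof -
  have "sqrt A \<noteq> 0" "sqrt A * sqrt A = A" using assms by auto
  have pos: "1 + A * r\<^sup>2 > 0" for r using assms by (simp add: add_pos_nonneg)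
  have "((\<lambda>r. sqrt A * arctan (sqrt A * r)) \<longlongrightarrow> sqrt A * (pi / 2)) at_top"
    using assms
    by (intro tendsto_intros filterlim_compose[OF tendsto_arctan_at_top]
          filterlim_tendsto_pos_mult_at_top[OF tendsto_const _ filterlim_ident]) auto
  hence "(\<integral>\<^sup>+r. ennreal (A / (1 + A * r\<^sup>2)) * indicator {0..} r \<partial>lborel)
    = ennreal (sqrt A * (pi / 2) - sqrt A * arctan (sqrt A * 0))"
    using assms pos
    by (intro nn_integral_FTC_atLeast)
       (auto intro!: derivative_eq_intros divide_nonneg_pos simp: power_mult_distrib power2_eq_square field_simps)
  thus ?thesis by simp
qed

text \<open>
  Antiderivatives are built by recursion on \<open>k\<close>: differentiating
  \<open>r^(2k+1) / (1 + A r\<^sup>2)^(k+2)\<close> gives a combination of the integrands for \<open>k\<close> and \<open>k + 1\<close>,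
  and this function vanishes at \<open>0\<close> and at infinity. The integrals therefore satisfy
  \<open>(2k + 4) A R(k+1) = (2k + 1) R(k)\<close>.
\<close>

lemma nn_integral_rational_moment:
  fixes A :: real and k :: nat
  assumes "A > 0"
  shows "(\<integral>\<^sup>+r. ennreal (r ^ (2 * k) / (1 + A * r\<^sup>2) ^ (k + 2)) * indicator {0..} r \<partial>lborel)
    = ennreal (pi / 4 * (pochhammer (1/2) k / fact (Suc k)) / (sqrt A * A ^ k))"
proof -
  have sA: "sqrt A \<noteq> 0" "sqrt A * sqrt A = A" using assms by auto
  have pos: "1 + A * r\<^sup>2 > 0" for r using assms by (simp add: add_pos_nonneg)
  hence nz: "1 + A * r\<^sup>2 \<noteq> 0" for r by (metis less_irrefl)
  define R where "R k = pi / 4 * (pochhammer (1/2) k / fact (Suc k)) / (sqrt A * A ^ k)" for k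
  have R_Suc: "R (Suc k) = (real (2 * k + 1) * R k - 0) / (real (2 * k + 4) * A)" for k
    using assms sA unfolding R_def by (simp add: pochhammer_Suc divide_simps) (simp add: algebra_simps)
  have "\<exists>F. (\<forall>r. DERIV F r :> r ^ (2 * k) / (1 + A * r\<^sup>2) ^ (k + 2)) \<and> (F \<longlongrightarrow> R k) at_top \<and> F 0 = 0"
  proof (induction k)
    case 0
    define F where "F r = 1/2 * (r / (1 + A * r\<^sup>2) + arctan (sqrt A * r) / sqrt A)" for r
    have "DERIV F r :> r ^ (2 * 0) / (1 + A * r\<^sup>2) ^ (0 + 2)" for r
    proof -
      have e: "1 + (sqrt A * r)\<^sup>2 = 1 + A * r\<^sup>2" using assms by (simp add: power_mult_distrib)
      have "DERIV F r :> (1/2 * ((1 * (1 + A * r\<^sup>2) - r * (0 + A * (2 * r))) / ((1 + A * r\<^sup>2) * (1 + A * r\<^sup>2))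
         + (inverse (1 + (sqrt A * r)\<^sup>2) * sqrt A) / sqrt A))" (is "DERIV F r :> ?D")
        unfolding F_def using nz[of r] sA by (auto intro!: derivative_eq_intros)
      also have "?D = r ^ (2 * 0) / (1 + A * r\<^sup>2) ^ (0 + 2)"
        unfolding e using nz[of r] sA by (simp add: divide_simps power2_eq_square)
      finally show ?thesis .
    qed
    moreover have "(F \<longlongrightarrow> 1/2 * (0 + (pi / 2) / sqrt A)) at_top"
      unfolding F_def
    proof (intro tendsto_intros)
      show "((\<lambda>r. r / (1 + A * r\<^sup>2)) \<longlongrightarrow> 0) at_top" using assms by real_asymp
      show "((\<lambda>r. arctan (sqrt A * r)) \<longlongrightarrow> pi / 2) at_top"
        using assms by (intro filterlim_compose[OF tendsto_arctan_at_top]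
          filterlim_tendsto_pos_mult_at_top[OF tendsto_const _ filterlim_ident]) auto
    qed (use sA in auto)
    moreover have "1/2 * (0 + (pi / 2) / sqrt A) = R 0" by (simp add: R_def)
    moreover have "F 0 = 0" by (simp add: F_def)
    ultimately show ?case by metis
  next
    case (Suc k)
    then obtain F where F: "\<And>r. DERIV F r :> r ^ (2 * k) / (1 + A * r\<^sup>2) ^ (k + 2)" 
      "(F \<longlongrightarrow> R k) at_top" "F 0 = 0" by blast
    define F' where "F' r = (real (2 * k + 1) * F r - r ^ (2 * k + 1) / (1 + A * r\<^sup>2) ^ (k + 2)) / (real (2 * k + 4) * A)" for r
    have "DERIV F' r :> r ^ (2 * Suc k) / (1 + A * r\<^sup>2) ^ (Suc k + 2)" for r
    proof -
      define u where "u = 1 + A * r\<^sup>2"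
      have u: "u \<noteq> 0" using nz[of r] by (simp add: u_def)
      have num: "DERIV (\<lambda>r. r ^ (2 * k + 1)) r :> real (2 * k + 1) * r ^ (2 * k)"
        using DERIV_pow[of "2 * k + 1" r] by simp
      have "DERIV (\<lambda>r. 1 + A * r\<^sup>2) r :> A * (2 * r)"
        by (auto intro!: derivative_eq_intros)
      from DERIV_power[OF this, of "k + 2"]
      have den: "DERIV (\<lambda>r. (1 + A * r\<^sup>2) ^ (k + 2)) r :> real (k + 2) * u ^ (k + 1) * (A * (2 * r))"
        by (simp add: u_def mult_ac)
      have "DERIV F' r :> (real (2 * k + 1) * (r ^ (2 * k) / u ^ (k + 2)) -
         ((real (2 * k + 1) * r ^ (2 * k)) * u ^ (k + 2) - r ^ (2 * k + 1) * (real (k + 2) * u ^ (k + 1) * (A * (2 * r)))) 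
          / (u ^ (k + 2) * u ^ (k + 2))) / (real (2 * k + 4) * A)" (is "DERIV F' r :> ?D")
        unfolding F'_def using DERIV_divide[OF num den] u F(1)[of r]
        by (intro DERIV_cdivide DERIV_diff DERIV_cmult) (simp_all add: u_def)
      also have "?D = r ^ (2 * Suc k) / u ^ (Suc k + 2)"
        using u assms by (simp add: divide_simps)
      finally show ?thesis unfolding u_def .
    qed
    moreover have "((\<lambda>r. r ^ (2 * k + 1) / (1 + A * r\<^sup>2) ^ (k + 2)) \<longlongrightarrow> 0) at_top"
    proof (rule tendsto_sandwich[of "\<lambda>_. 0" _ _ "\<lambda>r. (1 / A ^ (k + 2)) * (1 / r)"])
      show "\<forall>\<^sub>F r in at_top. 0 \<le> r ^ (2 * k + 1) / (1 + A * r\<^sup>2) ^ (k + 2)"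
        using pos by (intro eventually_mono[OF eventually_gt_at_top[of 0]]) (auto intro!: divide_nonneg_pos)
      show "\<forall>\<^sub>F r in at_top. r ^ (2 * k + 1) / (1 + A * r\<^sup>2) ^ (k + 2) \<le> (1 / A ^ (k + 2)) * (1 / r)"
        using eventually_gt_at_top[of 1]
      proof eventually_elim
        case (elim r)
        have "r ^ (2 * k + 1) / (1 + A * r\<^sup>2) ^ (k + 2) \<le> r ^ (2 * k + 3) / (A * r\<^sup>2) ^ (k + 2)"
          using elim assms by (intro frac_le power_mono power_increasing) auto
        also have "\<dots> = (1 / A ^ (k + 2)) * (1 / r)"
          using elim assms by (simp add: power_mult_distrib power_mult[symmetric] field_simps power_add[symmetric] power_Suc[symmetric] del: power_Suc)
        finally show ?case .
      qed
      show "((\<lambda>r. (1 / A ^ (k + 2)) * (1 / r)) \<longlongrightarrow> 0) at_top" by real_asymp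
    qed simp
    hence "(F' \<longlongrightarrow> R (Suc k)) at_top"
      unfolding R_Suc F'_def using assms by (intro tendsto_intros F) auto
    moreover have "F' 0 = 0" by (simp add: F'_def F)
    ultimately show ?case by blast
  qed
  then obtain F where F: "\<And>r. DERIV F r :> r ^ (2 * k) / (1 + A * r\<^sup>2) ^ (k + 2)" 
      "(F \<longlongrightarrow> R k) at_top" "F 0 = 0" by blast
  have "(\<integral>\<^sup>+r. ennreal (r ^ (2 * k) / (1 + A * r\<^sup>2) ^ (k + 2)) * indicator {0..} r \<partial>lborel) = ennreal (R k - F 0)"
    using F pos by (intro nn_integral_FTC_atLeast) (auto intro!: divide_nonneg_pos)
  thus ?thesis by (simp add: F R_def)
qed

text \<open>
  Completing the square turns the integrand times the standard normal density into a multiple of the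
  density with mean \<open>b / (1 + a)\<close> and variance \<open>1 / (1 + a)\<close>.
\<close>

lemma std_normal_integral_exp_quadratic:
  fixes a b :: real
  assumes a: "1 + a > 0"
  shows "(\<integral>t. exp (- a * t\<^sup>2 / 2 + b * t) \<partial>std_normal_distribution) = exp (b\<^sup>2 / (2 * (1 + a))) / sqrt (1 + a)"
proof -
  define \<mu> \<sigma> where "\<mu> = b / (1 + a)" and "\<sigma> = 1 / sqrt (1 + a)"
  have \<sigma>: "\<sigma> > 0" "\<sigma>\<^sup>2 = 1 / (1 + a)" using a by (auto simp: \<sigma>_def power_divide)
  have e: "- t\<^sup>2 / 2 + (- a * t\<^sup>2 / 2 + b * t) = b\<^sup>2 / (2 * (1 + a)) + - (t - \<mu>)\<^sup>2 / (2 * \<sigma>\<^sup>2)" for t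
    unfolding \<sigma> \<mu>_def using a by (simp add: divide_simps) (simp add: algebra_simps power2_eq_square)
  have "(\<integral>t. exp (- a * t\<^sup>2 / 2 + b * t) \<partial>std_normal_distribution)
    = (\<integral>t. std_normal_density t * exp (- a * t\<^sup>2 / 2 + b * t) \<partial>lborel)"
    by (subst integral_density) auto
  also have "\<dots> = (\<integral>t. (exp (b\<^sup>2 / (2 * (1 + a))) / sqrt (1 + a)) * normal_density \<mu> \<sigma> t \<partial>lborel)"
  proof (intro Bochner_Integration.integral_cong refl)
    fix t :: real
    have "std_normal_density t * exp (- a * t\<^sup>2 / 2 + b * t) = 1 / sqrt (2 * pi) * exp (- t\<^sup>2 / 2 + (- a * t\<^sup>2 / 2 + b * t))"
      unfolding std_normal_density_def exp_add by simp
    also have "\<dots> = 1 / sqrt (2 * pi) * (exp (b\<^sup>2 / (2 * (1 + a))) * exp (- (t - \<mu>)\<^sup>2 / (2 * \<sigma>\<^sup>2)))"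
      unfolding e exp_add ..
    also have "1 / sqrt (2 * pi) = 1 / sqrt (1 + a) * (1 / sqrt (2 * pi * \<sigma>\<^sup>2))"
      unfolding \<sigma> using a by (simp add: real_sqrt_mult real_sqrt_divide)
    finally show "std_normal_density t * exp (- a * t\<^sup>2 / 2 + b * t)
       = (exp (b\<^sup>2 / (2 * (1 + a))) / sqrt (1 + a)) * normal_density \<mu> \<sigma> t"
      by (simp add: normal_density_def)
  qed
  also have "\<dots> = exp (b\<^sup>2 / (2 * (1 + a))) / sqrt (1 + a)"
    using integral_normal_density[OF \<sigma>(1)] by simp
  finally show ?thesis .
qed

section \<open>Circular Gaussian pairs\<close>

lemma integrable_mult_of_squares:
  fixes f g :: "'a \<Rightarrow> real"
  assumes [measurable]: "f \<in> borel_measurable M" "g \<in> borel_measurable M"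
    and "integrable M (\<lambda>\<omega>. (f \<omega>)\<^sup>2)" "integrable M (\<lambda>\<omega>. (g \<omega>)\<^sup>2)"
  shows "integrable M (\<lambda>\<omega>. f \<omega> * g \<omega>)"
proof (rule Bochner_Integration.integrable_bound[of _ "\<lambda>\<omega>. (f \<omega>)\<^sup>2 + (g \<omega>)\<^sup>2"])
  show "integrable M (\<lambda>\<omega>. (f \<omega>)\<^sup>2 + (g \<omega>)\<^sup>2)" using assms by simp
  have "\<bar>f \<omega> * g \<omega>\<bar> \<le> (f \<omega>)\<^sup>2 + (g \<omega>)\<^sup>2" for \<omega>
    using sum_squares_bound[of "\<bar>f \<omega>\<bar>" "\<bar>g \<omega>\<bar>"] abs_ge_zero[of "f \<omega> * g \<omega>"]
    unfolding abs_mult power2_abs by linarith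
  thus "AE \<omega> in M. norm (f \<omega> * g \<omega>) \<le> norm ((f \<omega>)\<^sup>2 + (g \<omega>)\<^sup>2)" by simp
qed measurable

text \<open>
  The second moment is the limit of the second difference quotients of the characteristic function
  at \<open>0\<close>. Fatou's lemma gives integrability, after which dominated convergence applies since
  \<open>2 n\<^sup>2 (1 - cos (y / n)) \<le> y\<^sup>2\<close>.
\<close>

lemma (in prob_space) second_moment_of_gaussian_char:
  fixes X :: "'a \<Rightarrow> real"
  assumes [measurable]: "X \<in> borel_measurable M"
    and char: "\<And>u. (\<integral>\<omega>. exp (\<i> * of_real (u * X \<omega>)) \<partial>M) = of_real (exp (- (u\<^sup>2 * v / 2)))"
  shows "integrable M (\<lambda>\<omega>. (X \<omega>)\<^sup>2)" "(\<integral>\<omega>. (X \<omega>)\<^sup>2 \<partial>M) = v"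
proof -
  define h where "h n y = 2 * (real (Suc n))\<^sup>2 * (1 - cos (y / real (Suc n)))" for n y
  have [measurable]: "h n \<in> borel_measurable borel" for n unfolding h_def by measurable
  have h_eq: "h n y = (2 * real (Suc n) * sin (y / (2 * real (Suc n))))\<^sup>2" for n y
  proof -
    have "2 * (y / (2 * real (Suc n))) = y / real (Suc n)" by (simp add: field_simps)
    with cos_double_sin[of "y / (2 * real (Suc n))"] show ?thesis
      by (simp add: h_def power_mult_distrib del: of_nat_Suc)
  qed
  have h_nonneg: "h n y \<ge> 0" for n y unfolding h_eq by simp
  have h_le: "h n y \<le> y\<^sup>2" for n y
  proof -
    have "\<bar>2 * real (Suc n) * sin (y / (2 * real (Suc n)))\<bar> \<le> 2 * real (Suc n) * \<bar>y / (2 * real (Suc n))\<bar>"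
      unfolding abs_mult using abs_sin_x_le_abs_x[of "y / (2 * real (Suc n))"] by (intro mult_mono) auto
    also have "\<dots> = \<bar>y\<bar>" by (simp add: abs_mult)
    finally show ?thesis unfolding h_eq by (rule abs_le_square_iff[THEN iffD1])
  qed
  have h_lim: "(\<lambda>n. h n y) \<longlonglongrightarrow> y\<^sup>2" for y
  proof -
    have "(\<lambda>n. 2 * real (Suc n) * sin (y / (2 * real (Suc n)))) \<longlonglongrightarrow> y"
      by real_asymp
    thus ?thesis unfolding h_eq by (intro tendsto_intros)
  qed
  have cos_E: "(\<integral>\<omega>. cos (u * X \<omega>) \<partial>M) = exp (- (u\<^sup>2 * v / 2))" for u
  proof -
    have "integrable M (\<lambda>\<omega>. exp (\<i> * of_real (u * X \<omega>)))"
      by (intro integrable_const_bound[where B=1]) (auto simp: norm_exp_i_times)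
    hence "(\<integral>\<omega>. Re (exp (\<i> * of_real (u * X \<omega>))) \<partial>M) = exp (- (u\<^sup>2 * v / 2))"
      by (subst integral_Re) (simp_all only: char Re_complex_of_real)
    thus ?thesis by (simp add: Re_exp)
  qed
  have int_cos: "integrable M (\<lambda>\<omega>. cos (u * X \<omega>))" for u
    by (intro integrable_const_bound[where B=1]) auto
  have h_E: "(\<integral>\<omega>. h n (X \<omega>) \<partial>M) = 2 * (real (Suc n))\<^sup>2 * (1 - exp (- ((1 / real (Suc n))\<^sup>2 * v / 2)))" for n
    using int_cos[of "1 / real (Suc n)"] cos_E[of "1 / real (Suc n)"]
    by (simp add: h_def prob_space)
  have h_int: "integrable M (\<lambda>\<omega>. h n (X \<omega>))" for n
    using int_cos[of "1 / real (Suc n)"] by (simp add: h_def)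
  have h_E_lim: "(\<lambda>n. \<integral>\<omega>. h n (X \<omega>) \<partial>M) \<longlonglongrightarrow> v"
    unfolding h_E by real_asymp
  have "(\<integral>\<^sup>+\<omega>. ennreal ((X \<omega>)\<^sup>2) \<partial>M) = (\<integral>\<^sup>+\<omega>. liminf (\<lambda>n. ennreal (h n (X \<omega>))) \<partial>M)"
    by (intro nn_integral_cong lim_imp_Liminf[symmetric] tendsto_ennrealI h_lim) simp
  also have "\<dots> \<le> liminf (\<lambda>n. \<integral>\<^sup>+\<omega>. ennreal (h n (X \<omega>)) \<partial>M)"
    by (rule nn_integral_liminf) measurable
  also have "\<dots> = liminf (\<lambda>n. ennreal (\<integral>\<omega>. h n (X \<omega>) \<partial>M))"
    by (simp add: nn_integral_eq_integral[OF h_int] h_nonneg)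
  also have "\<dots> = ennreal v"
    by (intro lim_imp_Liminf tendsto_ennrealI h_E_lim) simp
  finally have "(\<integral>\<^sup>+\<omega>. ennreal ((X \<omega>)\<^sup>2) \<partial>M) < \<infinity>"
    by (rule order_le_less_trans) simp
  thus int: "integrable M (\<lambda>\<omega>. (X \<omega>)\<^sup>2)"
    by (intro integrableI_bounded) (auto simp: ennreal_power)
  have "(\<lambda>n. \<integral>\<omega>. h n (X \<omega>) \<partial>M) \<longlonglongrightarrow> (\<integral>\<omega>. (X \<omega>)\<^sup>2 \<partial>M)"
    using int h_le h_nonneg h_lim
    by (intro integral_dominated_convergence[where w="\<lambda>\<omega>. (X \<omega>)\<^sup>2"]) auto
  thus "(\<integral>\<omega>. (X \<omega>)\<^sup>2 \<partial>M) = v" using h_E_lim LIMSEQ_unique by blast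
qed

text \<open>
  The Gaussian \<open>exp (- x\<^sup>2 / 2)\<close> is the characteristic function of the standard normal law at \<open>x\<close>.
  This is how expectations of Gaussians of \<open>X\<close> are reduced to characteristic functions.
\<close>

lemma (in prob_space) gaussian_randomisation:
  fixes X :: "'a \<Rightarrow> real" and V :: "'a \<Rightarrow> complex"
  assumes [measurable]: "X \<in> borel_measurable M" "V \<in> borel_measurable M"
    and V: "\<And>\<omega>. norm (V \<omega>) \<le> 1"
  shows "(\<integral>\<omega>. V \<omega> * of_real (exp (- (X \<omega>)\<^sup>2 / 2)) \<partial>M)
    = (\<integral>t. (\<integral>\<omega>. V \<omega> * exp (\<i> * of_real (t * X \<omega>)) \<partial>M) \<partial>std_normal_distribution)"
proof -
  interpret N: real_distribution std_normal_distribution by (rule real_dist_normal_dist)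
  interpret P: pair_prob_space M std_normal_distribution ..
  have [measurable]: "(\<lambda>(\<omega>, t). V \<omega> * exp (\<i> * of_real (t * X \<omega>))) \<in> borel_measurable (M \<Otimes>\<^sub>M std_normal_distribution)"
    by measurable
  have "integrable (M \<Otimes>\<^sub>M std_normal_distribution) (\<lambda>(\<omega>, t). V \<omega> * exp (\<i> * of_real (t * X \<omega>)))"
    using V by (intro P.P.integrable_const_bound[where B=1]) (auto simp: norm_mult norm_exp_i_times)
  from P.Fubini_integral[OF this]
  have "(\<integral>t. (\<integral>\<omega>. V \<omega> * exp (\<i> * of_real (t * X \<omega>)) \<partial>M) \<partial>std_normal_distribution)
     = (\<integral>\<omega>. (\<integral>t. V \<omega> * exp (\<i> * of_real (t * X \<omega>)) \<partial>std_normal_distribution) \<partial>M)" .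
  also have "\<dots> = (\<integral>\<omega>. V \<omega> * of_real (exp (- (X \<omega>)\<^sup>2 / 2)) \<partial>M)"
  proof (intro Bochner_Integration.integral_cong refl)
    fix \<omega>
    have "(\<integral>t. V \<omega> * exp (\<i> * of_real (t * X \<omega>)) \<partial>std_normal_distribution)
       = V \<omega> * char std_normal_distribution (X \<omega>)"
      by (simp add: char_def mult.commute)
    thus "(\<integral>t. V \<omega> * exp (\<i> * of_real (t * X \<omega>)) \<partial>std_normal_distribution)
       = V \<omega> * of_real (exp (- (X \<omega>)\<^sup>2 / 2))"
      by (simp add: char_std_normal_distribution)
  qed
  finally show ?thesis ..
qed

text \<open>
  The exponent involves \<open>c1\<close> and \<open>c2\<close> only through a Hermitian form, so the law does not change
  when both variables are multiplied by the same unimodular constant; hence "circular". Degenerate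
  pairs are admitted.
\<close>

locale circular_gaussian_pair = prob_space M
  for M :: "'a measure" +
  fixes W1 W2 :: "'a \<Rightarrow> complex" and A B :: real and D :: complex
  assumes W_measurable [measurable]: "W1 \<in> borel_measurable M" "W2 \<in> borel_measurable M"
    and joint_char: "\<And>c1 c2. (\<integral>\<omega>. exp (\<i> * of_real (Re (c1 * W1 \<omega> + c2 * W2 \<omega>))) \<partial>M)
      = of_real (exp (- ((cmod c1)\<^sup>2 * A + (cmod c2)\<^sup>2 * B + 2 * Re (c1 * cnj c2 * D)) / 4))"
begin

lemma linear_form_second_moment:
  "integrable M (\<lambda>\<omega>. (Re (c1 * W1 \<omega> + c2 * W2 \<omega>))\<^sup>2)"
  "(\<integral>\<omega>. (Re (c1 * W1 \<omega> + c2 * W2 \<omega>))\<^sup>2 \<partial>M)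
     = ((cmod c1)\<^sup>2 * A + (cmod c2)\<^sup>2 * B + 2 * Re (c1 * cnj c2 * D)) / 2"
proof -
  have "(\<integral>\<omega>. exp (\<i> * of_real (u * Re (c1 * W1 \<omega> + c2 * W2 \<omega>))) \<partial>M)
    = of_real (exp (- (u\<^sup>2 * (((cmod c1)\<^sup>2 * A + (cmod c2)\<^sup>2 * B + 2 * Re (c1 * cnj c2 * D)) / 2) / 2)))" for u
  proof -
    have e: "u * Re (c1 * W1 \<omega> + c2 * W2 \<omega>) = Re ((of_real u * c1) * W1 \<omega> + (of_real u * c2) * W2 \<omega>)" for \<omega>
      by (simp add: algebra_simps)
    have n: "(cmod (of_real u * c))\<^sup>2 = u\<^sup>2 * (cmod c)\<^sup>2" for c
      by (simp add: norm_mult power_mult_distrib)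
    have r: "Re ((of_real u * c1) * cnj (of_real u * c2) * D) = u\<^sup>2 * Re (c1 * cnj c2 * D)"
      by (simp add: power2_eq_square algebra_simps)
    define d where "d = Re (c1 * cnj c2 * D)"
    show ?thesis unfolding e joint_char n r d_def[symmetric] by (simp add: field_simps)
  qed
  note * = second_moment_of_gaussian_char[OF _ this]
  show "integrable M (\<lambda>\<omega>. (Re (c1 * W1 \<omega> + c2 * W2 \<omega>))\<^sup>2)" by (rule *) measurable
  show "(\<integral>\<omega>. (Re (c1 * W1 \<omega> + c2 * W2 \<omega>))\<^sup>2 \<partial>M)
     = ((cmod c1)\<^sup>2 * A + (cmod c2)\<^sup>2 * B + 2 * Re (c1 * cnj c2 * D)) / 2" by (rule *) measurable
qed

lemma form_nonneg: "(cmod c1)\<^sup>2 * A + (cmod c2)\<^sup>2 * B + 2 * Re (c1 * cnj c2 * D) \<ge> 0"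
proof -
  have "(\<integral>\<omega>. (Re (c1 * W1 \<omega> + c2 * W2 \<omega>))\<^sup>2 \<partial>M) \<ge> 0" by simp
  thus ?thesis unfolding linear_form_second_moment(2) by simp
qed

lemma A_nonneg: "A \<ge> 0" and B_nonneg: "B \<ge> 0"
  using form_nonneg[of 1 0] form_nonneg[of 0 1] by auto

text \<open>
  The determinant of a positive semidefinite form is nonnegative. The form is evaluated at
  \<open>(- B, D)\<close> and at \<open>(- cnj D, A)\<close>, which settles the cases \<open>B > 0\<close> and \<open>A > 0\<close>.
\<close>

lemma cross_moment_bound: "(cmod D)\<^sup>2 \<le> A * B"
proof -
  have 1: "B * (A * B - (cmod D)\<^sup>2) \<ge> 0"
    using form_nonneg[of "- of_real B" D]
    by (simp add: power2_eq_square[of B] cmod_power2) (simp add: algebra_simps power2_eq_square)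
  have 2: "A * (A * B - (cmod D)\<^sup>2) \<ge> 0"
    using form_nonneg[of "- cnj D" "of_real A"]
    by (simp add: power2_eq_square[of A] cmod_power2) (simp add: algebra_simps power2_eq_square)
  show ?thesis
  proof (cases "A = 0 \<and> B = 0")
    case True
    have "Re (- cnj D * cnj 1 * D) = - (cmod D)\<^sup>2"
      unfolding cmod_power2 by (simp add: power2_eq_square)
    from form_nonneg[of "- cnj D" 1, unfolded this] True show ?thesis by simp
  next
    case False
    with A_nonneg B_nonneg have "A > 0 \<or> B > 0" by auto
    with 1 2 show ?thesis by (auto simp: zero_le_mult_iff)
  qed
qed

lemma real_moments:
  shows "integrable M (\<lambda>\<omega>. (Re (W1 \<omega>))\<^sup>2)" "integrable M (\<lambda>\<omega>. (Im (W1 \<omega>))\<^sup>2)"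
    and "integrable M (\<lambda>\<omega>. (Re (W2 \<omega>))\<^sup>2)" "integrable M (\<lambda>\<omega>. (Im (W2 \<omega>))\<^sup>2)"
    and "(\<integral>\<omega>. (Re (W1 \<omega>))\<^sup>2 \<partial>M) = A / 2" "(\<integral>\<omega>. (Im (W1 \<omega>))\<^sup>2 \<partial>M) = A / 2"
    and "(\<integral>\<omega>. (Re (W2 \<omega>))\<^sup>2 \<partial>M) = B / 2" "(\<integral>\<omega>. (Im (W2 \<omega>))\<^sup>2 \<partial>M) = B / 2"
  using linear_form_second_moment[of 1 0] linear_form_second_moment[of \<i> 0]
    linear_form_second_moment[of 0 1] linear_form_second_moment[of 0 \<i>] by simp_all

lemma abs_squares:
  shows "integrable M (\<lambda>\<omega>. (cmod (W1 \<omega>))\<^sup>2)" "(\<integral>\<omega>. (cmod (W1 \<omega>))\<^sup>2 \<partial>M) = A"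
    and "integrable M (\<lambda>\<omega>. (cmod (W2 \<omega>))\<^sup>2)" "(\<integral>\<omega>. (cmod (W2 \<omega>))\<^sup>2 \<partial>M) = B"
  unfolding cmod_power2 using real_moments by simp_all

lemma product_from_square:
  fixes f g :: "'a \<Rightarrow> real"
  assumes [measurable]: "f \<in> borel_measurable M" "g \<in> borel_measurable M"
    and f: "integrable M (\<lambda>\<omega>. (f \<omega>)\<^sup>2)" and g: "integrable M (\<lambda>\<omega>. (g \<omega>)\<^sup>2)"
  shows "(\<integral>\<omega>. f \<omega> * g \<omega> \<partial>M) 
    = ((\<integral>\<omega>. (f \<omega> + g \<omega>)\<^sup>2 \<partial>M) - (\<integral>\<omega>. (f \<omega>)\<^sup>2 \<partial>M) - (\<integral>\<omega>. (g \<omega>)\<^sup>2 \<partial>M)) / 2"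
  using integrable_mult_of_squares[OF assms] f g by (simp add: power2_sum mult.assoc)

text \<open>
  Polarisation: the second moments of \<open>Re (c1 W1 + c2 W2)\<close> with \<open>c1\<close> and \<open>c2\<close> chosen among
  \<open>1\<close> and \<open>- \<i>\<close> determine the four mixed moments of real and imaginary parts.
\<close>

lemma cross_moment: "(\<integral>\<omega>. W1 \<omega> * cnj (W2 \<omega>) \<partial>M) = D"
proof -
  note m = real_moments
  have rr: "(\<integral>\<omega>. Re (W1 \<omega>) * Re (W2 \<omega>) \<partial>M) = Re D / 2"
    using linear_form_second_moment(2)[of 1 1] product_from_square[of "\<lambda>\<omega>. Re (W1 \<omega>)" "\<lambda>\<omega>. Re (W2 \<omega>)"] m by simp
  have ii: "(\<integral>\<omega>. Im (W1 \<omega>) * Im (W2 \<omega>) \<partial>M) = Re D / 2"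
    using linear_form_second_moment(2)[of "-\<i>" "-\<i>"] product_from_square[of "\<lambda>\<omega>. Im (W1 \<omega>)" "\<lambda>\<omega>. Im (W2 \<omega>)"] m by simp
  have ir: "(\<integral>\<omega>. Im (W1 \<omega>) * Re (W2 \<omega>) \<partial>M) = Im D / 2"
    using linear_form_second_moment(2)[of "-\<i>" "1"] product_from_square[of "\<lambda>\<omega>. Im (W1 \<omega>)" "\<lambda>\<omega>. Re (W2 \<omega>)"] m by (simp add: add.commute)
  have ri: "(\<integral>\<omega>. Re (W1 \<omega>) * Im (W2 \<omega>) \<partial>M) = - Im D / 2"
    using linear_form_second_moment(2)[of "1" "-\<i>"] product_from_square[of "\<lambda>\<omega>. Re (W1 \<omega>)" "\<lambda>\<omega>. Im (W2 \<omega>)"] m by simp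
  have i: "integrable M (\<lambda>\<omega>. Re (W1 \<omega>) * Re (W2 \<omega>))" "integrable M (\<lambda>\<omega>. Im (W1 \<omega>) * Im (W2 \<omega>))"
    "integrable M (\<lambda>\<omega>. Im (W1 \<omega>) * Re (W2 \<omega>))" "integrable M (\<lambda>\<omega>. Re (W1 \<omega>) * Im (W2 \<omega>))"
    by (intro integrable_mult_of_squares m; measurable)+
  have e: "W1 \<omega> * cnj (W2 \<omega>) = of_real (Re (W1 \<omega>) * Re (W2 \<omega>) + Im (W1 \<omega>) * Im (W2 \<omega>))
     + \<i> * of_real (Im (W1 \<omega>) * Re (W2 \<omega>) - Re (W1 \<omega>) * Im (W2 \<omega>))" for \<omega>
    by (simp add: complex_eq_iff)
  have "(\<integral>\<omega>. W1 \<omega> * cnj (W2 \<omega>) \<partial>M) = of_real (\<integral>\<omega>. Re (W1 \<omega>) * Re (W2 \<omega>) + Im (W1 \<omega>) * Im (W2 \<omega>) \<partial>M)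
     + \<i> * of_real (\<integral>\<omega>. Im (W1 \<omega>) * Re (W2 \<omega>) - Re (W1 \<omega>) * Im (W2 \<omega>) \<partial>M)"
    unfolding e using i
    by (subst Bochner_Integration.integral_add) (auto simp del: of_real_add of_real_diff of_real_mult)
  also have "\<dots> = D" using i by (simp add: rr ii ir ri complex_eq_iff)
  finally show ?thesis .
qed

text \<open>
  Each of the four real coordinates is randomised by its own standard normal variable. The inner
  expectation is then a value of the joint characteristic function, at \<open>c1 = sqrt 2 r (t1 + i t2)\<close>
  and \<open>c2 = sqrt 2 s (t3 + i t4)\<close>, so that a four-fold Gaussian integral remains. The variables
  \<open>t1\<close>, \<open>t2\<close> are integrated first, with \<open>t3\<close>, \<open>t4\<close> fixed; the result is again Gaussian in
  \<open>t3\<close>, \<open>t4\<close>.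
\<close>

lemma laplace_transform:
  "(\<integral>\<omega>. exp (- (r * cmod (W1 \<omega>))\<^sup>2 - (s * cmod (W2 \<omega>))\<^sup>2) \<partial>M)
     = 1 / ((1 + A * r\<^sup>2) * (1 + B * s\<^sup>2) - r\<^sup>2 * s\<^sup>2 * (cmod D)\<^sup>2)"
proof -
  define p where "p = 1 + A * r\<^sup>2"
  \<comment> \<open>\<open>q\<close> is the Schur complement: the precision of \<open>t3\<close> and \<open>t4\<close> once \<open>t1\<close> and \<open>t2\<close> are
      integrated out\<close>
  define q where "q = 1 + B * s\<^sup>2 - r\<^sup>2 * s\<^sup>2 * (cmod D)\<^sup>2 / p"
  have p: "p > 0" using A_nonneg by (simp add: p_def add_pos_nonneg)
  have "r\<^sup>2 * s\<^sup>2 * (cmod D)\<^sup>2 \<le> r\<^sup>2 * s\<^sup>2 * (A * B)" by (intro mult_left_mono cross_moment_bound) simp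
  also have "\<dots> \<le> p * (B * s\<^sup>2)" using B_nonneg by (simp add: p_def algebra_simps)
  finally have q: "q > 0" using p by (simp add: q_def divide_le_eq field_simps)
  let ?N = std_normal_distribution
  \<comment> \<open>the signs at the imaginary parts match \<open>Re (\<i> * z) = - Im z\<close>\<close>
  let ?X1 = "\<lambda>\<omega>. sqrt 2 * r * Re (W1 \<omega>)" and ?X2 = "\<lambda>\<omega>. - sqrt 2 * r * Im (W1 \<omega>)"
  let ?X3 = "\<lambda>\<omega>. sqrt 2 * s * Re (W2 \<omega>)" and ?X4 = "\<lambda>\<omega>. - sqrt 2 * s * Im (W2 \<omega>)"
  let ?g = "\<lambda>X \<omega>. complex_of_real (exp (- (X \<omega>)\<^sup>2 / 2))"
  let ?e = "\<lambda>t X \<omega>. exp (\<i> * complex_of_real (t * X \<omega>))"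
  have innermost: "(\<integral>\<omega>. (?e t4 ?X4 \<omega> * ?e t3 ?X3 \<omega> * ?e t2 ?X2 \<omega>) * ?e t1 ?X1 \<omega> \<partial>M) =
     of_real (exp (- (B * s\<^sup>2) * (t3\<^sup>2 + t4\<^sup>2) / 2)
       * exp (- (A * r\<^sup>2) * t2\<^sup>2 / 2 + (r * s * Im (cnj (Complex t3 t4) * D)) * t2)
       * exp (- (A * r\<^sup>2) * t1\<^sup>2 / 2 + (- r * s * Re (cnj (Complex t3 t4) * D)) * t1))" for t1 t2 t3 t4
  proof -
    have "(\<integral>\<omega>. (?e t4 ?X4 \<omega> * ?e t3 ?X3 \<omega> * ?e t2 ?X2 \<omega>) * ?e t1 ?X1 \<omega> \<partial>M)
      = (\<integral>\<omega>. exp (\<i> * of_real (Re ((of_real (sqrt 2 * r) * Complex t1 t2) * W1 \<omega> + (of_real (sqrt 2 * s) * Complex t3 t4) * W2 \<omega>))) \<partial>M)"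
      by (intro Bochner_Integration.integral_cong refl) (simp add: exp_add[symmetric] algebra_simps)
    also have "\<dots> = of_real (exp (- (B * s\<^sup>2) * (t3\<^sup>2 + t4\<^sup>2) / 2
       + (- (A * r\<^sup>2) * t2\<^sup>2 / 2 + (r * s * Im (cnj (Complex t3 t4) * D)) * t2)
       + (- (A * r\<^sup>2) * t1\<^sup>2 / 2 + (- r * s * Re (cnj (Complex t3 t4) * D)) * t1)))"
      unfolding joint_char
      by (intro arg_cong[where f="\<lambda>x. complex_of_real (exp x)"])
         (simp add: norm_mult power_mult_distrib cmod_power2 algebra_simps add_divide_distrib diff_divide_distrib)
    finally show ?thesis by (simp only: exp_add)
  qed
  have cm: "(Re (cnj (Complex t3 t4) * D))\<^sup>2 + (Im (cnj (Complex t3 t4) * D))\<^sup>2 = (t3\<^sup>2 + t4\<^sup>2) * (cmod D)\<^sup>2" for t3 t4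
  proof -
    have "(Re (cnj (Complex t3 t4) * D))\<^sup>2 + (Im (cnj (Complex t3 t4) * D))\<^sup>2 = (cmod (cnj (Complex t3 t4) * D))\<^sup>2"
      by (simp only: cmod_power2)
    also have "\<dots> = (cmod (Complex t3 t4))\<^sup>2 * (cmod D)\<^sup>2" by (simp add: norm_mult power_mult_distrib)
    finally show ?thesis by (simp add: cmod_power2)
  qed
  have inner: "(\<integral>t2. (\<integral>t1. (\<integral>\<omega>. (?e t4 ?X4 \<omega> * ?e t3 ?X3 \<omega> * ?e t2 ?X2 \<omega>) * ?e t1 ?X1 \<omega> \<partial>M) \<partial>?N) \<partial>?N) =
     of_real (exp (- (q - 1) * t4\<^sup>2 / 2 + 0 * t4) * exp (- (q - 1) * t3\<^sup>2 / 2 + 0 * t3) / p)" for t3 t4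
  proof -
    define e where "e = cnj (Complex t3 t4) * D"
    have "(\<integral>t2. (\<integral>t1. (\<integral>\<omega>. (?e t4 ?X4 \<omega> * ?e t3 ?X3 \<omega> * ?e t2 ?X2 \<omega>) * ?e t1 ?X1 \<omega> \<partial>M) \<partial>?N) \<partial>?N) =
      of_real (exp (- (B * s\<^sup>2) * (t3\<^sup>2 + t4\<^sup>2) / 2) * (exp ((r * s * Im e)\<^sup>2 / (2 * p)) / sqrt p)
         * (exp ((- r * s * Re e)\<^sup>2 / (2 * p)) / sqrt p))"
      unfolding innermost e_def[symmetric]
      using p std_normal_integral_exp_quadratic[of "A * r\<^sup>2", unfolded p_def[symmetric]]
      by (simp only: integral_complex_of_real integral_mult_right_zero integral_mult_left_zero)
    also have "\<dots> = of_real (exp (- (B * s\<^sup>2) * (t3\<^sup>2 + t4\<^sup>2) / 2 + ((r * s * Im e)\<^sup>2 / (2 * p) + (- r * s * Re e)\<^sup>2 / (2 * p))) / p)"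
      using p unfolding exp_add by simp
    also have "(r * s * Im e)\<^sup>2 / (2 * p) + (- r * s * Re e)\<^sup>2 / (2 * p) = r\<^sup>2 * s\<^sup>2 / (2 * p) * ((t3\<^sup>2 + t4\<^sup>2) * (cmod D)\<^sup>2)"
      unfolding cm[symmetric] e_def[symmetric] by (simp add: power_mult_distrib algebra_simps add_divide_distrib)
    also have "- (B * s\<^sup>2) * (t3\<^sup>2 + t4\<^sup>2) / 2 + r\<^sup>2 * s\<^sup>2 / (2 * p) * ((t3\<^sup>2 + t4\<^sup>2) * (cmod D)\<^sup>2)
      = (- (q - 1) * t4\<^sup>2 / 2 + 0 * t4) + (- (q - 1) * t3\<^sup>2 / 2 + 0 * t3)"
      unfolding q_def using p by (simp add: field_simps)
    finally show ?thesis by (simp only: exp_add)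
  qed
  have "complex_of_real (\<integral>\<omega>. exp (- (r * cmod (W1 \<omega>))\<^sup>2 - (s * cmod (W2 \<omega>))\<^sup>2) \<partial>M)
    = (\<integral>\<omega>. (?g ?X1 \<omega> * ?g ?X2 \<omega> * ?g ?X3 \<omega>) * ?g ?X4 \<omega> \<partial>M)"
    unfolding integral_complex_of_real[symmetric]
    by (intro Bochner_Integration.integral_cong refl)
       (simp add: exp_add[symmetric] exp_of_real[symmetric] power_mult_distrib cmod_power2 algebra_simps)
  also have "\<dots> = (\<integral>t4. (\<integral>\<omega>. (?g ?X1 \<omega> * ?g ?X2 \<omega> * ?g ?X3 \<omega>) * ?e t4 ?X4 \<omega> \<partial>M) \<partial>?N)"
    by (rule gaussian_randomisation) (auto simp: norm_mult intro!: mult_le_one)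
  also have "\<dots> = (\<integral>t4. (\<integral>\<omega>. (?g ?X1 \<omega> * ?g ?X2 \<omega> * ?e t4 ?X4 \<omega>) * ?g ?X3 \<omega> \<partial>M) \<partial>?N)"
    by (simp only: mult_ac)
  also have "\<dots> = (\<integral>t4. (\<integral>t3. (\<integral>\<omega>. (?g ?X1 \<omega> * ?g ?X2 \<omega> * ?e t4 ?X4 \<omega>) * ?e t3 ?X3 \<omega> \<partial>M) \<partial>?N) \<partial>?N)"
    by (intro Bochner_Integration.integral_cong refl gaussian_randomisation)
       (auto simp: norm_mult intro!: mult_le_one)
  also have "\<dots> = (\<integral>t4. (\<integral>t3. (\<integral>\<omega>. (?g ?X1 \<omega> * ?e t4 ?X4 \<omega> * ?e t3 ?X3 \<omega>) * ?g ?X2 \<omega> \<partial>M) \<partial>?N) \<partial>?N)"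
    by (simp only: mult_ac)
  also have "\<dots> = (\<integral>t4. (\<integral>t3. (\<integral>t2. (\<integral>\<omega>. (?g ?X1 \<omega> * ?e t4 ?X4 \<omega> * ?e t3 ?X3 \<omega>) * ?e t2 ?X2 \<omega> \<partial>M) \<partial>?N) \<partial>?N) \<partial>?N)"
    by (intro Bochner_Integration.integral_cong refl gaussian_randomisation)
       (auto simp: norm_mult intro!: mult_le_one)
  also have "\<dots> = (\<integral>t4. (\<integral>t3. (\<integral>t2. (\<integral>\<omega>. (?e t4 ?X4 \<omega> * ?e t3 ?X3 \<omega> * ?e t2 ?X2 \<omega>) * ?g ?X1 \<omega> \<partial>M) \<partial>?N) \<partial>?N) \<partial>?N)"
    by (simp only: mult_ac)
  also have "\<dots> = (\<integral>t4. (\<integral>t3. (\<integral>t2. (\<integral>t1. (\<integral>\<omega>. (?e t4 ?X4 \<omega> * ?e t3 ?X3 \<omega> * ?e t2 ?X2 \<omega>) * ?e t1 ?X1 \<omega> \<partial>M) \<partial>?N) \<partial>?N) \<partial>?N) \<partial>?N)"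
    by (intro Bochner_Integration.integral_cong refl gaussian_randomisation)
       (auto simp: norm_mult intro!: mult_le_one)
  also have "\<dots> = of_real (1 / sqrt q * (1 / sqrt q) / p)"
    unfolding inner using q std_normal_integral_exp_quadratic[of "q - 1" 0]
    by (simp only: integral_complex_of_real integral_mult_right_zero integral_mult_left_zero integral_divide_zero)
       simp
  also have "1 / sqrt q * (1 / sqrt q) / p = 1 / (p * q)" using q by simp
  also have "p * q = p * (1 + B * s\<^sup>2) - r\<^sup>2 * s\<^sup>2 * (cmod D)\<^sup>2" using p by (simp add: q_def field_simps)
  finally show ?thesis unfolding p_def of_real_eq_iff .
qed

end

section \<open>The moduli of a circular Gaussian pair\<close>

text \<open>
  With \<open>y = \<bar>W\<bar>\<close> in the integral representation of \<open>sqrt \<pi> * y\<close>, the expectation and the integral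
  over \<open>r\<close> may be exchanged, and the hypothesis makes the inner expectation rational in \<open>r\<close>.
\<close>

lemma (in prob_space) nn_integral_cmod_of_laplace:
  assumes [measurable]: "W \<in> borel_measurable M" and A: "A > 0"
    and L: "\<And>r. (\<integral>\<omega>. exp (- (r * cmod (W \<omega>))\<^sup>2) \<partial>M) = 1 / (1 + A * r\<^sup>2)"
  shows "(\<integral>\<^sup>+\<omega>. ennreal (cmod (W \<omega>)) \<partial>M) = ennreal (sqrt (pi * A) / 2)"
proof -
  interpret P: pair_sigma_finite M lborel ..
  define K where "K r y = ennreal ((1 - exp (- (r * y)\<^sup>2)) / r\<^sup>2) * indicator {0..} r" for r y :: real
  have E: "(\<integral>\<^sup>+\<omega>. K r (cmod (W \<omega>)) \<partial>M) = ennreal (A / (1 + A * r\<^sup>2)) * indicator {0..} r" if "r \<noteq> 0" for r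
  proof -
    have p: "1 + A * r\<^sup>2 > 0" using A by (simp add: add_pos_nonneg)
    have i: "integrable M (\<lambda>\<omega>. exp (- (r * cmod (W \<omega>))\<^sup>2))"
      by (intro integrable_const_bound[where B=1]) auto
    have "(\<integral>\<^sup>+\<omega>. ennreal ((1 - exp (- (r * cmod (W \<omega>))\<^sup>2)) / r\<^sup>2) \<partial>M)
      = ennreal (\<integral>\<omega>. (1 - exp (- (r * cmod (W \<omega>))\<^sup>2)) / r\<^sup>2 \<partial>M)"
      using i by (intro nn_integral_eq_integral) auto
    also have "(\<integral>\<omega>. (1 - exp (- (r * cmod (W \<omega>))\<^sup>2)) / r\<^sup>2 \<partial>M) = (1 - 1 / (1 + A * r\<^sup>2)) / r\<^sup>2"
      using i L[of r] by (simp add: prob_space)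
    also have "\<dots> = A / (1 + A * r\<^sup>2)" 
    proof -
      have "1 - 1 / (1 + A * r\<^sup>2) = A * r\<^sup>2 / (1 + A * r\<^sup>2)" using p by (simp add: field_simps)
      thus ?thesis using that by simp
    qed
    finally show ?thesis unfolding K_def by (simp add: nn_integral_multc)
  qed
  have "ennreal (sqrt pi) * (\<integral>\<^sup>+\<omega>. ennreal (cmod (W \<omega>)) \<partial>M) = (\<integral>\<^sup>+\<omega>. ennreal (sqrt pi * cmod (W \<omega>)) \<partial>M)"
    by (simp add: ennreal_mult nn_integral_cmult)
  also have "\<dots> = (\<integral>\<^sup>+\<omega>. (\<integral>\<^sup>+r. K r (cmod (W \<omega>)) \<partial>lborel) \<partial>M)"
    unfolding K_def by (simp add: nn_integral_exp_kernel)
  also have "\<dots> = (\<integral>\<^sup>+r. (\<integral>\<^sup>+\<omega>. K r (cmod (W \<omega>)) \<partial>M) \<partial>lborel)"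
    unfolding K_def by (rule P.Fubini'[symmetric]) measurable
  also have "\<dots> = (\<integral>\<^sup>+r. ennreal (A / (1 + A * r\<^sup>2)) * indicator {0..} r \<partial>lborel)"
    using AE_lborel_singleton[of 0] by (intro nn_integral_cong_AE) (auto elim!: eventually_mono simp: E)
  also have "\<dots> = ennreal (sqrt A * (pi / 2))" by (rule nn_integral_lorentzian[OF A])
  finally have "ennreal (1 / sqrt pi) * (ennreal (sqrt pi) * (\<integral>\<^sup>+\<omega>. ennreal (cmod (W \<omega>)) \<partial>M))
     = ennreal (1 / sqrt pi) * ennreal (sqrt A * (pi / 2))" by simp
  moreover have "1 / sqrt pi * (sqrt A * (pi / 2)) = sqrt (pi * A) / 2"
  proof -
    have "pi = sqrt pi * sqrt pi" by simp
    thus ?thesis by (simp add: real_sqrt_mult field_simps)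
  qed
  ultimately show ?thesis
    using A by (simp add: mult.assoc[symmetric] ennreal_mult[symmetric])
qed

context circular_gaussian_pair
begin

text \<open>
  With \<open>p = 1 + A r\<^sup>2\<close>, \<open>q = 1 + B s\<^sup>2\<close> and \<open>z = r\<^sup>2 s\<^sup>2 \<bar>D\<bar>\<^sup>2 / (p q) < 1\<close>, the Laplace
  transform is \<open>1 / (p q (1 - z))\<close>. Its constant term combines with the three remaining expectations
  to \<open>(1 - 1/p) (1 - 1/q)\<close>, the product for independent moduli, and the higher powers of \<open>z\<close> give
  the series. In each summand the variables \<open>r\<close> and \<open>s\<close> are separated.
\<close>

lemma nn_integral_kernel_product:
  assumes rs: "r \<noteq> 0" "s \<noteq> 0" and strict: "(cmod D)\<^sup>2 < A * B"
  shows "(\<integral>\<^sup>+\<omega>. ennreal ((1 - exp (- (r * cmod (W1 \<omega>))\<^sup>2)) / r\<^sup>2) * ennreal ((1 - exp (- (s * cmod (W2 \<omega>))\<^sup>2)) / s\<^sup>2) \<partial>M)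
    = ennreal (A / (1 + A * r\<^sup>2)) * ennreal (B / (1 + B * s\<^sup>2))
      + (\<Sum>k. ennreal ((cmod D)\<^sup>2 ^ Suc k) * (ennreal (r ^ (2 * k) / (1 + A * r\<^sup>2) ^ (k + 2)) * ennreal (s ^ (2 * k) / (1 + B * s\<^sup>2) ^ (k + 2))))"
proof -
  define p q d where "p = 1 + A * r\<^sup>2" and "q = 1 + B * s\<^sup>2" and "d = (cmod D)\<^sup>2"
  have pq: "p > 0" "q > 0" using A_nonneg B_nonneg by (auto simp: p_def q_def add_pos_nonneg)
  have d: "d \<ge> 0" by (simp add: d_def)
  define z where "z = r\<^sup>2 * s\<^sup>2 * d / (p * q)"
  have "r\<^sup>2 * s\<^sup>2 * d \<le> r\<^sup>2 * s\<^sup>2 * (A * B)" using strict by (intro mult_left_mono) (auto simp: d_def)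
  also have "\<dots> < p * q"
  proof -
    have "p * q = 1 + A * r\<^sup>2 + B * s\<^sup>2 + r\<^sup>2 * s\<^sup>2 * (A * B)" by (simp add: p_def q_def algebra_simps)
    moreover have "A * r\<^sup>2 \<ge> 0" "B * s\<^sup>2 \<ge> 0" using A_nonneg B_nonneg by auto
    ultimately show ?thesis by linarith
  qed
  finally have less: "r\<^sup>2 * s\<^sup>2 * d < p * q" .
  hence z: "0 \<le> z" "z < 1" using pq d by (auto simp: z_def)
  have bounded: "integrable M (\<lambda>\<omega>. exp (- (a * cmod (W1 \<omega>))\<^sup>2 - (b * cmod (W2 \<omega>))\<^sup>2))" for a b
    by (intro integrable_const_bound[where B=1]) (auto simp: add_nonneg_nonneg)
  have b1: "integrable M (\<lambda>\<omega>. exp (- (r * cmod (W1 \<omega>))\<^sup>2))" and b2: "integrable M (\<lambda>\<omega>. exp (- (s * cmod (W2 \<omega>))\<^sup>2))"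
    using bounded[of r 0] bounded[of 0 s] by simp_all
  have L1: "(\<integral>\<omega>. exp (- (r * cmod (W1 \<omega>))\<^sup>2) \<partial>M) = 1 / p" and L2: "(\<integral>\<omega>. exp (- (s * cmod (W2 \<omega>))\<^sup>2) \<partial>M) = 1 / q"
    using laplace_transform[of r 0] laplace_transform[of 0 s] by (simp_all add: p_def q_def)
  let ?P = "\<lambda>\<omega>. (1 - exp (- (r * cmod (W1 \<omega>))\<^sup>2)) / r\<^sup>2 * ((1 - exp (- (s * cmod (W2 \<omega>))\<^sup>2)) / s\<^sup>2)"
  have e: "?P \<omega> = (1 - exp (- (r * cmod (W1 \<omega>))\<^sup>2) - exp (- (s * cmod (W2 \<omega>))\<^sup>2)
      + exp (- (r * cmod (W1 \<omega>))\<^sup>2 - (s * cmod (W2 \<omega>))\<^sup>2)) / (r\<^sup>2 * s\<^sup>2)" for \<omega>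
    by (simp add: exp_diff exp_minus divide_simps) (simp add: algebra_simps)
  have iP: "integrable M ?P" unfolding e using bounded[of r s] b1 b2 by simp
  have "(\<integral>\<omega>. ?P \<omega> \<partial>M) = (1 - 1 / p - 1 / q + 1 / (p * q - r\<^sup>2 * s\<^sup>2 * d)) / (r\<^sup>2 * s\<^sup>2)"
    unfolding e using bounded[of r s] b1 b2
    by (simp add: prob_space L1 L2 laplace_transform p_def q_def d_def)
  also have "1 / (p * q - r\<^sup>2 * s\<^sup>2 * d) = 1 / (p * q) + z / (p * q) * (1 / (1 - z))"
    using pq z less by (simp add: z_def divide_simps)
  also have "(1 - 1 / p - 1 / q + (1 / (p * q) + z / (p * q) * (1 / (1 - z)))) / (r\<^sup>2 * s\<^sup>2)
     = ((p - 1) / r\<^sup>2 / p) * ((q - 1) / s\<^sup>2 / q) + d / (p * q)\<^sup>2 * (1 / (1 - z))"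
  proof -
    have z': "z / (r\<^sup>2 * s\<^sup>2) = d / (p * q)" using rs pq by (simp add: z_def)
    have "(1 - 1 / p - 1 / q + (1 / (p * q) + z / (p * q) * (1 / (1 - z)))) / (r\<^sup>2 * s\<^sup>2)
       = (1 - 1 / p - 1 / q + 1 / (p * q)) / (r\<^sup>2 * s\<^sup>2) + (z / (r\<^sup>2 * s\<^sup>2)) / (p * q) * (1 / (1 - z))"
      by (simp add: add_divide_distrib diff_divide_distrib mult_ac)
    also have "1 - 1 / p - 1 / q + 1 / (p * q) = ((p - 1) / p) * ((q - 1) / q)"
      using pq by (simp add: field_simps)
    finally show ?thesis unfolding z' by (simp add: power2_eq_square mult_ac)
  qed
  also have "(p - 1) / r\<^sup>2 = A" using rs by (simp add: p_def)
  also have "(q - 1) / s\<^sup>2 = B" using rs by (simp add: q_def)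
  finally have EP: "(\<integral>\<omega>. ?P \<omega> \<partial>M) = A / p * (B / q) + d / (p * q)\<^sup>2 * (1 / (1 - z))" .
  have "(\<lambda>k. d / (p * q)\<^sup>2 * z ^ k) sums (d / (p * q)\<^sup>2 * (1 / (1 - z)))"
    using z by (intro sums_mult geometric_sums) auto
  moreover have "d / (p * q)\<^sup>2 * z ^ k = d ^ Suc k * (r ^ (2 * k) / p ^ (k + 2) * (s ^ (2 * k) / q ^ (k + 2)))" for k
    using pq by (simp add: z_def power_divide power_mult_distrib power_mult power_add power2_eq_square divide_simps)
  ultimately have S: "(\<lambda>k. d ^ Suc k * (r ^ (2 * k) / p ^ (k + 2) * (s ^ (2 * k) / q ^ (k + 2)))) sums (d / (p * q)\<^sup>2 * (1 / (1 - z)))"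
    by simp
  have nn: "0 \<le> r ^ (2 * k) / p ^ (k + 2)" "0 \<le> s ^ (2 * k) / q ^ (k + 2)" for k
    using pq by (auto simp: power_mult)
  have "(\<integral>\<^sup>+\<omega>. ennreal ((1 - exp (- (r * cmod (W1 \<omega>))\<^sup>2)) / r\<^sup>2) * ennreal ((1 - exp (- (s * cmod (W2 \<omega>))\<^sup>2)) / s\<^sup>2) \<partial>M)
     = (\<integral>\<^sup>+\<omega>. ennreal (?P \<omega>) \<partial>M)"
    by (intro nn_integral_cong ennreal_mult[symmetric]) auto
  also have "\<dots> = ennreal (\<integral>\<omega>. ?P \<omega> \<partial>M)" by (intro nn_integral_eq_integral iP) auto
  also have "\<dots> = ennreal (A / p) * ennreal (B / q) + ennreal (d / (p * q)\<^sup>2 * (1 / (1 - z)))"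
    unfolding EP using A_nonneg B_nonneg pq d z by (simp add: ennreal_mult[symmetric] ennreal_plus[symmetric] del: ennreal_plus)
  also have "ennreal (d / (p * q)\<^sup>2 * (1 / (1 - z)))
     = (\<Sum>k. ennreal (d ^ Suc k * (r ^ (2 * k) / p ^ (k + 2) * (s ^ (2 * k) / q ^ (k + 2)))))"
    unfolding sums_unique[OF S]
    by (intro suminf_ennreal2[symmetric] sums_summable[OF S] mult_nonneg_nonneg nn zero_le_power d)
  also have "\<dots> = (\<Sum>k. ennreal (d ^ Suc k) * (ennreal (r ^ (2 * k) / p ^ (k + 2)) * ennreal (s ^ (2 * k) / q ^ (k + 2))))"
    using d nn by (simp only: ennreal_mult zero_le_power mult_nonneg_nonneg)
  finally show ?thesis unfolding p_def q_def d_def .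
qed

text \<open>
  The integral representation is used for both moduli. All integrands are nonnegative, so the
  expectation is taken first and the separated series is integrated termwise afterwards; the
  \<open>k\<close>-th summand contributes \<open>\<bar>D\<bar>^(2k+2)\<close> times the rational moments for \<open>A\<close> and for \<open>B\<close>, which is
  the coefficient with index \<open>k + 1\<close> of \<open>2F1(-1/2, -1/2; 1; x)\<close> up to a common factor.
\<close>

lemma nn_integral_product_of_moduli:
  assumes strict: "(cmod D)\<^sup>2 < A * B"
  defines "x \<equiv> (cmod D)\<^sup>2 / (A * B)"
  shows "(\<integral>\<^sup>+\<omega>. ennreal (cmod (W1 \<omega>) * cmod (W2 \<omega>)) \<partial>M)
    = ennreal (pi / 4 * sqrt (A * B) * ((1 - x)\<^sup>2 * hyp2F1 (3/2) (3/2) 1 x))"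
proof -
  interpret P: pair_sigma_finite M lborel ..
  define H where "H = (1 - x)\<^sup>2 * hyp2F1 (3/2) (3/2) 1 x"
  have AB: "A > 0" "B > 0"
    using strict A_nonneg B_nonneg zero_le_power2[of "cmod D"]
    by (auto simp: less_le intro: ccontr)
  hence x: "0 \<le> x" "x < 1" using strict by (auto simp: x_def)
  define d where "d = (cmod D)\<^sup>2"
  define f where "f A k r = ennreal (r ^ (2 * k) / (1 + A * r\<^sup>2) ^ (k + 2)) * indicator {0..} r" for A r :: real and k :: nat
  define l where "l A r = ennreal (A / (1 + A * r\<^sup>2)) * indicator {0..} r" for A r :: real
  define R where "R A k = pi / 4 * (pochhammer (1/2) k / fact (Suc k)) / (sqrt A * A ^ k)" for A :: real and k :: nat
  have [measurable]: "f a k \<in> borel_measurable borel" "l a \<in> borel_measurable borel" for a k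
    unfolding f_def l_def by measurable
  have If: "(\<integral>\<^sup>+r. f a k r \<partial>lborel) = ennreal (R a k)" if "a > 0" for a k
    unfolding f_def R_def by (rule nn_integral_rational_moment[OF that])
  have Il: "(\<integral>\<^sup>+r. l a r \<partial>lborel) = ennreal (sqrt a * (pi / 2))" if "a > 0" for a
    unfolding l_def by (rule nn_integral_lorentzian[OF that])
  have R0: "R a k \<ge> 0" if "a > 0" for a k
    using that by (auto simp: R_def pochhammer_nonneg intro!: divide_nonneg_pos mult_nonneg_nonneg)
  define K where "K r y = ennreal ((1 - exp (- (r * y)\<^sup>2)) / r\<^sup>2) * indicator {0..} r" for r y :: real
  have [measurable]: "(\<lambda>(r, y). K r y) \<in> borel_measurable (borel \<Otimes>\<^sub>M borel)"
    unfolding K_def by measurable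
  have IK: "(\<integral>\<^sup>+r. K r y \<partial>lborel) = ennreal (sqrt pi * y)" if "y \<ge> 0" for y
    unfolding K_def by (rule nn_integral_exp_kernel[OF that])
  \<comment> \<open>the points \<open>r = 0\<close> and \<open>s = 0\<close>, where the kernels take the default value \<open>0\<close> of a division by
      \<open>0\<close>, form null sets\<close>
  have EK: "(\<integral>\<^sup>+\<omega>. K r (cmod (W1 \<omega>)) * K s (cmod (W2 \<omega>)) \<partial>M)
     = l A r * l B s + (\<Sum>k. ennreal (d ^ Suc k) * (f A k r * f B k s))" if "r \<noteq> 0" "s \<noteq> 0" for r s
  proof (cases "r \<ge> 0 \<and> s \<ge> 0")
    case True
    thus ?thesis using nn_integral_kernel_product[OF that strict] by (simp add: K_def l_def f_def d_def)
  next
    case False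
    thus ?thesis by (auto simp: K_def l_def f_def)
  qed
  have "ennreal pi * (\<integral>\<^sup>+\<omega>. ennreal (cmod (W1 \<omega>) * cmod (W2 \<omega>)) \<partial>M)
     = (\<integral>\<^sup>+\<omega>. ennreal (sqrt pi * cmod (W1 \<omega>)) * ennreal (sqrt pi * cmod (W2 \<omega>)) \<partial>M)"
  proof -
    have "ennreal (sqrt pi * a) * ennreal (sqrt pi * b) = ennreal pi * ennreal (a * b)" if "a \<ge> 0" "b \<ge> 0" for a b
    proof -
      have "(sqrt pi * a) * (sqrt pi * b) = (sqrt pi * sqrt pi) * (a * b)" by (simp only: mult_ac)
      thus ?thesis using that by (simp add: ennreal_mult[symmetric])
    qed
    thus ?thesis by (simp add: nn_integral_cmult)
  qed
  also have "\<dots> = (\<integral>\<^sup>+\<omega>. (\<integral>\<^sup>+r. (\<integral>\<^sup>+s. K r (cmod (W1 \<omega>)) * K s (cmod (W2 \<omega>)) \<partial>lborel) \<partial>lborel) \<partial>M)"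
    by (simp add: nn_integral_cmult nn_integral_multc IK)
  also have "\<dots> = (\<integral>\<^sup>+r. (\<integral>\<^sup>+\<omega>. (\<integral>\<^sup>+s. K r (cmod (W1 \<omega>)) * K s (cmod (W2 \<omega>)) \<partial>lborel) \<partial>M) \<partial>lborel)"
    by (rule P.Fubini'[symmetric]) measurable
  also have "\<dots> = (\<integral>\<^sup>+r. (\<integral>\<^sup>+s. (\<integral>\<^sup>+\<omega>. K r (cmod (W1 \<omega>)) * K s (cmod (W2 \<omega>)) \<partial>M) \<partial>lborel) \<partial>lborel)"
    by (intro nn_integral_cong P.Fubini'[symmetric]) measurable
  also have "\<dots> = (\<integral>\<^sup>+r. (\<integral>\<^sup>+s. l A r * l B s + (\<Sum>k. ennreal (d ^ Suc k) * (f A k r * f B k s)) \<partial>lborel) \<partial>lborel)"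
  proof (intro nn_integral_cong_AE)
    have "(\<integral>\<^sup>+s. (\<integral>\<^sup>+\<omega>. K r (cmod (W1 \<omega>)) * K s (cmod (W2 \<omega>)) \<partial>M) \<partial>lborel)
      = (\<integral>\<^sup>+s. l A r * l B s + (\<Sum>k. ennreal (d ^ Suc k) * (f A k r * f B k s)) \<partial>lborel)" if "r \<noteq> 0" for r
      using AE_lborel_singleton[of 0] that by (intro nn_integral_cong_AE) (auto elim!: eventually_mono simp: EK)
    thus "AE r in lborel. (\<integral>\<^sup>+s. (\<integral>\<^sup>+\<omega>. K r (cmod (W1 \<omega>)) * K s (cmod (W2 \<omega>)) \<partial>M) \<partial>lborel)
      = (\<integral>\<^sup>+s. l A r * l B s + (\<Sum>k. ennreal (d ^ Suc k) * (f A k r * f B k s)) \<partial>lborel)"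
      using AE_lborel_singleton[of 0] by (auto elim!: eventually_mono)
  qed
  also have "\<dots> = ennreal (sqrt A * (pi / 2)) * ennreal (sqrt B * (pi / 2)) + (\<Sum>k. ennreal (d ^ Suc k) * (ennreal (R A k) * ennreal (R B k)))"
    using AB by (simp add: nn_integral_add nn_integral_suminf nn_integral_cmult nn_integral_multc If Il del: power_Suc)
  also have "\<dots> = ennreal (pi\<^sup>2 / 4 * sqrt (A * B) * 1) + (\<Sum>k. ennreal (pi\<^sup>2 / 4 * sqrt (A * B) * (euler_coeff (Suc k) * x ^ Suc k)))"
  proof -
    have "sqrt A * (pi / 2) * (sqrt B * (pi / 2)) = pi\<^sup>2 / 4 * sqrt (A * B) * 1"
      by (simp add: real_sqrt_mult power2_eq_square)
    hence 1: "ennreal (sqrt A * (pi / 2)) * ennreal (sqrt B * (pi / 2)) = ennreal (pi\<^sup>2 / 4 * sqrt (A * B) * 1)"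
      using AB by (simp add: ennreal_mult[symmetric])
    have 2: "ennreal (d ^ Suc k) * (ennreal (R A k) * ennreal (R B k)) = ennreal (pi\<^sup>2 / 4 * sqrt (A * B) * (euler_coeff (Suc k) * x ^ Suc k))" for k
    proof -
      define g where "g = pochhammer (1/2::real) k / fact (Suc k)"
      have sq: "sqrt A * sqrt A = A" "sqrt B * sqrt B = B" using AB by auto
      have "d ^ Suc k * (R A k * R B k) = pi\<^sup>2 / 16 * g\<^sup>2 * (d ^ Suc k / ((sqrt A * sqrt B) * (A ^ k * B ^ k)))"
        unfolding R_def g_def[symmetric] by (simp add: power2_eq_square mult_ac)
      also have "d ^ Suc k / ((sqrt A * sqrt B) * (A ^ k * B ^ k)) = (sqrt A * sqrt B) * x ^ Suc k"
      proof -
        have x': "x ^ Suc k = d ^ Suc k / ((sqrt A * sqrt A) * (sqrt B * sqrt B) * (A ^ k * B ^ k))"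
          unfolding sq x_def d_def[symmetric] by (simp add: power_divide power_mult_distrib)
        have "u / ((a * b) * c) = (a * b) * (u / ((a * a) * (b * b) * c))" if "a \<noteq> 0" "b \<noteq> 0" for a b c u :: real
          using that by (simp add: divide_simps)
        from this[of "sqrt A" "sqrt B"] show ?thesis unfolding x' using AB by simp
      qed
      also have "pi\<^sup>2 / 16 * g\<^sup>2 * ((sqrt A * sqrt B) * x ^ Suc k) = pi\<^sup>2 / 4 * sqrt (A * B) * (euler_coeff (Suc k) * x ^ Suc k)"
        unfolding euler_coeff_Suc g_def[symmetric] by (simp add: real_sqrt_mult)
      finally have "d ^ Suc k * (R A k * R B k) = pi\<^sup>2 / 4 * sqrt (A * B) * (euler_coeff (Suc k) * x ^ Suc k)" .
      moreover have "ennreal (d ^ Suc k) * (ennreal (R A k) * ennreal (R B k)) = ennreal (d ^ Suc k * (R A k * R B k))"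
        using R0 AB by (simp only: ennreal_mult mult_nonneg_nonneg zero_le_power zero_le_power2 d_def)
      ultimately show ?thesis by (simp only:)
    qed
    show ?thesis unfolding 1 2 ..
  qed
  also have "\<dots> = ennreal (pi\<^sup>2 / 4 * sqrt (A * B) * H)"
  proof -
    define c where "c = pi\<^sup>2 / 4 * sqrt (A * B)"
    have c: "c \<ge> 0" using AB by (simp add: c_def)
    have "(\<lambda>k. euler_coeff k * x ^ k) sums H" unfolding H_def using x by (intro euler_transformation) simp
    hence "(\<lambda>k. euler_coeff (Suc k) * x ^ Suc k) sums (H - 1)"
      by (subst sums_Suc_iff) (simp add: euler_coeff_def)
    hence S: "(\<lambda>k. c * (euler_coeff (Suc k) * x ^ Suc k)) sums (c * (H - 1))" by (rule sums_mult)
    have n: "0 \<le> c * (euler_coeff (Suc k) * x ^ Suc k)" for k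
      using c x by (simp add: euler_coeff_def)
    have "(\<Sum>k. ennreal (c * (euler_coeff (Suc k) * x ^ Suc k))) = ennreal (c * (H - 1))"
      unfolding sums_unique[OF S] using S n by (intro suminf_ennreal2) (auto simp: sums_iff)
    moreover have "0 \<le> c * (H - 1)" unfolding sums_unique[OF S] using S n by (intro suminf_nonneg) (auto simp: sums_iff)
    ultimately show ?thesis unfolding c_def[symmetric] using c
      by (simp add: ennreal_plus[symmetric] algebra_simps del: ennreal_plus)
  qed
  finally have "ennreal (1 / pi) * (ennreal pi * (\<integral>\<^sup>+\<omega>. ennreal (cmod (W1 \<omega>) * cmod (W2 \<omega>)) \<partial>M))
    = ennreal (1 / pi) * ennreal (pi\<^sup>2 / 4 * sqrt (A * B) * H)" by simp
  moreover have "ennreal (1 / pi) * ennreal (pi\<^sup>2 / 4 * sqrt (A * B) * H) = ennreal (1 / pi * (pi\<^sup>2 / 4 * sqrt (A * B) * H))"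
    by (subst ennreal_mult') simp_all
  moreover have "1 / pi * (pi\<^sup>2 / 4 * sqrt (A * B) * H) = pi / 4 * sqrt (A * B) * H"
    by (simp add: power2_eq_square)
  moreover have "ennreal (1 / pi) * (ennreal pi * I) = I" for I
    by (simp add: mult.assoc[symmetric] ennreal_mult[symmetric])
  ultimately show ?thesis unfolding H_def[symmetric] by (simp only:)
qed

text \<open>
  The means of the moduli are \<open>sqrt (\<pi> A) / 2\<close> and \<open>sqrt (\<pi> B) / 2\<close>, and their variances are
  \<open>A (1 - \<pi>/4)\<close> and \<open>B (1 - \<pi>/4)\<close>.
\<close>

lemma covariance_of_moduli:
  assumes strict: "(cmod D)\<^sup>2 < A * B"
  defines "x \<equiv> (cmod D)\<^sup>2 / (A * B)"
  shows "covariance M (\<lambda>\<omega>. cmod (W1 \<omega>)) (\<lambda>\<omega>. cmod (W2 \<omega>))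
      = pi / 4 * sqrt (A * B) * ((1 - x)\<^sup>2 * hyp2F1 (3/2) (3/2) 1 x - 1)"
    and "correlation M (\<lambda>\<omega>. cmod (W1 \<omega>)) (\<lambda>\<omega>. cmod (W2 \<omega>))
      = inverse (4 / pi - 1) * ((1 - x)\<^sup>2 * hyp2F1 (3/2) (3/2) 1 x - 1)"
proof -
  define H where "H = (1 - x)\<^sup>2 * hyp2F1 (3/2) (3/2) 1 x"
  have AB: "A > 0" "B > 0"
    using strict A_nonneg B_nonneg zero_le_power2[of "cmod D"]
    by (auto simp: less_le intro: ccontr)
  have x: "0 \<le> x" "x < 1" using strict AB by (auto simp: x_def)
  have "(\<lambda>k. euler_coeff k * x ^ k) sums H" unfolding H_def using x by (intro euler_transformation) simp
  hence H0: "H \<ge> 0" using x by (auto simp: sums_iff euler_coeff_def intro!: suminf_nonneg)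
  have n1: "(\<integral>\<^sup>+\<omega>. ennreal (cmod (W1 \<omega>)) \<partial>M) = ennreal (sqrt (pi * A) / 2)"
    using AB laplace_transform[of _ 0] by (intro nn_integral_cmod_of_laplace) simp_all
  have n2: "(\<integral>\<^sup>+\<omega>. ennreal (cmod (W2 \<omega>)) \<partial>M) = ennreal (sqrt (pi * B) / 2)"
    using AB laplace_transform[of 0] by (intro nn_integral_cmod_of_laplace) simp_all
  have n12: "(\<integral>\<^sup>+\<omega>. ennreal (cmod (W1 \<omega>) * cmod (W2 \<omega>)) \<partial>M) = ennreal (pi / 4 * sqrt (A * B) * H)"
    unfolding H_def x_def by (rule nn_integral_product_of_moduli[OF strict])
  have b: "has_bochner_integral M (\<lambda>\<omega>. cmod (W1 \<omega>)) (sqrt (pi * A) / 2)"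
     "has_bochner_integral M (\<lambda>\<omega>. cmod (W2 \<omega>)) (sqrt (pi * B) / 2)"
     "has_bochner_integral M (\<lambda>\<omega>. cmod (W1 \<omega>) * cmod (W2 \<omega>)) (pi / 4 * sqrt (A * B) * H)"
    using n1 n2 n12 AB H0 by (intro has_bochner_integral_nn_integral; simp)+
  have cov: "covariance M X Y = (\<integral>\<omega>. X \<omega> * Y \<omega> \<partial>M) - (\<integral>\<omega>. X \<omega> \<partial>M) * (\<integral>\<omega>. Y \<omega> \<partial>M)"
    if "integrable M X" "integrable M Y" "integrable M (\<lambda>\<omega>. X \<omega> * Y \<omega>)" for X Y :: "'a \<Rightarrow> real"
  proof -
    have "covariance M X Y = (\<integral>\<omega>. X \<omega> * Y \<omega> - (\<integral>\<omega>. Y \<omega> \<partial>M) * X \<omega> - (\<integral>\<omega>. X \<omega> \<partial>M) * Y \<omega>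
       + (\<integral>\<omega>. X \<omega> \<partial>M) * (\<integral>\<omega>. Y \<omega> \<partial>M) \<partial>M)"
      unfolding covariance_def by (intro Bochner_Integration.integral_cong refl) (simp add: algebra_simps)
    also have "\<dots> = (\<integral>\<omega>. X \<omega> * Y \<omega> \<partial>M) - (\<integral>\<omega>. X \<omega> \<partial>M) * (\<integral>\<omega>. Y \<omega> \<partial>M)"
      using that by (simp add: prob_space)
    finally show ?thesis .
  qed
  have ev12: "pi / 4 * sqrt (A * B) * H - sqrt (pi * A) / 2 * (sqrt (pi * B) / 2) = pi / 4 * sqrt (A * B) * (H - 1)"
    by (simp add: real_sqrt_mult algebra_simps)
  note eval = b[THEN has_bochner_integral_integral_eq]
  show c12: "covariance M (\<lambda>\<omega>. cmod (W1 \<omega>)) (\<lambda>\<omega>. cmod (W2 \<omega>)) = pi / 4 * sqrt (A * B) * (H - 1)"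
    using cov[of "\<lambda>\<omega>. cmod (W1 \<omega>)" "\<lambda>\<omega>. cmod (W2 \<omega>)"] b unfolding eval ev12
    by (auto simp: has_bochner_integral_iff)
  have c11: "covariance M (\<lambda>\<omega>. cmod (W1 \<omega>)) (\<lambda>\<omega>. cmod (W1 \<omega>)) = A * (1 - pi / 4)"
    using cov[of "\<lambda>\<omega>. cmod (W1 \<omega>)" "\<lambda>\<omega>. cmod (W1 \<omega>)"] b(1) abs_squares AB
    unfolding eval power2_eq_square by (simp add: has_bochner_integral_iff abs_mult algebra_simps)
  have c22: "covariance M (\<lambda>\<omega>. cmod (W2 \<omega>)) (\<lambda>\<omega>. cmod (W2 \<omega>)) = B * (1 - pi / 4)"
    using cov[of "\<lambda>\<omega>. cmod (W2 \<omega>)" "\<lambda>\<omega>. cmod (W2 \<omega>)"] b(2) abs_squares AB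
    unfolding eval power2_eq_square by (simp add: has_bochner_integral_iff abs_mult algebra_simps)
  have pi: "1 - pi / 4 > 0" using pi_less_4 by simp
  have "sqrt (A * (1 - pi / 4) * (B * (1 - pi / 4))) = sqrt (A * B) * (1 - pi / 4)"
  proof -
    have "A * (1 - pi / 4) * (B * (1 - pi / 4)) = A * B * (1 - pi / 4)\<^sup>2" by (simp add: power2_eq_square)
    thus ?thesis using pi by (simp add: real_sqrt_mult)
  qed
  hence "correlation M (\<lambda>\<omega>. cmod (W1 \<omega>)) (\<lambda>\<omega>. cmod (W2 \<omega>)) = pi / 4 * sqrt (A * B) * (H - 1) / (sqrt (A * B) * (1 - pi / 4))"
    unfolding correlation_def c12 c11 c22 by simp
  also have "\<dots> = (H - 1) * (pi / 4 / (1 - pi / 4))" using AB by simp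
  also have "pi / 4 / (1 - pi / 4) = inverse (4 / pi - 1)" using pi by (simp add: field_simps)
  finally show "correlation M (\<lambda>\<omega>. cmod (W1 \<omega>)) (\<lambda>\<omega>. cmod (W2 \<omega>)) = inverse (4 / pi - 1) * (H - 1)"
    by (simp add: mult.commute)
qed

end

section \<open>Stationary Gaussian noise\<close>

text \<open>
  Expressing the characteristic function by the mean and the variance makes the degenerate case fit
  the same formula as the case with a density.
\<close>

lemma (in prob_space) gaussian_rv_moments_and_char:
  assumes "gaussian_rv M X"
  shows "X \<in> borel_measurable M" "integrable M X" "integrable M (\<lambda>\<omega>. (X \<omega>)\<^sup>2)"
    and "(\<integral>\<omega>. exp (\<i> * of_real (X \<omega>)) \<partial>M)
      = exp (\<i> * of_real (\<integral>\<omega>. X \<omega> \<partial>M) - of_real (covariance M X X / 2))"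
proof -
  show X [measurable]: "X \<in> borel_measurable M" using assms by (simp add: gaussian_rv_def)
  have "integrable M X \<and> integrable M (\<lambda>\<omega>. (X \<omega>)\<^sup>2) \<and> (\<integral>\<omega>. exp (\<i> * of_real (X \<omega>)) \<partial>M)
      = exp (\<i> * of_real (\<integral>\<omega>. X \<omega> \<partial>M) - of_real (covariance M X X / 2))"
    using assms unfolding gaussian_rv_def
  proof (elim conjE disjE exE)
    fix \<mu> \<sigma> :: real assume \<sigma>: "\<sigma> > 0" and d: "distributed M lborel X (normal_density \<mu> \<sigma>)"
    define Z where "Z \<omega> = (X \<omega> - \<mu>) / \<sigma>" for \<omega>
    have [measurable]: "Z \<in> borel_measurable M" unfolding Z_def by measurable
    have dZ: "distributed M lborel Z std_normal_density"
      using d normal_standard_normal_convert[OF \<sigma>] unfolding Z_def by blast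
    have XZ: "X \<omega> = \<mu> + \<sigma> * Z \<omega>" for \<omega> using \<sigma> by (simp add: Z_def)
    have "integrable M (\<lambda>\<omega>. Z \<omega> ^ k)" for k
      using integrable_std_normal_moment[of k] distributed_integrable[OF dZ, of "\<lambda>x. x ^ k"] by simp
    from this[of 1] this[of 2] have i: "integrable M X" "integrable M (\<lambda>\<omega>. (X \<omega>)\<^sup>2)"
      unfolding XZ by (auto simp: power2_sum power_mult_distrib mult.assoc)
    have ex: "(\<integral>\<omega>. X \<omega> \<partial>M) = \<mu>" by (rule normal_distributed_expectation[OF \<sigma> d])
    have var: "covariance M X X = \<sigma>\<^sup>2"
      using normal_distributed_variance[OF \<sigma> d] by (simp add: covariance_def power2_eq_square)
    have dist: "distr M borel Z = std_normal_distribution"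
      using distributed_distr_eq_density[OF dZ] by (simp cong: distr_cong)
    have "(\<integral>\<omega>. exp (\<i> * of_real (X \<omega>)) \<partial>M)
      = exp (\<i> * of_real \<mu>) * (\<integral>\<omega>. exp (\<i> * of_real (\<sigma> * Z \<omega>)) \<partial>M)"
      unfolding XZ by (simp add: exp_add distrib_left)
    also have "(\<integral>\<omega>. exp (\<i> * of_real (\<sigma> * Z \<omega>)) \<partial>M) = char (distr M borel Z) \<sigma>"
      unfolding char_def by (subst integral_distr) auto
    also have "\<dots> = exp (- of_real (\<sigma>\<^sup>2 / 2))"
      unfolding dist char_std_normal_distribution by (simp add: exp_of_real[symmetric])
    finally show ?thesis using i unfolding ex var
      by (simp add: exp_add[symmetric] flip: of_real_power of_real_divide)
  next
    fix \<mu> assume ae: "AE \<omega> in M. X \<omega> = \<mu>"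
    have "integrable M X \<longleftrightarrow> integrable M (\<lambda>_. \<mu>)"
      using ae by (intro integrable_cong_AE) auto
    moreover have "integrable M (\<lambda>\<omega>. (X \<omega>)\<^sup>2) \<longleftrightarrow> integrable M (\<lambda>_. \<mu>\<^sup>2)"
      using ae by (intro integrable_cong_AE) auto
    moreover have ex: "(\<integral>\<omega>. X \<omega> \<partial>M) = (\<integral>\<omega>. \<mu> \<partial>M)"
      using ae by (intro integral_cong_AE) auto
    moreover have "covariance M X X = (\<integral>\<omega>. 0 \<partial>M)" 
      unfolding covariance_def ex using ae by (intro integral_cong_AE) (auto simp: prob_space)
    moreover have "(\<integral>\<omega>. exp (\<i> * of_real (X \<omega>)) \<partial>M) = (\<integral>\<omega>. exp (\<i> * of_real \<mu>) \<partial>M)"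
      using ae by (intro integral_cong_AE) auto
    ultimately show ?thesis by (simp add: prob_space)
  qed
  thus "integrable M X" "integrable M (\<lambda>\<omega>. (X \<omega>)\<^sup>2)" "(\<integral>\<omega>. exp (\<i> * of_real (X \<omega>)) \<partial>M)
      = exp (\<i> * of_real (\<integral>\<omega>. X \<omega> \<partial>M) - of_real (covariance M X X / 2))" by auto
qed

context stationary_gaussian_noise
begin

lemma spectral_space: "space F = UNIV"
  using sets_eq_imp_space_eq[OF spectral_sets] by simp

lemma spectral_finite: "finite_measure F"
  by (rule finite_measureI) (simp add: spectral_space spectral_mass)

sublocale spectral: finite_measure F by (rule spectral_finite)

lemma measurable_spectral [measurable_cong]: "sets F = sets borel" by (rule spectral_sets)

definition noise_mean :: real where "noise_mean = (\<integral>\<omega>. \<Phi> 0 \<omega> \<partial>M)"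

lemma Phi_joint [measurable]: "(\<lambda>(\<omega>, t). \<Phi> t \<omega>) \<in> borel_measurable (M \<Otimes>\<^sub>M borel)"
  using measurable_pair_swap[OF jointly_measurable] by (simp add: case_prod_beta')

lemma Phi_joint' [measurable]: "(\<lambda>(t, \<omega>). \<Phi> t \<omega>) \<in> borel_measurable (borel \<Otimes>\<^sub>M M)"
  by (rule jointly_measurable)

lemma Phi_gaussian: "gaussian_rv M (\<Phi> t)"
  using gaussian[unfolded gaussian_process_def, rule_format, of "{t}" "\<lambda>_. 1"] by simp

lemmas Phi_measurable [measurable] = gaussian_rv_moments_and_char(1)[OF Phi_gaussian]
  and Phi_integrable = gaussian_rv_moments_and_char(2)[OF Phi_gaussian]
  and Phi_square_integrable = gaussian_rv_moments_and_char(3)[OF Phi_gaussian]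

lemma Phi_mean: "(\<integral>\<omega>. \<Phi> t \<omega> \<partial>M) = noise_mean"
  unfolding noise_mean_def by (rule constant_mean)

lemma Phi_centered_square_integrable: "integrable M (\<lambda>\<omega>. (\<Phi> t \<omega> - noise_mean)\<^sup>2)"
  using Phi_integrable[of t] Phi_square_integrable[of t] by (simp add: power2_diff)

lemma Phi_centered_product_integrable:
  "integrable M (\<lambda>\<omega>. (\<Phi> t \<omega> - noise_mean) * (\<Phi> t' \<omega> - noise_mean))"
  by (intro integrable_mult_of_squares Phi_centered_square_integrable) measurable

lemma Phi_covariance: "(\<integral>\<omega>. (\<Phi> t \<omega> - noise_mean) * (\<Phi> t' \<omega> - noise_mean) \<partial>M) = C (t - t')"
  using stationary_covariance[of t t'] by (simp add: covariance_def Phi_mean)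

text \<open>
  By the spectral representation the variance of a finite combination is the integral against \<open>F\<close>
  of the squared modulus of the trigonometric polynomial with the same coefficients. In this form
  the passage to continuous kernels is dominated convergence.
\<close>

lemma char_finite_combination:
  assumes I: "finite I"
  shows "(\<integral>\<omega>. exp (\<i> * of_real (\<Sum>t\<in>I. a t * \<Phi> t \<omega>)) \<partial>M)
    = exp (\<i> * of_real (noise_mean * (\<Sum>t\<in>I. a t))
        - of_real ((\<integral>l. (cmod (\<Sum>t\<in>I. a t *\<^sub>R exp (\<i> * of_real (l * t))))\<^sup>2 \<partial>F) / 2))"
proof -
  let ?S = "\<lambda>\<omega>. \<Sum>t\<in>I. a t * \<Phi> t \<omega>"
  have g: "gaussian_rv M ?S" using gaussian I by (auto simp: gaussian_process_def)
  have mean: "(\<integral>\<omega>. ?S \<omega> \<partial>M) = noise_mean * (\<Sum>t\<in>I. a t)"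
  proof -
    have "(\<integral>\<omega>. ?S \<omega> \<partial>M) = (\<Sum>t\<in>I. a t * noise_mean)"
      using Phi_integrable by (subst Bochner_Integration.integral_sum) (simp_all add: Phi_mean)
    also have "\<dots> = noise_mean * (\<Sum>t\<in>I. a t)"
      unfolding sum_distrib_left by (intro sum.cong refl mult.commute)
    finally show ?thesis .
  qed
  have iE: "integrable F (\<lambda>l. exp (\<i> * of_real (l * t)))" for t
    by (intro spectral.integrable_const_bound[where B=1]) (auto simp: norm_exp_i_times)
  have e: "(?S \<omega> - noise_mean * (\<Sum>t\<in>I. a t)) * (?S \<omega> - noise_mean * (\<Sum>t\<in>I. a t))
    = (\<Sum>t\<in>I. \<Sum>t'\<in>I. a t * a t' * ((\<Phi> t \<omega> - noise_mean) * (\<Phi> t' \<omega> - noise_mean)))" for \<omega>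
  proof -
    have "?S \<omega> - noise_mean * (\<Sum>t\<in>I. a t) = (\<Sum>t\<in>I. a t * (\<Phi> t \<omega> - noise_mean))"
      unfolding right_diff_distrib sum_subtractf sum_distrib_left by (simp only: mult.commute)
    thus ?thesis by (simp add: sum_product algebra_simps)
  qed
  have "covariance M ?S ?S = (\<Sum>t\<in>I. \<Sum>t'\<in>I. a t * a t' * C (t - t'))"
    unfolding covariance_def mean e
    using Phi_centered_product_integrable
    by (simp add: Bochner_Integration.integral_sum Bochner_Integration.integrable_sum Phi_covariance)
  hence "complex_of_real (covariance M ?S ?S)
     = (\<Sum>t\<in>I. \<Sum>t'\<in>I. of_real (a t * a t') * (\<integral>l. exp (\<i> * of_real (l * (t - t'))) \<partial>F))"
    by (simp add: spectral_representation)
  also have "\<dots> = (\<integral>l. (\<Sum>t\<in>I. \<Sum>t'\<in>I. of_real (a t * a t') * exp (\<i> * of_real (l * (t - t')))) \<partial>F)"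
    using iE by (simp add: Bochner_Integration.integral_sum Bochner_Integration.integrable_sum del: of_real_mult of_real_diff)
  also have "\<dots> = (\<integral>l. of_real ((cmod (\<Sum>t\<in>I. a t *\<^sub>R exp (\<i> * of_real (l * t))))\<^sup>2) \<partial>F)"
  proof (intro Bochner_Integration.integral_cong refl)
    fix l
    have "complex_of_real ((cmod (\<Sum>t\<in>I. a t *\<^sub>R exp (\<i> * of_real (l * t))))\<^sup>2)
      = (\<Sum>t\<in>I. a t *\<^sub>R exp (\<i> * of_real (l * t))) * (\<Sum>t\<in>I. a t *\<^sub>R exp (- (\<i> * of_real (l * t))))"
      unfolding complex_norm_square by (simp add: exp_cnj)
    also have "\<dots> = (\<Sum>t\<in>I. \<Sum>t'\<in>I. of_real (a t * a t') * exp (\<i> * of_real (l * (t - t'))))"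
      unfolding sum_product by (intro sum.cong refl) (simp add: scaleR_conv_of_real right_diff_distrib exp_diff exp_minus field_simps)
    finally show "(\<Sum>t\<in>I. \<Sum>t'\<in>I. of_real (a t * a t') * exp (\<i> * of_real (l * (t - t'))))
      = complex_of_real ((cmod (\<Sum>t\<in>I. a t *\<^sub>R exp (\<i> * of_real (l * t))))\<^sup>2)" ..
  qed
  also have "\<dots> = of_real (\<integral>l. (cmod (\<Sum>t\<in>I. a t *\<^sub>R exp (\<i> * of_real (l * t))))\<^sup>2 \<partial>F)"
    by (rule integral_complex_of_real)
  finally have cov: "covariance M ?S ?S = (\<integral>l. (cmod (\<Sum>t\<in>I. a t *\<^sub>R exp (\<i> * of_real (l * t))))\<^sup>2 \<partial>F)"
    unfolding of_real_eq_iff .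
  show ?thesis using gaussian_rv_moments_and_char(4)[OF g] unfolding mean cov .
qed

lemma L1_increment_le: "(\<integral>\<omega>. \<bar>\<Phi> t \<omega> - \<Phi> t' \<omega>\<bar> \<partial>M) \<le> sqrt (2 * (C 0 - C (t - t')))"
proof -
  let ?Y = "\<lambda>\<omega>. \<bar>\<Phi> t \<omega> - \<Phi> t' \<omega>\<bar>"
  have e: "(?Y \<omega>)\<^sup>2 = (\<Phi> t \<omega> - noise_mean)\<^sup>2 + (\<Phi> t' \<omega> - noise_mean)\<^sup>2
     - 2 * ((\<Phi> t \<omega> - noise_mean) * (\<Phi> t' \<omega> - noise_mean))" for \<omega>
    by (simp add: power2_eq_square algebra_simps)
  have i: "integrable M (\<lambda>\<omega>. (?Y \<omega>)\<^sup>2)" "integrable M ?Y"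
    unfolding e using Phi_centered_square_integrable Phi_centered_product_integrable Phi_integrable by simp_all
  have "(\<integral>\<omega>. (?Y \<omega>)\<^sup>2 \<partial>M) = 2 * (C 0 - C (t - t'))"
    unfolding e using Phi_centered_square_integrable Phi_centered_product_integrable
      Phi_covariance[of t t] Phi_covariance[of t' t'] Phi_covariance[of t t']
    by (simp add: power2_eq_square[symmetric])
  moreover have "0 \<le> variance ?Y" by simp
  ultimately have "(\<integral>\<omega>. ?Y \<omega> \<partial>M)\<^sup>2 \<le> 2 * (C 0 - C (t - t'))"
    using variance_eq[OF i(2) i(1)] by simp
  thus ?thesis by (rule real_le_rsqrt)
qed

lemma L1_bound: "(\<integral>\<omega>. \<bar>\<Phi> t \<omega>\<bar> \<partial>M) \<le> 1 + C 0 + noise_mean\<^sup>2"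
proof -
  have sq: "(\<integral>\<omega>. (\<Phi> t \<omega>)\<^sup>2 \<partial>M) = C 0 + noise_mean\<^sup>2"
    using Phi_covariance[of t t] Phi_integrable[of t] Phi_square_integrable[of t]
    by (simp add: power2_eq_square[symmetric] power2_diff Phi_mean prob_space) (simp add: power2_eq_square)
  have "(\<integral>\<omega>. \<bar>\<Phi> t \<omega>\<bar> \<partial>M) \<le> (\<integral>\<omega>. 1 + (\<Phi> t \<omega>)\<^sup>2 \<partial>M)"
  proof (intro integral_mono)
    fix \<omega>
    have "0 \<le> (\<bar>\<Phi> t \<omega>\<bar> - 1)\<^sup>2" by simp
    thus "\<bar>\<Phi> t \<omega>\<bar> \<le> 1 + (\<Phi> t \<omega>)\<^sup>2"
      by (simp add: power2_diff)
  qed (use Phi_integrable Phi_square_integrable in auto)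
  also have "\<dots> = 1 + C 0 + noise_mean\<^sup>2"
    using Phi_square_integrable[of t] sq by (simp add: prob_space)
  finally show ?thesis .
qed

text \<open>
  Continuity of the covariance function at \<open>0\<close>, because \<open>F\<close> is finite. With the bound
  \<open>L1_increment_le\<close> it makes the noise continuous in mean.
\<close>

lemma C_tendsto:
  assumes "u \<longlonglongrightarrow> (0::real)"
  shows "(\<lambda>n. C (u n)) \<longlonglongrightarrow> C 0"
proof -
  have "(\<lambda>n. \<integral>l. exp (\<i> * of_real (l * u n)) \<partial>F) \<longlonglongrightarrow> (\<integral>l. exp (\<i> * of_real (l * 0)) \<partial>F)"
  proof (rule integral_dominated_convergence[where w="\<lambda>_. 1"])
    have "(\<lambda>n. exp (\<i> * of_real (l * u n))) \<longlonglongrightarrow> exp (\<i> * of_real (l * 0))" for l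
      by (intro tendsto_intros assms)
    thus "AE l in F. (\<lambda>n. exp (\<i> * of_real (l * u n))) \<longlonglongrightarrow> exp (\<i> * of_real (l * 0))"
      by (rule AE_I2)
  qed (auto simp: norm_exp_i_times)
  thus ?thesis unfolding spectral_representation[symmetric] by (rule tendsto_of_real_iff[THEN iffD1])
qed

sublocale time_noise: pair_sigma_finite lborel M ..

lemma path_integrable_product:
  fixes h :: "real \<Rightarrow> real"
  assumes h: "integrable lborel h"
  shows "integrable (lborel \<Otimes>\<^sub>M M) (\<lambda>(\<tau>, \<omega>). h \<tau> * \<Phi> \<tau> \<omega>)"
proof (rule time_noise.Fubini_integrable)
  have [measurable]: "h \<in> borel_measurable borel" using h by auto
  show "(\<lambda>(\<tau>, \<omega>). h \<tau> * \<Phi> \<tau> \<omega>) \<in> borel_measurable (lborel \<Otimes>\<^sub>M M)" by measurable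
  show "AE \<tau> in lborel. integrable M (\<lambda>\<omega>. case (\<tau>, \<omega>) of (\<tau>, \<omega>) \<Rightarrow> h \<tau> * \<Phi> \<tau> \<omega>)"
    using Phi_integrable by simp
  show "integrable lborel (\<lambda>\<tau>. \<integral>\<omega>. norm (case (\<tau>, \<omega>) of (\<tau>, \<omega>) \<Rightarrow> h \<tau> * \<Phi> \<tau> \<omega>) \<partial>M)"
  proof (rule Bochner_Integration.integrable_bound[of _ "\<lambda>\<tau>. (1 + C 0 + noise_mean\<^sup>2) * \<bar>h \<tau>\<bar>"])
    show "integrable lborel (\<lambda>\<tau>. (1 + C 0 + noise_mean\<^sup>2) * \<bar>h \<tau>\<bar>)" using h by simp
    have "norm (\<integral>\<omega>. norm (h \<tau> * \<Phi> \<tau> \<omega>) \<partial>M) \<le> norm ((1 + C 0 + noise_mean\<^sup>2) * \<bar>h \<tau>\<bar>)" for \<tau>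
    proof -
      have "norm (\<integral>\<omega>. norm (h \<tau> * \<Phi> \<tau> \<omega>) \<partial>M) = \<bar>h \<tau>\<bar> * (\<integral>\<omega>. \<bar>\<Phi> \<tau> \<omega>\<bar> \<partial>M)"
        by (simp add: abs_mult)
      also have "\<dots> \<le> \<bar>h \<tau>\<bar> * (1 + C 0 + noise_mean\<^sup>2)" by (intro mult_left_mono L1_bound) simp
      also have "\<dots> \<le> norm ((1 + C 0 + noise_mean\<^sup>2) * \<bar>h \<tau>\<bar>)" by (simp add: mult.commute)
      finally show ?thesis .
    qed
    thus "AE \<tau> in lborel. norm (\<integral>\<omega>. norm (case (\<tau>, \<omega>) of (\<tau>, \<omega>) \<Rightarrow> h \<tau> * \<Phi> \<tau> \<omega>) \<partial>M)
      \<le> norm ((1 + C 0 + noise_mean\<^sup>2) * \<bar>h \<tau>\<bar>)" by simp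
  qed measurable
qed

lemma AE_path_integrable:
  fixes h :: "real \<Rightarrow> real"
  assumes h: "integrable lborel h"
  shows "AE \<omega> in M. integrable lborel (\<lambda>\<tau>. h \<tau> * \<Phi> \<tau> \<omega>)"
  by (rule time_noise.AE_integrable_snd[OF path_integrable_product[OF h]])

end

section \<open>Characteristic functions of linear functionals of the noise\<close>

text \<open>
  Riemann sums on the window from \<open>-n\<close> to \<open>n\<close> with mesh \<open>1 / (n + 1)\<close>: \<open>grid n\<close> rounds down to
  the mesh. A point of the mesh is weighted by the integral of \<open>h\<close> over the cell that is rounded to
  it, not by a value of \<open>h\<close>, since \<open>h\<close> is merely integrable.
\<close>

definition grid :: "nat \<Rightarrow> real \<Rightarrow> real" where
  "grid n \<tau> = of_int \<lfloor>real (Suc n) * \<tau>\<rfloor> / real (Suc n)"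

definition grid_points :: "nat \<Rightarrow> real set" where
  "grid_points n = (\<lambda>k. of_int k / real (Suc n)) ` {- int (n * Suc n)..int (n * Suc n)}"

definition grid_weight :: "(real \<Rightarrow> real) \<Rightarrow> nat \<Rightarrow> real \<Rightarrow> real" where
  "grid_weight h n v = (\<integral>\<tau>. indicator {\<tau>\<in>{-real n..real n}. grid n \<tau> = v} \<tau> * h \<tau> \<partial>lborel)"

lemma grid_measurable [measurable]: "grid n \<in> borel_measurable borel"
  unfolding grid_def by measurable

lemma finite_grid_points: "finite (grid_points n)"
  by (simp add: grid_points_def)

lemma grid_in_grid_points:
  assumes "\<tau> \<in> {-real n..real n}"
  shows "grid n \<tau> \<in> grid_points n"
proof -
  have "real (Suc n) * (- real n) \<le> real (Suc n) * \<tau>" "real (Suc n) * \<tau> \<le> real (Suc n) * real n"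
    using assms by (intro mult_left_mono; simp)+
  hence "- int (n * Suc n) \<le> \<lfloor>real (Suc n) * \<tau>\<rfloor>" "\<lfloor>real (Suc n) * \<tau>\<rfloor> \<le> int (n * Suc n)"
    by (simp_all add: le_floor_iff floor_le_iff algebra_simps)
  thus ?thesis unfolding grid_def grid_points_def by auto
qed

lemma grid_tendsto: "(\<lambda>n. grid n \<tau>) \<longlonglongrightarrow> \<tau>"
proof -
  have "norm (grid n \<tau> - \<tau>) \<le> 1 / real (Suc n)" for n
  proof -
    have "grid n \<tau> - \<tau> = (of_int \<lfloor>real (Suc n) * \<tau>\<rfloor> - real (Suc n) * \<tau>) / real (Suc n)"
      by (simp add: grid_def diff_divide_distrib)
    moreover have "\<bar>of_int \<lfloor>real (Suc n) * \<tau>\<rfloor> - real (Suc n) * \<tau>\<bar> \<le> 1" by linarith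
    ultimately show ?thesis by (simp add: divide_right_mono)
  qed
  hence "(\<lambda>n. grid n \<tau> - \<tau>) \<longlonglongrightarrow> 0"
    by (intro Lim_null_comparison[OF _ LIMSEQ_Suc[OF lim_1_over_n]]) (auto simp: eventually_sequentially)
  thus ?thesis by (rule LIM_zero_cancel)
qed

lemma integral_over_grid:
  fixes f :: "real \<Rightarrow> 'b::{banach, second_countable_topology}"
  assumes h: "integrable lborel h"
  shows "(\<integral>\<tau>. (indicator {-real n..real n} \<tau> * h \<tau>) *\<^sub>R f (grid n \<tau>) \<partial>lborel)
      = (\<Sum>v\<in>grid_points n. grid_weight h n v *\<^sub>R f v)"
    and "integrable lborel (\<lambda>\<tau>. (indicator {-real n..real n} \<tau> * h \<tau>) *\<^sub>R f (grid n \<tau>))"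
proof -
  let ?I = "\<lambda>v. {\<tau>\<in>{-real n..real n}. grid n \<tau> = v}"
  have e: "(indicator {-real n..real n} \<tau> * h \<tau>) *\<^sub>R f (grid n \<tau>)
     = (\<Sum>v\<in>grid_points n. (indicator (?I v) \<tau> * h \<tau>) *\<^sub>R f v)" for \<tau>
  proof (cases "\<tau> \<in> {-real n..real n}")
    case True
    have "(\<Sum>v\<in>grid_points n. (indicator (?I v) \<tau> * h \<tau>) *\<^sub>R f v)
       = (\<Sum>v\<in>grid_points n. if v = grid n \<tau> then h \<tau> *\<^sub>R f v else 0)"
      using True by (intro sum.cong refl) (auto simp: indicator_def)
    thus ?thesis using True grid_in_grid_points[OF True] by (simp add: finite_grid_points)
  qed (auto simp: indicator_def)
  have "?I v \<in> sets lborel" for v by measurable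
  hence i: "integrable lborel (\<lambda>\<tau>. indicator (?I v) \<tau> * h \<tau>)" for v
    using integrable_mult_indicator[of "?I v" lborel h] h by simp
  show "integrable lborel (\<lambda>\<tau>. (indicator {-real n..real n} \<tau> * h \<tau>) *\<^sub>R f (grid n \<tau>))"
    unfolding e using i by (intro Bochner_Integration.integrable_sum integrable_scaleR_left)
  show "(\<integral>\<tau>. (indicator {-real n..real n} \<tau> * h \<tau>) *\<^sub>R f (grid n \<tau>) \<partial>lborel)
      = (\<Sum>v\<in>grid_points n. grid_weight h n v *\<^sub>R f v)"
    unfolding e grid_weight_def using i
    by (subst Bochner_Integration.integral_sum) (auto intro!: integrable_scaleR_left)
qed

lemma eventually_in_window: "\<forall>\<^sub>F n in sequentially. (\<tau>::real) \<in> {-real n..real n}"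
proof -
  have "\<forall>\<^sub>F n in sequentially. \<bar>\<tau>\<bar> \<le> real n"
    using filterlim_real_sequentially unfolding filterlim_at_top by blast
  thus ?thesis by eventually_elim auto
qed

lemma norm_exp_i_diff_le: "cmod (exp (\<i> * of_real x) - exp (\<i> * of_real y)) \<le> \<bar>x - y\<bar>"
proof -
  have "exp (\<i> * of_real x) - exp (\<i> * of_real y) = exp (\<i> * of_real y) * (exp (\<i> * of_real (x - y)) - 1)"
    by (simp add: algebra_simps exp_diff)
  thus ?thesis using iexp_approx1[of "x - y" 0] by (simp add: norm_mult norm_exp_i_times)
qed

context stationary_gaussian_noise
begin

text \<open>
  The mean error is at most the integral of \<open>\<bar>h \<tau>\<bar>\<close> times the mean distance of \<open>\<Phi> \<tau>\<close> and its
  value at the rounded time. That distance tends to \<open>0\<close> for every \<open>\<tau>\<close> by continuity in mean,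
  and it is bounded uniformly in \<open>\<tau>\<close> by stationarity, so dominated convergence applies.
\<close>

lemma L1_riemann_error_tendsto_zero:
  fixes h :: "real \<Rightarrow> real"
  assumes h: "integrable lborel h"
  shows "(\<lambda>n. \<integral>\<^sup>+\<omega>. ennreal \<bar>(\<integral>\<tau>. h \<tau> * \<Phi> \<tau> \<omega> \<partial>lborel) - (\<Sum>v\<in>grid_points n. grid_weight h n v * \<Phi> v \<omega>)\<bar> \<partial>M) \<longlonglongrightarrow> 0"
proof -
  have [measurable]: "h \<in> borel_measurable borel" using h by auto
  define b where "b = 1 + C 0 + noise_mean\<^sup>2"
  have b0: "b \<ge> 0"
    using order_trans[OF _ L1_bound[of 0], of 0] by (simp add: b_def)
  define X where "X \<omega> = (\<integral>\<tau>. h \<tau> * \<Phi> \<tau> \<omega> \<partial>lborel)" for \<omega>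
  define S where "S n \<omega> = (\<Sum>v\<in>grid_points n. grid_weight h n v * \<Phi> v \<omega>)" for n \<omega>
  define E where "E n \<tau> \<omega> = \<bar>\<Phi> \<tau> \<omega> - indicator {-real n..real n} \<tau> * \<Phi> (grid n \<tau>) \<omega>\<bar>" for n \<tau> \<omega>
  have Eint: "integrable M (E n \<tau>)" for n \<tau>
    unfolding E_def using Phi_integrable by simp
  have E_bound: "(\<integral>\<omega>. E n \<tau> \<omega> \<partial>M) \<le> 2 * b" for n \<tau>
  proof -
    have "(\<integral>\<omega>. E n \<tau> \<omega> \<partial>M) \<le> (\<integral>\<omega>. \<bar>\<Phi> \<tau> \<omega>\<bar> + \<bar>\<Phi> (grid n \<tau>) \<omega>\<bar> \<partial>M)"
      using Phi_integrable by (intro integral_mono Eint) (auto simp: E_def indicator_def)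
    also have "\<dots> \<le> b + b" using Phi_integrable L1_bound[of \<tau>] L1_bound[of "grid n \<tau>"] unfolding b_def by simp
    finally show ?thesis by simp
  qed
  have E_lim: "(\<lambda>n. \<integral>\<omega>. E n \<tau> \<omega> \<partial>M) \<longlonglongrightarrow> 0" for \<tau>
  proof (rule tendsto_sandwich[of "\<lambda>_. 0" _ _ "\<lambda>n. sqrt (2 * (C 0 - C (\<tau> - grid n \<tau>)))"])
    show "\<forall>\<^sub>F n in sequentially. 0 \<le> (\<integral>\<omega>. E n \<tau> \<omega> \<partial>M)" by (simp add: E_def)
    show "\<forall>\<^sub>F n in sequentially. (\<integral>\<omega>. E n \<tau> \<omega> \<partial>M) \<le> sqrt (2 * (C 0 - C (\<tau> - grid n \<tau>)))"
      using eventually_in_window[of \<tau>]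
    proof eventually_elim
      case (elim n)
      thus ?case using L1_increment_le[of \<tau> "grid n \<tau>"] by (simp add: E_def)
    qed
    have "(\<lambda>n. \<tau> - grid n \<tau>) \<longlonglongrightarrow> \<tau> - \<tau>" by (intro tendsto_intros grid_tendsto)
    hence "(\<lambda>n. C (\<tau> - grid n \<tau>)) \<longlonglongrightarrow> C 0" by (intro C_tendsto) simp
    hence "(\<lambda>n. sqrt (2 * (C 0 - C (\<tau> - grid n \<tau>)))) \<longlonglongrightarrow> sqrt (2 * (C 0 - C 0))"
      by (intro tendsto_intros)
    thus "(\<lambda>n. sqrt (2 * (C 0 - C (\<tau> - grid n \<tau>)))) \<longlonglongrightarrow> 0" by simp
  qed simp
  have [measurable]: "(\<lambda>(\<tau>, \<omega>). E n \<tau> \<omega>) \<in> borel_measurable (borel \<Otimes>\<^sub>M M)" for n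
    unfolding E_def by measurable
  have [measurable]: "(\<lambda>(\<omega>, \<tau>). E n \<tau> \<omega>) \<in> borel_measurable (M \<Otimes>\<^sub>M borel)" for n
    unfolding E_def by measurable
  define e where "e n \<tau> = ennreal (\<bar>h \<tau>\<bar> * (\<integral>\<omega>. E n \<tau> \<omega> \<partial>M))" for n \<tau>
  have [measurable]: "e n \<in> borel_measurable borel" for n
    unfolding e_def by measurable
  have "(\<lambda>n. \<integral>\<^sup>+\<tau>. e n \<tau> \<partial>lborel) \<longlonglongrightarrow> (\<integral>\<^sup>+(\<tau>::real). 0 \<partial>lborel)"
  proof (rule nn_integral_dominated_convergence[where w="\<lambda>\<tau>. ennreal (\<bar>h \<tau>\<bar> * (2 * b))"])
    show "AE \<tau> in lborel. e n \<tau> \<le> ennreal (\<bar>h \<tau>\<bar> * (2 * b))" for n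
      unfolding e_def by (intro AE_I2 ennreal_leI mult_left_mono E_bound) simp
    have "integrable lborel (\<lambda>\<tau>. \<bar>h \<tau>\<bar> * (2 * b))" using h by simp
    thus "(\<integral>\<^sup>+\<tau>. ennreal (\<bar>h \<tau>\<bar> * (2 * b)) \<partial>lborel) < \<infinity>"
      using b0 by (subst nn_integral_eq_integral) auto
    have "(\<lambda>n. e n \<tau>) \<longlonglongrightarrow> ennreal (\<bar>h \<tau>\<bar> * 0)" for \<tau>
      unfolding e_def by (intro tendsto_ennrealI tendsto_intros E_lim)
    thus "AE \<tau> in lborel. (\<lambda>n. e n \<tau>) \<longlonglongrightarrow> 0" by simp
  qed measurable
  hence lim: "(\<lambda>n. \<integral>\<^sup>+\<tau>. e n \<tau> \<partial>lborel) \<longlonglongrightarrow> 0" by simp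
  have le: "(\<integral>\<^sup>+\<omega>. ennreal \<bar>X \<omega> - S n \<omega>\<bar> \<partial>M) \<le> (\<integral>\<^sup>+\<tau>. e n \<tau> \<partial>lborel)" for n
  proof -
    have "AE \<omega> in M. ennreal \<bar>X \<omega> - S n \<omega>\<bar> \<le> (\<integral>\<^sup>+\<tau>. ennreal (\<bar>h \<tau>\<bar> * E n \<tau> \<omega>) \<partial>lborel)"
      using AE_path_integrable[OF h]
    proof eventually_elim
      case (elim \<omega>)
      note g = integral_over_grid[OF h, where f="\<lambda>v. \<Phi> v \<omega>" and n=n]
      have "X \<omega> - S n \<omega> = (\<integral>\<tau>. h \<tau> * \<Phi> \<tau> \<omega> - (indicator {-real n..real n} \<tau> * h \<tau>) * \<Phi> (grid n \<tau>) \<omega> \<partial>lborel)"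
        unfolding X_def S_def using elim g by (subst Bochner_Integration.integral_diff) auto
      also have "\<dots> = (\<integral>\<tau>. h \<tau> * (\<Phi> \<tau> \<omega> - indicator {-real n..real n} \<tau> * \<Phi> (grid n \<tau>) \<omega>) \<partial>lborel)"
        by (intro Bochner_Integration.integral_cong refl) (simp add: algebra_simps)
      finally have eq: "X \<omega> - S n \<omega> = (\<integral>\<tau>. h \<tau> * (\<Phi> \<tau> \<omega> - indicator {-real n..real n} \<tau> * \<Phi> (grid n \<tau>) \<omega>) \<partial>lborel)" .
      have "integrable lborel (\<lambda>\<tau>. h \<tau> * \<Phi> \<tau> \<omega> - (indicator {-real n..real n} \<tau> * h \<tau>) * \<Phi> (grid n \<tau>) \<omega>)"
        using elim g(2) by simp
      hence i: "integrable lborel (\<lambda>\<tau>. h \<tau> * (\<Phi> \<tau> \<omega> - indicator {-real n..real n} \<tau> * \<Phi> (grid n \<tau>) \<omega>))"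
        by (simp add: algebra_simps)
      have "ennreal (norm (X \<omega> - S n \<omega>)) \<le> (\<integral>\<^sup>+\<tau>. ennreal (norm (h \<tau> * (\<Phi> \<tau> \<omega> - indicator {-real n..real n} \<tau> * \<Phi> (grid n \<tau>) \<omega>))) \<partial>lborel)"
        unfolding eq by (rule integral_norm_bound_ennreal[OF i])
      thus ?case by (simp add: abs_mult E_def)
    qed
    hence "(\<integral>\<^sup>+\<omega>. ennreal \<bar>X \<omega> - S n \<omega>\<bar> \<partial>M) \<le> (\<integral>\<^sup>+\<omega>. (\<integral>\<^sup>+\<tau>. ennreal (\<bar>h \<tau>\<bar> * E n \<tau> \<omega>) \<partial>lborel) \<partial>M)"
      by (rule nn_integral_mono_AE)
    also have "\<dots> = (\<integral>\<^sup>+\<tau>. (\<integral>\<^sup>+\<omega>. ennreal (\<bar>h \<tau>\<bar> * E n \<tau> \<omega>) \<partial>M) \<partial>lborel)"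
      by (rule time_noise.Fubini') measurable
    also have "\<dots> = (\<integral>\<^sup>+\<tau>. e n \<tau> \<partial>lborel)"
      unfolding e_def
    proof (intro nn_integral_cong)
      fix \<tau>
      have "0 \<le> E n \<tau> \<omega>" for \<omega> by (simp add: E_def)
      thus "(\<integral>\<^sup>+\<omega>. ennreal (\<bar>h \<tau>\<bar> * E n \<tau> \<omega>) \<partial>M) = ennreal (\<bar>h \<tau>\<bar> * (\<integral>\<omega>. E n \<tau> \<omega> \<partial>M))"
        using Eint[of n \<tau>] by (subst nn_integral_eq_integral) auto
    qed
    finally show ?thesis .
  qed
  show ?thesis
    unfolding X_def[symmetric] S_def[symmetric]
    by (rule tendsto_sandwich[OF _ _ tendsto_const lim]) (simp_all add: le)
qed

text \<open>
  The characteristic functions of the Riemann sums are known, and both sides of that formula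
  converge: the left one since \<open>\<bar>exp (i x) - exp (i y)\<bar> \<le> \<bar>x - y\<bar>\<close>, the right one by dominated
  convergence, first in time and then in frequency.
\<close>

theorem char_linear_functional:
  fixes h :: "real \<Rightarrow> real"
  assumes h: "integrable lborel h"
  shows "(\<integral>\<omega>. exp (\<i> * of_real (\<integral>\<tau>. h \<tau> * \<Phi> \<tau> \<omega> \<partial>lborel)) \<partial>M)
    = exp (\<i> * of_real (noise_mean * (\<integral>\<tau>. h \<tau> \<partial>lborel))
        - of_real ((\<integral>l. (cmod (\<integral>\<tau>. h \<tau> *\<^sub>R exp (\<i> * of_real (l * \<tau>)) \<partial>lborel))\<^sup>2 \<partial>F) / 2))"
proof -
  have [measurable]: "h \<in> borel_measurable borel" using h by auto
  define X where "X \<omega> = (\<integral>\<tau>. h \<tau> * \<Phi> \<tau> \<omega> \<partial>lborel)" for \<omega>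
  define S where "S n \<omega> = (\<Sum>v\<in>grid_points n. grid_weight h n v * \<Phi> v \<omega>)" for n \<omega>
  define H where "H l = (\<integral>\<tau>. h \<tau> *\<^sub>R exp (\<i> * of_real (l * \<tau>)) \<partial>lborel)" for l
  define Hn where "Hn n l = (\<Sum>v\<in>grid_points n. grid_weight h n v *\<^sub>R exp (\<i> * of_real (l * v)))" for n l
  have [measurable]: "X \<in> borel_measurable M" "S n \<in> borel_measurable M" for n
    unfolding X_def S_def by measurable
  have [measurable]: "H \<in> borel_measurable borel" "Hn n \<in> borel_measurable borel" for n
    unfolding H_def Hn_def by measurable
  have int: "integrable M (\<lambda>\<omega>. exp (\<i> * of_real (X \<omega>)))" "integrable M (\<lambda>\<omega>. exp (\<i> * of_real (S n \<omega>)))" for n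
    by (intro integrable_const_bound[where B=1]; auto simp: norm_exp_i_times)+
  have "(\<lambda>n. ennreal (cmod ((\<integral>\<omega>. exp (\<i> * of_real (S n \<omega>)) \<partial>M) - (\<integral>\<omega>. exp (\<i> * of_real (X \<omega>)) \<partial>M)))) \<longlonglongrightarrow> 0"
  proof (rule tendsto_sandwich[OF _ _ tendsto_const L1_riemann_error_tendsto_zero[OF h, folded X_def S_def]])
    have "ennreal (cmod ((\<integral>\<omega>. exp (\<i> * of_real (S n \<omega>)) \<partial>M) - (\<integral>\<omega>. exp (\<i> * of_real (X \<omega>)) \<partial>M)))
      \<le> (\<integral>\<^sup>+\<omega>. ennreal \<bar>X \<omega> - S n \<omega>\<bar> \<partial>M)" for n
    proof -
      have "(\<integral>\<omega>. exp (\<i> * of_real (S n \<omega>)) \<partial>M) - (\<integral>\<omega>. exp (\<i> * of_real (X \<omega>)) \<partial>M)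
         = (\<integral>\<omega>. exp (\<i> * of_real (S n \<omega>)) - exp (\<i> * of_real (X \<omega>)) \<partial>M)"
        using int by simp
      hence "ennreal (cmod ((\<integral>\<omega>. exp (\<i> * of_real (S n \<omega>)) \<partial>M) - (\<integral>\<omega>. exp (\<i> * of_real (X \<omega>)) \<partial>M)))
        = ennreal (cmod (\<integral>\<omega>. exp (\<i> * of_real (S n \<omega>)) - exp (\<i> * of_real (X \<omega>)) \<partial>M))"
        by (simp only:)
      also have "\<dots> \<le> (\<integral>\<^sup>+\<omega>. ennreal (cmod (exp (\<i> * of_real (S n \<omega>)) - exp (\<i> * of_real (X \<omega>)))) \<partial>M)"
        by (intro integral_norm_bound_ennreal Bochner_Integration.integrable_diff int)
      also have "\<dots> \<le> (\<integral>\<^sup>+\<omega>. ennreal \<bar>X \<omega> - S n \<omega>\<bar> \<partial>M)"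
        by (intro nn_integral_mono ennreal_leI, subst abs_minus_commute) (rule norm_exp_i_diff_le)
      finally show ?thesis .
    qed
    thus "\<forall>\<^sub>F n in sequentially. ennreal (cmod ((\<integral>\<omega>. exp (\<i> * of_real (S n \<omega>)) \<partial>M) - (\<integral>\<omega>. exp (\<i> * of_real (X \<omega>)) \<partial>M)))
      \<le> (\<integral>\<^sup>+\<omega>. ennreal \<bar>X \<omega> - S n \<omega>\<bar> \<partial>M)" by simp
  qed simp
  hence "(\<lambda>n. cmod ((\<integral>\<omega>. exp (\<i> * of_real (S n \<omega>)) \<partial>M) - (\<integral>\<omega>. exp (\<i> * of_real (X \<omega>)) \<partial>M))) \<longlonglongrightarrow> 0"
    by (subst (asm) ennreal_0[symmetric], subst (asm) tendsto_ennreal_iff) auto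
  hence "(\<lambda>n. (\<integral>\<omega>. exp (\<i> * of_real (S n \<omega>)) \<partial>M) - (\<integral>\<omega>. exp (\<i> * of_real (X \<omega>)) \<partial>M)) \<longlonglongrightarrow> 0"
    by (rule tendsto_norm_zero_cancel)
  hence left: "(\<lambda>n. \<integral>\<omega>. exp (\<i> * of_real (S n \<omega>)) \<partial>M) \<longlonglongrightarrow> (\<integral>\<omega>. exp (\<i> * of_real (X \<omega>)) \<partial>M)"
    by (rule LIM_zero_cancel)
  have ind_lim: "(\<lambda>n. indicator {-real n..real n} \<tau> * h \<tau>) \<longlonglongrightarrow> h \<tau>" for \<tau>
    using eventually_in_window[of \<tau>] by (intro tendsto_eventually) (auto elim!: eventually_mono simp: indicator_def)
  have mean_lim: "(\<lambda>n. \<Sum>v\<in>grid_points n. grid_weight h n v) \<longlonglongrightarrow> (\<integral>\<tau>. h \<tau> \<partial>lborel)"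
  proof -
    have "(\<lambda>n. \<integral>\<tau>. indicator {-real n..real n} \<tau> * h \<tau> \<partial>lborel) \<longlonglongrightarrow> (\<integral>\<tau>. h \<tau> \<partial>lborel)"
    proof (rule integral_dominated_convergence[where w="\<lambda>\<tau>. \<bar>h \<tau>\<bar>"])
      show "AE \<tau> in lborel. (\<lambda>n. indicator {-real n..real n} \<tau> * h \<tau>) \<longlonglongrightarrow> h \<tau>"
        by (intro AE_I2 ind_lim)
    qed (use h in \<open>auto simp: indicator_def\<close>)
    thus ?thesis using integral_over_grid(1)[OF h, where f="\<lambda>_. 1::real"] by simp
  qed
  have H_lim: "(\<lambda>n. Hn n l) \<longlonglongrightarrow> H l" for l
  proof -
    have "(\<lambda>n. \<integral>\<tau>. (indicator {-real n..real n} \<tau> * h \<tau>) *\<^sub>R exp (\<i> * of_real (l * grid n \<tau>)) \<partial>lborel) \<longlonglongrightarrow> H l"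
      unfolding H_def
    proof (rule integral_dominated_convergence[where w="\<lambda>\<tau>. \<bar>h \<tau>\<bar>"])
      have "(\<lambda>n. (indicator {-real n..real n} \<tau> * h \<tau>) *\<^sub>R exp (\<i> * of_real (l * grid n \<tau>)))
         \<longlonglongrightarrow> h \<tau> *\<^sub>R exp (\<i> * of_real (l * \<tau>))" for \<tau>
        by (intro tendsto_intros ind_lim grid_tendsto)
      thus "AE \<tau> in lborel. (\<lambda>n. (indicator {-real n..real n} \<tau> * h \<tau>) *\<^sub>R exp (\<i> * of_real (l * grid n \<tau>)))
         \<longlonglongrightarrow> h \<tau> *\<^sub>R exp (\<i> * of_real (l * \<tau>))" by simp
      have "norm ((indicator {-real n..real n} \<tau> * h \<tau>) *\<^sub>R exp (\<i> * of_real (l * grid n \<tau>))) \<le> \<bar>h \<tau>\<bar>" for n \<tau>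
        unfolding norm_scaleR norm_exp_i_times by (simp add: abs_mult indicator_def)
      thus "AE \<tau> in lborel. norm ((indicator {-real n..real n} \<tau> * h \<tau>) *\<^sub>R exp (\<i> * of_real (l * grid n \<tau>))) \<le> \<bar>h \<tau>\<bar>" for n
        by simp
    qed (use h in \<open>measurable; simp\<close>)+
    thus ?thesis
      using integral_over_grid(1)[OF h, where f="\<lambda>v. exp (\<i> * of_real (l * v))"] by (simp only: Hn_def)
  qed
  have Hn_bound: "cmod (Hn n l) \<le> (\<integral>\<tau>. \<bar>h \<tau>\<bar> \<partial>lborel)" for n l
  proof -
    have "cmod (Hn n l) \<le> (\<integral>\<tau>. norm ((indicator {-real n..real n} \<tau> * h \<tau>) *\<^sub>R exp (\<i> * of_real (l * grid n \<tau>))) \<partial>lborel)"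
      unfolding Hn_def integral_over_grid(1)[OF h, symmetric] by (rule integral_norm_bound)
    also have "\<dots> \<le> (\<integral>\<tau>. \<bar>h \<tau>\<bar> \<partial>lborel)"
    proof (rule integral_mono)
      show "integrable lborel (\<lambda>\<tau>. norm ((indicator {-real n..real n} \<tau> * h \<tau>) *\<^sub>R exp (\<i> * of_real (l * grid n \<tau>))))"
        by (intro integrable_norm integral_over_grid(2)[OF h])
      show "norm ((indicator {-real n..real n} \<tau> * h \<tau>) *\<^sub>R exp (\<i> * of_real (l * grid n \<tau>))) \<le> \<bar>h \<tau>\<bar>" for \<tau>
        unfolding norm_scaleR norm_exp_i_times by (simp add: abs_mult indicator_def)
    qed (use h in simp)
    finally show ?thesis .
  qed
  have var_lim: "(\<lambda>n. \<integral>l. (cmod (Hn n l))\<^sup>2 \<partial>F) \<longlonglongrightarrow> (\<integral>l. (cmod (H l))\<^sup>2 \<partial>F)"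
  proof (rule integral_dominated_convergence[where w="\<lambda>_. (\<integral>\<tau>. \<bar>h \<tau>\<bar> \<partial>lborel)\<^sup>2"])
    show "AE l in F. (\<lambda>n. (cmod (Hn n l))\<^sup>2) \<longlonglongrightarrow> (cmod (H l))\<^sup>2"
      by (intro AE_I2 tendsto_intros H_lim)
    show "AE l in F. norm ((cmod (Hn n l))\<^sup>2) \<le> (\<integral>\<tau>. \<bar>h \<tau>\<bar> \<partial>lborel)\<^sup>2" for n
      using Hn_bound by (intro AE_I2) (simp add: power_mono)
  qed (simp_all, measurable)
  have "(\<integral>\<omega>. exp (\<i> * of_real (S n \<omega>)) \<partial>M) = exp (\<i> * of_real (noise_mean * (\<Sum>v\<in>grid_points n. grid_weight h n v))
        - of_real ((\<integral>l. (cmod (Hn n l))\<^sup>2 \<partial>F) / 2))" for n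
    unfolding S_def Hn_def by (rule char_finite_combination[OF finite_grid_points])
  moreover have "(\<lambda>n. exp (\<i> * of_real (noise_mean * (\<Sum>v\<in>grid_points n. grid_weight h n v))
        - of_real ((\<integral>l. (cmod (Hn n l))\<^sup>2 \<partial>F) / 2)))
    \<longlonglongrightarrow> exp (\<i> * of_real (noise_mean * (\<integral>\<tau>. h \<tau> \<partial>lborel)) - of_real ((\<integral>l. (cmod (H l))\<^sup>2 \<partial>F) / 2))"
    by (intro tendsto_intros mean_lim var_lim) simp
  ultimately have "(\<lambda>n. \<integral>\<omega>. exp (\<i> * of_real (S n \<omega>)) \<partial>M)
    \<longlonglongrightarrow> exp (\<i> * of_real (noise_mean * (\<integral>\<tau>. h \<tau> \<partial>lborel)) - of_real ((\<integral>l. (cmod (H l))\<^sup>2 \<partial>F) / 2))"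
    by (simp only:)
  with left show ?thesis unfolding X_def H_def by (rule LIMSEQ_unique)
qed

end

section \<open>The analytic wavelet transform\<close>

text \<open>
  The opposite sign in the exponent, compared with \<open>fourier\<close>, is the one of the spectral
  representation. Since the kernels of the wavelet transform are complex conjugates of wavelets, this
  sign also puts their spectrum on the positive half line.
\<close>

definition inv_fourier :: "(real \<Rightarrow> complex) \<Rightarrow> real \<Rightarrow> complex" where
  "inv_fourier g l = (\<integral>\<tau>. exp (\<i> * of_real (l * \<tau>)) * g \<tau> \<partial>lborel)"

lemma cnj_borel_measurable [measurable]: "cnj \<in> borel_measurable borel"
  by (intro borel_measurable_continuous_onI continuous_intros)

lemma exp_times_integrable:
  assumes g: "integrable lborel (g :: real \<Rightarrow> complex)"
  shows "integrable lborel (\<lambda>\<tau>. exp (\<i> * of_real (l * \<tau>)) * g \<tau>)"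
proof (rule Bochner_Integration.integrable_bound[OF g])
  have [measurable]: "g \<in> borel_measurable borel" using g by auto
  show "(\<lambda>\<tau>. exp (\<i> * of_real (l * \<tau>)) * g \<tau>) \<in> borel_measurable lborel" by measurable
qed (auto simp: norm_mult norm_exp_i_times)

lemma inv_fourier_measurable [measurable]:
  assumes "integrable lborel g"
  shows "inv_fourier g \<in> borel_measurable borel"
proof -
  have [measurable]: "g \<in> borel_measurable borel" using assms by auto
  show ?thesis unfolding inv_fourier_def by measurable
qed

lemma norm_inv_fourier_le:
  "cmod (inv_fourier g l) \<le> (\<integral>\<tau>. cmod (g \<tau>) \<partial>lborel)"
proof -
  have "cmod (inv_fourier g l) \<le> (\<integral>\<tau>. norm (exp (\<i> * of_real (l * \<tau>)) * g \<tau>) \<partial>lborel)"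
    unfolding inv_fourier_def by (rule integral_norm_bound)
  thus ?thesis by (simp add: norm_mult norm_exp_i_times)
qed

lemma inv_fourier_linear:
  assumes "integrable lborel g1" "integrable lborel g2"
  shows "inv_fourier (\<lambda>\<tau>. c1 * g1 \<tau> + c2 * g2 \<tau>) l = c1 * inv_fourier g1 l + c2 * inv_fourier g2 l"
  using exp_times_integrable[OF assms(1), of l] exp_times_integrable[OF assms(2), of l]
  by (simp add: inv_fourier_def distrib_left mult.left_commute[of "exp _"])

lemma inv_fourier_Re:
  assumes g: "integrable lborel g"
  shows "(\<integral>\<tau>. Re (g \<tau>) *\<^sub>R exp (\<i> * of_real (l * \<tau>)) \<partial>lborel)
    = (inv_fourier g l + cnj (inv_fourier g (- l))) / 2"
proof -
  have "(\<integral>\<tau>. Re (g \<tau>) *\<^sub>R exp (\<i> * of_real (l * \<tau>)) \<partial>lborel)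
    = (\<integral>\<tau>. (exp (\<i> * of_real (l * \<tau>)) * g \<tau> + cnj (exp (\<i> * of_real (- l * \<tau>)) * g \<tau>)) / 2 \<partial>lborel)"
  proof (intro Bochner_Integration.integral_cong refl)
    fix \<tau>
    have "complex_of_real (Re (g \<tau>)) = (g \<tau> + cnj (g \<tau>)) / 2"
      by (simp add: complex_eq_iff)
    thus "Re (g \<tau>) *\<^sub>R exp (\<i> * of_real (l * \<tau>))
       = (exp (\<i> * of_real (l * \<tau>)) * g \<tau> + cnj (exp (\<i> * of_real (- l * \<tau>)) * g \<tau>)) / 2"
      by (simp add: scaleR_conv_of_real exp_cnj algebra_simps add_divide_distrib)
  qed
  also have "\<dots> = (inv_fourier g l + cnj (inv_fourier g (- l))) / 2"
    using exp_times_integrable[OF g, of l] exp_times_integrable[OF g, of "- l"]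
    unfolding inv_fourier_def
    by (simp only: integral_divide_zero Bochner_Integration.integral_add complex_integrable_cnj Bochner_Integration.integral_cnj)
  finally show ?thesis .
qed

context stationary_gaussian_noise
begin

text \<open>
  The average over \<open>l\<close> and \<open>- l\<close> is what the variance of the real part of a functional produces:
  the spectrum of the real part of a kernel carries the original spectrum and its mirror image.
\<close>

definition spectral_form :: "(real \<Rightarrow> complex) \<Rightarrow> (real \<Rightarrow> complex) \<Rightarrow> complex" where
  "spectral_form g g' = (\<integral>l. inv_fourier g l * cnj (inv_fourier g' l)
      + inv_fourier g (- l) * cnj (inv_fourier g' (- l)) \<partial>F) / 2"

lemma spectral_form_integrable:
  assumes g: "integrable lborel g" "integrable lborel g'"
  shows "integrable F (\<lambda>l. inv_fourier g l * cnj (inv_fourier g' l)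
      + inv_fourier g (- l) * cnj (inv_fourier g' (- l)))"
proof -
  note [measurable] = inv_fourier_measurable[OF g(1)] inv_fourier_measurable[OF g(2)]
  let ?B = "(\<integral>\<tau>. cmod (g \<tau>) \<partial>lborel) * (\<integral>\<tau>. cmod (g' \<tau>) \<partial>lborel)"
  have b: "cmod (inv_fourier g l * cnj (inv_fourier g' l)) \<le> ?B" for l
    unfolding norm_mult complex_mod_cnj by (intro mult_mono norm_inv_fourier_le) auto
  have "integrable F (\<lambda>l. inv_fourier g l * cnj (inv_fourier g' l))"
    using b by (intro spectral.integrable_const_bound[where B="?B"]) auto
  moreover have "integrable F (\<lambda>l. inv_fourier g (- l) * cnj (inv_fourier g' (- l)))"
    using b by (intro spectral.integrable_const_bound[where B="?B"]) auto
  ultimately show ?thesis by (rule Bochner_Integration.integrable_add)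
qed

lemma spectral_form_of_combination:
  assumes g: "integrable lborel g1" "integrable lborel g2"
  shows "(\<integral>l. (cmod (c1 * inv_fourier g1 l + c2 * inv_fourier g2 l))\<^sup>2
      + (cmod (c1 * inv_fourier g1 (- l) + c2 * inv_fourier g2 (- l)))\<^sup>2 \<partial>F)
    = 2 * ((cmod c1)\<^sup>2 * Re (spectral_form g1 g1) + (cmod c2)\<^sup>2 * Re (spectral_form g2 g2)
      + 2 * Re (c1 * cnj c2 * spectral_form g1 g2))"
proof -
  define P where "P g g' l = inv_fourier g l * cnj (inv_fourier g' l)
      + inv_fourier g (- l) * cnj (inv_fourier g' (- l))" for g g' l
  have i: "integrable F (P g1 g1)" "integrable F (P g2 g2)" "integrable F (P g1 g2)"
    unfolding P_def by (intro spectral_form_integrable g)+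
  have sq: "(cmod (c1 * a + c2 * b))\<^sup>2 = (cmod c1)\<^sup>2 * Re (a * cnj a) + (cmod c2)\<^sup>2 * Re (b * cnj b)
      + 2 * Re (c1 * cnj c2 * (a * cnj b))" for a b
    unfolding cmod_power2 by (simp add: power2_eq_square algebra_simps)
  have e: "(cmod (c1 * inv_fourier g1 l + c2 * inv_fourier g2 l))\<^sup>2
      + (cmod (c1 * inv_fourier g1 (- l) + c2 * inv_fourier g2 (- l)))\<^sup>2
    = (cmod c1)\<^sup>2 * Re (P g1 g1 l) + (cmod c2)\<^sup>2 * Re (P g2 g2 l) + 2 * Re (c1 * cnj c2 * P g1 g2 l)" for l
    unfolding sq P_def by (simp only: plus_complex.simps distrib_left)
  have s: "(\<integral>l. P g g' l \<partial>F) = 2 * spectral_form g g'" for g g'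
    by (simp add: P_def spectral_form_def)
  have "(\<integral>l. (cmod c1)\<^sup>2 * Re (P g1 g1 l) + (cmod c2)\<^sup>2 * Re (P g2 g2 l) + 2 * Re (c1 * cnj c2 * P g1 g2 l) \<partial>F)
    = (cmod c1)\<^sup>2 * Re (\<integral>l. P g1 g1 l \<partial>F) + (cmod c2)\<^sup>2 * Re (\<integral>l. P g2 g2 l \<partial>F)
      + 2 * Re (\<integral>l. c1 * cnj c2 * P g1 g2 l \<partial>F)"
    using i by (simp only: Bochner_Integration.integral_add Bochner_Integration.integrable_add
        integrable_mult_right integral_mult_right_zero integrable_Re integral_Re)
  also have "(\<integral>l. c1 * cnj c2 * P g1 g2 l \<partial>F) = c1 * cnj c2 * (\<integral>l. P g1 g2 l \<partial>F)"
    by (rule integral_mult_right_zero)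
  finally show ?thesis unfolding e s by (simp add: algebra_simps)
qed

lemma AE_path_integrable_complex:
  assumes g: "integrable lborel (g :: real \<Rightarrow> complex)"
  shows "AE \<omega> in M. integrable lborel (\<lambda>\<tau>. of_real (\<Phi> \<tau> \<omega>) * g \<tau>)"
  using AE_path_integrable[OF integrable_Re[OF g]] AE_path_integrable[OF integrable_Im[OF g]]
proof eventually_elim
  case (elim \<omega>)
  have e: "of_real (\<Phi> \<tau> \<omega>) * g \<tau> = of_real (Re (g \<tau>) * \<Phi> \<tau> \<omega>) + \<i> * of_real (Im (g \<tau>) * \<Phi> \<tau> \<omega>)" for \<tau>
    by (simp add: complex_eq_iff)
  show ?case unfolding e using elim
    by (intro Bochner_Integration.integrable_add integrable_mult_right integrable_of_real)
qed

text \<open>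
  For \<open>h = Re (c1 g1 + c2 g2)\<close> the transform at \<open>l\<close> is half the sum of the transform of the complex
  kernel at \<open>l\<close> and the conjugate of its transform at \<open>- l\<close>. One of the two vanishes, so the
  squared modulus has no cross term and the variance is a Hermitian form in \<open>(c1, c2)\<close>.
\<close>

theorem circular_gaussian_pair_of_filters:
  assumes g: "integrable lborel g1" "integrable lborel g2"
    and one_sided: "\<And>l. l \<le> 0 \<Longrightarrow> inv_fourier g1 l = 0" "\<And>l. l \<le> 0 \<Longrightarrow> inv_fourier g2 l = 0"
  shows "circular_gaussian_pair M (\<lambda>\<omega>. \<integral>\<tau>. of_real (\<Phi> \<tau> \<omega>) * g1 \<tau> \<partial>lborel) (\<lambda>\<omega>. \<integral>\<tau>. of_real (\<Phi> \<tau> \<omega>) * g2 \<tau> \<partial>lborel)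
     (Re (spectral_form g1 g1)) (Re (spectral_form g2 g2)) (spectral_form g1 g2)"
proof (unfold_locales)
  have [measurable]: "g1 \<in> borel_measurable borel" "g2 \<in> borel_measurable borel" using g by auto
  let ?W1 = "\<lambda>\<omega>. \<integral>\<tau>. of_real (\<Phi> \<tau> \<omega>) * g1 \<tau> \<partial>lborel" and ?W2 = "\<lambda>\<omega>. \<integral>\<tau>. of_real (\<Phi> \<tau> \<omega>) * g2 \<tau> \<partial>lborel"
  show W [measurable]: "?W1 \<in> borel_measurable M" "?W2 \<in> borel_measurable M" by measurable
  fix c1 c2
  define g where "g \<tau> = c1 * g1 \<tau> + c2 * g2 \<tau>" for \<tau>
  have gi: "integrable lborel g" unfolding g_def using g by simp
  hence [measurable]: "g \<in> borel_measurable borel" by auto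
  have fg: "inv_fourier g l = c1 * inv_fourier g1 l + c2 * inv_fourier g2 l" for l
    unfolding g_def by (rule inv_fourier_linear[OF assms(1,2)])
  have zero: "inv_fourier g l = 0" if "l \<le> 0" for l using that one_sided by (simp add: fg)
  \<comment> \<open>linearity of the pathwise integral needs integrable paths, hence holds only almost surely\<close>
  have ae: "AE \<omega> in M. Re (c1 * ?W1 \<omega> + c2 * ?W2 \<omega>) = (\<integral>\<tau>. Re (g \<tau>) * \<Phi> \<tau> \<omega> \<partial>lborel)"
    using AE_path_integrable_complex[OF g(1)] AE_path_integrable_complex[OF g(2)]
  proof eventually_elim
    case (elim \<omega>)
    have "c1 * ?W1 \<omega> + c2 * ?W2 \<omega> = (\<integral>\<tau>. c1 * (of_real (\<Phi> \<tau> \<omega>) * g1 \<tau>) + c2 * (of_real (\<Phi> \<tau> \<omega>) * g2 \<tau>) \<partial>lborel)"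
      using elim by (simp only: Bochner_Integration.integral_add integrable_mult_right integral_mult_right_zero)
    also have "\<dots> = (\<integral>\<tau>. of_real (\<Phi> \<tau> \<omega>) * g \<tau> \<partial>lborel)"
      by (intro Bochner_Integration.integral_cong refl) (simp add: g_def algebra_simps)
    finally have "c1 * ?W1 \<omega> + c2 * ?W2 \<omega> = (\<integral>\<tau>. of_real (\<Phi> \<tau> \<omega>) * g \<tau> \<partial>lborel)" .
    moreover have "integrable lborel (\<lambda>\<tau>. c1 * (of_real (\<Phi> \<tau> \<omega>) * g1 \<tau>) + c2 * (of_real (\<Phi> \<tau> \<omega>) * g2 \<tau>))"
      using elim by (intro Bochner_Integration.integrable_add integrable_mult_right)
    hence "integrable lborel (\<lambda>\<tau>. of_real (\<Phi> \<tau> \<omega>) * g \<tau>)"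
      by (simp add: g_def algebra_simps)
    ultimately show ?case by (simp add: integral_Re[symmetric] mult.commute)
  qed
  have "(\<integral>\<omega>. exp (\<i> * of_real (Re (c1 * ?W1 \<omega> + c2 * ?W2 \<omega>))) \<partial>M)
    = (\<integral>\<omega>. exp (\<i> * of_real (\<integral>\<tau>. Re (g \<tau>) * \<Phi> \<tau> \<omega> \<partial>lborel)) \<partial>M)"
  proof (rule integral_cong_AE)
    show "AE \<omega> in M. exp (\<i> * of_real (Re (c1 * ?W1 \<omega> + c2 * ?W2 \<omega>))) = exp (\<i> * of_real (\<integral>\<tau>. Re (g \<tau>) * \<Phi> \<tau> \<omega> \<partial>lborel))"
      using ae by eventually_elim (simp only:)
  qed measurable
  also have "\<dots> = exp (\<i> * of_real (noise_mean * (\<integral>\<tau>. Re (g \<tau>) \<partial>lborel))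
        - of_real ((\<integral>l. (cmod ((inv_fourier g l + cnj (inv_fourier g (- l))) / 2))\<^sup>2 \<partial>F) / 2))"
    unfolding inv_fourier_Re[OF gi, symmetric] by (rule char_linear_functional[OF integrable_Re[OF gi]])
  also have "(\<integral>\<tau>. Re (g \<tau>) \<partial>lborel) = 0"
    using zero[of 0] gi by (simp add: inv_fourier_def integral_Re)
  also have "(\<lambda>l. (cmod ((inv_fourier g l + cnj (inv_fourier g (- l))) / 2))\<^sup>2)
     = (\<lambda>l. 1 / 4 * ((cmod (inv_fourier g l))\<^sup>2 + (cmod (inv_fourier g (- l)))\<^sup>2))"
  proof
    fix l
    have "inv_fourier g l = 0 \<or> inv_fourier g (- l) = 0" using zero[of l] zero[of "- l"] by linarith
    thus "(cmod ((inv_fourier g l + cnj (inv_fourier g (- l))) / 2))\<^sup>2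
       = 1 / 4 * ((cmod (inv_fourier g l))\<^sup>2 + (cmod (inv_fourier g (- l)))\<^sup>2)"
      by (auto simp: norm_divide power_divide)
  qed
  also have "(\<integral>l. 1 / 4 * ((cmod (inv_fourier g l))\<^sup>2 + (cmod (inv_fourier g (- l)))\<^sup>2) \<partial>F)
     = 1 / 4 * (2 * ((cmod c1)\<^sup>2 * Re (spectral_form g1 g1) + (cmod c2)\<^sup>2 * Re (spectral_form g2 g2)
      + 2 * Re (c1 * cnj c2 * spectral_form g1 g2)))"
    unfolding integral_mult_right_zero fg spectral_form_of_combination[OF g] ..
  also have "exp (\<i> * of_real (noise_mean * 0) - of_real (1 / 4 * (2 * ((cmod c1)\<^sup>2 * Re (spectral_form g1 g1) + (cmod c2)\<^sup>2 * Re (spectral_form g2 g2)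
      + 2 * Re (c1 * cnj c2 * spectral_form g1 g2))) / 2))
    = complex_of_real (exp (- ((cmod c1)\<^sup>2 * Re (spectral_form g1 g1) + (cmod c2)\<^sup>2 * Re (spectral_form g2 g2)
      + 2 * Re (c1 * cnj c2 * spectral_form g1 g2)) / 4))"
  proof -
    have "exp (\<i> * of_real (noise_mean * 0) - of_real (1 / 4 * (2 * Q) / 2)) = complex_of_real (exp (- Q / 4))" for Q
      unfolding exp_of_real[symmetric] by (intro arg_cong[where f=exp]) simp
    thus ?thesis .
  qed
  finally show "(\<integral>\<omega>. exp (\<i> * of_real (Re (c1 * ?W1 \<omega> + c2 * ?W2 \<omega>))) \<partial>M)
    = complex_of_real (exp (- ((cmod c1)\<^sup>2 * Re (spectral_form g1 g1) + (cmod c2)\<^sup>2 * Re (spectral_form g2 g2)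
      + 2 * Re (c1 * cnj c2 * spectral_form g1 g2)) / 4))" .
qed

end

lemma borel_version_complex:
  fixes f :: "real \<Rightarrow> complex"
  assumes "f \<in> borel_measurable lebesgue"
  obtains f' where "f' \<in> borel_measurable borel" "AE x in lborel. f x = f' x"
proof -
  have "(\<lambda>x. Re (f x)) \<in> borel_measurable lebesgue" "(\<lambda>x. Im (f x)) \<in> borel_measurable lebesgue"
    using assms by measurable
  then obtain u v where uv: "u \<in> borel_measurable lborel" "AE x in lborel. Re (f x) = u x"
    "v \<in> borel_measurable lborel" "AE x in lborel. Im (f x) = v x"
    by (metis completion_ex_borel_measurable_real)
  have [measurable]: "u \<in> borel_measurable borel" "v \<in> borel_measurable borel" using uv by auto
  show ?thesis
  proof
    show "(\<lambda>x. of_real (u x) + \<i> * of_real (v x)) \<in> borel_measurable borel" by measurable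
    show "AE x in lborel. f x = of_real (u x) + \<i> * of_real (v x)"
      using uv(2,4) by eventually_elim (simp add: complex_eq_iff)
  qed
qed

lemma AE_lborel_affine:
  fixes P :: "real \<Rightarrow> bool"
  assumes "AE x in lborel. P x" "c \<noteq> 0"
  shows "AE x in lborel. P (t + c * x)"
proof -
  obtain N where N: "{x. \<not> P x} \<subseteq> N" "N \<in> null_sets lborel"
    using assms(1) by (auto elim!: AE_E simp: null_sets_def)
  have [measurable]: "N \<in> sets borel" using N(2) by auto
  have "AE x in lborel. x \<notin> N" using N(2) by (rule AE_not_in)
  hence "AE x in lborel. t + c * x \<notin> N" using assms(2) by (intro AE_borel_affine) auto
  thus ?thesis by eventually_elim (use N(1) in auto)
qed

context stationary_gaussian_noise
begin

text \<open>
  The wavelet is only Lebesgue measurable, whereas the noise is jointly Borel measurable in time, so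
  \<open>\<psi>\<close> is first replaced by a Borel function that agrees with it almost everywhere. The transform
  of the kernel at \<open>l\<close> is \<open>sqrt s exp (i l t)\<close> times the conjugate of \<open>fourier \<psi> (s l)\<close>, and
  thus vanishes for \<open>l \<le> 0\<close>.
\<close>

lemma awt_circular_gaussian_pair:
  assumes wavelet: "analytic_mother_wavelet \<psi>" and s: "s1 > 0" "s2 > 0"
  shows "\<exists>A B D. circular_gaussian_pair M (awt \<psi> \<Phi> t1 s1) (awt \<psi> \<Phi> t2 s2) A B D"
proof -
  interpret analytic_mother_wavelet \<psi> by (rule wavelet)
  have [measurable]: "\<psi> \<in> borel_measurable lebesgue" using L1 by auto
  obtain \<psi>' where m [measurable]: "\<psi>' \<in> borel_measurable borel" and ae: "AE x in lborel. \<psi> x = \<psi>' x"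
    by (rule borel_version_complex[of \<psi>]) (use L1 in auto)
  have ae': "AE x in lebesgue. \<psi> x = \<psi>' x" using ae by (rule AE_completion)
  have "integrable lebesgue \<psi>'"
    using L1 by (subst integrable_cong_AE[OF _ _ AE_symmetric[OF ae']]) (auto intro: measurable_completion)
  hence int': "integrable lborel \<psi>'" by (simp add: integrable_completion)
  define g where "g t s \<tau> = of_real (1 / sqrt s) * cnj (\<psi>' (- t / s + (1 / s) * \<tau>))" for t s \<tau> :: real
  have g_int: "integrable lborel (g t s)" if "s > 0" for t s
    unfolding g_def using lborel_integrable_real_affine[OF int', of "1 / s" "- t / s"] that by simp
  have fourier': "fourier \<psi> w = (\<integral>t. exp (- (\<i> * of_real (t * w))) * \<psi>' t \<partial>lborel)" for w
  proof -
    have "fourier \<psi> w = (\<integral>t. exp (- (\<i> * of_real (t * w))) * \<psi>' t \<partial>lebesgue)"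
      unfolding fourier_def
    proof (rule integral_cong_AE)
      have e: "(\<lambda>t. exp (- (\<i> * of_real (t * w)))) \<in> borel_measurable lebesgue"
        by (intro measurable_completion) measurable
      show "(\<lambda>t. exp (- (\<i> * of_real (t * w))) * \<psi> t) \<in> borel_measurable lebesgue"
        using e by (intro borel_measurable_times) auto
      show "(\<lambda>t. exp (- (\<i> * of_real (t * w))) * \<psi>' t) \<in> borel_measurable lebesgue"
        by (intro measurable_completion) measurable
      show "AE t in lebesgue. exp (- (\<i> * of_real (t * w))) * \<psi> t = exp (- (\<i> * of_real (t * w))) * \<psi>' t"
        using ae' by eventually_elim simp
    qed
    also have "\<dots> = (\<integral>t. exp (- (\<i> * of_real (t * w))) * \<psi>' t \<partial>lborel)"
      by (rule integral_completion) measurable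
    finally show ?thesis .
  qed
  have one_sided: "inv_fourier (g t s) l = 0" if "s > 0" "l \<le> 0" for t s l
  proof -
    have "inv_fourier (g t s) l = s *\<^sub>R (\<integral>u. exp (\<i> * of_real (l * (t + s * u))) * g t s (t + s * u) \<partial>lborel)"
      unfolding inv_fourier_def using that
      by (subst lborel_integral_real_affine[where c=s and t=t]) auto
    also have "(\<integral>u. exp (\<i> * of_real (l * (t + s * u))) * g t s (t + s * u) \<partial>lborel)
       = (\<integral>u. (exp (\<i> * of_real (l * t)) * of_real (1 / sqrt s)) * cnj (exp (- (\<i> * of_real (u * (l * s)))) * \<psi>' u) \<partial>lborel)"
    proof (intro Bochner_Integration.integral_cong refl)
      fix u
      have "- t / s + (1 / s) * (t + s * u) = u" using that by (simp add: field_simps)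
      thus "exp (\<i> * of_real (l * (t + s * u))) * g t s (t + s * u)
        = (exp (\<i> * of_real (l * t)) * of_real (1 / sqrt s)) * cnj (exp (- (\<i> * of_real (u * (l * s)))) * \<psi>' u)"
        by (simp add: g_def exp_cnj distrib_left exp_add mult_ac)
    qed
    also have "\<dots> = (exp (\<i> * of_real (l * t)) * of_real (1 / sqrt s)) * cnj (fourier \<psi> (l * s))"
      unfolding fourier' integral_mult_right_zero Bochner_Integration.integral_cnj ..
    also have "fourier \<psi> (l * s) = 0" using that by (intro analytic mult_nonpos_nonneg) auto
    finally show ?thesis by simp
  qed
  have awt_eq: "awt \<psi> \<Phi> t s \<omega> = (\<integral>\<tau>. of_real (\<Phi> \<tau> \<omega>) * g t s \<tau> \<partial>lborel)" if "s > 0" "\<omega> \<in> space M" for t s \<omega>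
  proof -
    have P [measurable]: "(\<lambda>\<tau>. \<Phi> \<tau> \<omega>) \<in> borel_measurable borel"
      using measurable_compose[OF measurable_Pair2'[OF that(2)] Phi_joint'] by simp
    have [measurable]: "g t s \<in> borel_measurable borel" unfolding g_def by measurable
    have aff: "(\<tau> - t) / s = - t / s + (1 / s) * \<tau>" for \<tau> using that by (simp add: field_simps)
    have "awt \<psi> \<Phi> t s \<omega> = (\<integral>\<tau>. of_real (\<Phi> \<tau> \<omega>) * g t s \<tau> \<partial>lebesgue)"
      unfolding awt_def aff
    proof (rule integral_cong_AE)
      have "(\<lambda>\<tau>. - t / s + (1 / s) * \<tau>) \<in> lebesgue \<rightarrow>\<^sub>M lebesgue"
        using lebesgue_affine_measurable[where c="\<lambda>_::real. 1 / s" and t="- t / s"] that by simp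
      from measurable_compose[OF this, of \<psi> borel]
      have f1: "(\<lambda>\<tau>. \<psi> (- t / s + (1 / s) * \<tau>)) \<in> borel_measurable lebesgue" by simp
      have f2: "(\<lambda>\<tau>. complex_of_real (\<Phi> \<tau> \<omega>) * of_real (1 / sqrt s)) \<in> borel_measurable lebesgue"
        by (intro measurable_completion) measurable
      show "(\<lambda>\<tau>. complex_of_real (\<Phi> \<tau> \<omega>) * of_real (1 / sqrt s) * cnj (\<psi> (- t / s + (1 / s) * \<tau>))) \<in> borel_measurable lebesgue"
        by (rule borel_measurable_times[OF f2 measurable_compose[OF f1 cnj_borel_measurable]])
      show "(\<lambda>\<tau>. of_real (\<Phi> \<tau> \<omega>) * g t s \<tau>) \<in> borel_measurable lebesgue"
        by (intro measurable_completion) measurable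
      have "AE \<tau> in lborel. \<psi> (- t / s + (1 / s) * \<tau>) = \<psi>' (- t / s + (1 / s) * \<tau>)"
        using that by (intro AE_lborel_affine[OF ae]) simp
      hence "AE \<tau> in lebesgue. \<psi> (- t / s + (1 / s) * \<tau>) = \<psi>' (- t / s + (1 / s) * \<tau>)"
        by (rule AE_completion)
      thus "AE \<tau> in lebesgue. complex_of_real (\<Phi> \<tau> \<omega>) * of_real (1 / sqrt s) * cnj (\<psi> (- t / s + (1 / s) * \<tau>))
         = of_real (\<Phi> \<tau> \<omega>) * g t s \<tau>"
        by eventually_elim (simp add: g_def)
    qed
    also have "\<dots> = (\<integral>\<tau>. of_real (\<Phi> \<tau> \<omega>) * g t s \<tau> \<partial>lborel)"
      by (rule integral_completion) measurable
    finally show ?thesis .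
  qed
  define V where "V t s \<omega> = (\<integral>\<tau>. of_real (\<Phi> \<tau> \<omega>) * g t s \<tau> \<partial>lborel)" for t s \<omega>
  obtain A B D where p: "circular_gaussian_pair M (V t1 s1) (V t2 s2) A B D"
    using circular_gaussian_pair_of_filters[OF g_int[OF s(1), of t1] g_int[OF s(2), of t2] one_sided one_sided] s
    unfolding V_def by metis
  interpret V: circular_gaussian_pair M "V t1 s1" "V t2 s2" A B D by (rule p)
  have eq: "awt \<psi> \<Phi> t s \<omega> = V t s \<omega>" if "s > 0" "\<omega> \<in> space M" for t s \<omega>
    using awt_eq[OF that] by (simp add: V_def)
  have "circular_gaussian_pair M (awt \<psi> \<Phi> t1 s1) (awt \<psi> \<Phi> t2 s2) A B D"
  proof (unfold_locales)
    show "awt \<psi> \<Phi> t1 s1 \<in> borel_measurable M" "awt \<psi> \<Phi> t2 s2 \<in> borel_measurable M"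
      using V.W_measurable s by (simp_all add: eq cong: measurable_cong)
    fix c1 c2
    show "(\<integral>\<omega>. exp (\<i> * of_real (Re (c1 * awt \<psi> \<Phi> t1 s1 \<omega> + c2 * awt \<psi> \<Phi> t2 s2 \<omega>))) \<partial>M)
      = of_real (exp (- ((cmod c1)\<^sup>2 * A + (cmod c2)\<^sup>2 * B + 2 * Re (c1 * cnj c2 * D)) / 4))"
      unfolding V.joint_char[symmetric] using s
      by (intro Bochner_Integration.integral_cong refl) (simp add: eq)
  qed
  thus ?thesis by blast
qed

text \<open>
  The determinant of the second moment matrix is \<open>A B - \<bar>D\<bar>\<^sup>2\<close>, so that invertibility is the strict
  Cauchy-Schwarz inequality.
\<close>

lemma moduli_of_awt:
  assumes wavelet: "analytic_mother_wavelet \<psi>" and s: "s1 > 0" "s2 > 0"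
    and G: "G = awt_gamma M \<psi> \<Phi> t1 s1 t2 s2" and inv: "invertible G" and x: "x = coherence G"
  shows "x \<in> {0..<1}"
    and "covariance M (\<lambda>\<omega>. cmod (awt \<psi> \<Phi> t1 s1 \<omega>)) (\<lambda>\<omega>. cmod (awt \<psi> \<Phi> t2 s2 \<omega>)) =
      pi / 4 * sqrt (Re (G $ 1 $ 1) * Re (G $ 2 $ 2)) * ((1 - x)\<^sup>2 * hyp2F1 (3/2) (3/2) 1 x - 1)"
    and "correlation M (\<lambda>\<omega>. cmod (awt \<psi> \<Phi> t1 s1 \<omega>)) (\<lambda>\<omega>. cmod (awt \<psi> \<Phi> t2 s2 \<omega>)) =
      inverse (4 / pi - 1) * ((1 - x)\<^sup>2 * hyp2F1 (3/2) (3/2) 1 x - 1)"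
proof -
  obtain A B D where p: "circular_gaussian_pair M (awt \<psi> \<Phi> t1 s1) (awt \<psi> \<Phi> t2 s2) A B D"
    using awt_circular_gaussian_pair[OF wavelet s] by blast
  interpret P: circular_gaussian_pair M "awt \<psi> \<Phi> t1 s1" "awt \<psi> \<Phi> t2 s2" A B D by (rule p)
  have sq: "z * cnj z = of_real ((cmod z)\<^sup>2)" for z by (simp only: complex_norm_square)
  have G11: "G $ 1 $ 1 = of_real A"
    unfolding G awt_gamma_def second_moment_matrix_def by (simp add: sq P.abs_squares del: of_real_power)
  have G22: "G $ 2 $ 2 = of_real B"
    unfolding G awt_gamma_def second_moment_matrix_def by (simp add: sq P.abs_squares del: of_real_power)
  have G12: "G $ 1 $ 2 = D"
    unfolding G awt_gamma_def second_moment_matrix_def by (simp add: P.cross_moment)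
  have "G $ 2 $ 1 = cnj (\<integral>\<omega>. awt \<psi> \<Phi> t1 s1 \<omega> * cnj (awt \<psi> \<Phi> t2 s2 \<omega>) \<partial>M)"
    unfolding G awt_gamma_def second_moment_matrix_def Bochner_Integration.integral_cnj[symmetric] by (simp add: mult.commute)
  hence G21: "G $ 2 $ 1 = cnj D" by (simp add: P.cross_moment)
  have "det G = of_real (A * B - (cmod D)\<^sup>2)"
    unfolding det_2 G11 G22 G12 G21 sq by simp
  moreover have "det G \<noteq> 0" using inv by (simp add: invertible_det_nz)
  ultimately have "A * B \<noteq> (cmod D)\<^sup>2" by (metis eq_iff_diff_eq_0 of_real_0)
  hence strict: "(cmod D)\<^sup>2 < A * B" using P.cross_moment_bound by simp
  have x': "x = (cmod D)\<^sup>2 / (A * B)" unfolding x coherence_def G11 G12 G22 by simp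
  have "A * B > 0" using strict zero_le_power2[of "cmod D"] by linarith
  thus "x \<in> {0..<1}" using strict by (simp add: x')
  show "covariance M (\<lambda>\<omega>. cmod (awt \<psi> \<Phi> t1 s1 \<omega>)) (\<lambda>\<omega>. cmod (awt \<psi> \<Phi> t2 s2 \<omega>)) =
      pi / 4 * sqrt (Re (G $ 1 $ 1) * Re (G $ 2 $ 2)) * ((1 - x)\<^sup>2 * hyp2F1 (3/2) (3/2) 1 x - 1)"
    unfolding G11 G22 Re_complex_of_real x' by (rule P.covariance_of_moduli(1)[OF strict])
  show "correlation M (\<lambda>\<omega>. cmod (awt \<psi> \<Phi> t1 s1 \<omega>)) (\<lambda>\<omega>. cmod (awt \<psi> \<Phi> t2 s2 \<omega>)) =
      inverse (4 / pi - 1) * ((1 - x)\<^sup>2 * hyp2F1 (3/2) (3/2) 1 x - 1)"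
    unfolding x' by (rule P.covariance_of_moduli(2)[OF strict])
qed

end

section \<open>Covariance and correlation of the moduli\<close>

text \<open>
  The correlation coefficient depends on the points and scales only through the coherence, which is
  why the limit in the coherence is uniform in them.
\<close>

theorem corollary4:
  fixes M :: "'a measure" and \<psi> :: "real \<Rightarrow> complex" and \<Phi> :: "real \<Rightarrow> 'a \<Rightarrow> real"
    and C :: "real \<Rightarrow> real" and F :: "real measure"
    and t1 t2 s1 s2 x :: real and G :: "complex ^ 2 ^ 2"
  assumes wavelet: "analytic_mother_wavelet \<psi>"
    and noise: "stationary_gaussian_noise M \<Phi> C F"
    and scales: "s1 > 0" "s2 > 0"
    and G: "G = awt_gamma M \<psi> \<Phi> t1 s1 t2 s2"
    and inv: "invertible G"
    and x: "x = coherence G"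
  shows "x \<in> {0..<1} \<and>
    covariance M (\<lambda>\<omega>. cmod (awt \<psi> \<Phi> t1 s1 \<omega>)) (\<lambda>\<omega>. cmod (awt \<psi> \<Phi> t2 s2 \<omega>)) =
      pi / 4 * sqrt (Re (G $ 1 $ 1) * Re (G $ 2 $ 2)) * ((1 - x)\<^sup>2 * hyp2F1 (3/2) (3/2) 1 x - 1) \<and>
    correlation M (\<lambda>\<omega>. cmod (awt \<psi> \<Phi> t1 s1 \<omega>)) (\<lambda>\<omega>. cmod (awt \<psi> \<Phi> t2 s2 \<omega>)) =
      inverse (4 / pi - 1) * ((1 - x)\<^sup>2 * hyp2F1 (3/2) (3/2) 1 x - 1) \<and>
    \<comment> \<open>the asymptotic equivalence, both sides being functions of the real variable \<open>y\<close>\<close>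
    ((\<lambda>y. (inverse (4 / pi - 1) * ((1 - y)\<^sup>2 * hyp2F1 (3/2) (3/2) 1 y - 1)) /
      (inverse (16 / pi - 4) * y)) \<longlongrightarrow> 1) (at_right 0) \<and>
    \<comment> \<open>the same for the correlation coefficient itself, uniformly in the points and scales\<close>
    (\<forall>\<epsilon>>0. \<exists>\<delta>>0. \<forall>u1 u2 r1 r2. 0 < r1 \<longrightarrow> 0 < r2
      \<longrightarrow> invertible (awt_gamma M \<psi> \<Phi> u1 r1 u2 r2)
      \<longrightarrow> 0 < coherence (awt_gamma M \<psi> \<Phi> u1 r1 u2 r2)
      \<longrightarrow> coherence (awt_gamma M \<psi> \<Phi> u1 r1 u2 r2) < \<delta>
      \<longrightarrow> \<bar>correlation M (\<lambda>\<omega>. cmod (awt \<psi> \<Phi> u1 r1 \<omega>)) (\<lambda>\<omega>. cmod (awt \<psi> \<Phi> u2 r2 \<omega>)) /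
            (inverse (16 / pi - 4) * coherence (awt_gamma M \<psi> \<Phi> u1 r1 u2 r2)) - 1\<bar> < \<epsilon>)"
proof -
  interpret stationary_gaussian_noise M \<Phi> C F by (rule noise)
  note main = moduli_of_awt[OF wavelet]
  define q where "q y = (inverse (4 / pi - 1) * ((1 - y)\<^sup>2 * hyp2F1 (3/2) (3/2) 1 y - 1)) /
      (inverse (16 / pi - 4) * y)" for y
  have q_lim: "(q \<longlongrightarrow> 1) (at_right 0)"
  proof -
    have c: "4 / pi - 1 \<noteq> 0" using pi_less_4 by (simp add: field_simps)
    have "16 / pi - 4 = 4 * (4 / pi - 1)" by simp
    hence e: "q y = 4 * (((1 - y)\<^sup>2 * hyp2F1 (3/2) (3/2) 1 y - 1) / y)" for y
      using c unfolding q_def by (simp only: inverse_mult_distrib) simp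
    have "((\<lambda>y. 4 * (((1 - y)\<^sup>2 * hyp2F1 (3/2) (3/2) 1 y - 1) / y)) \<longlongrightarrow> 4 * (1 / 4)) (at_right 0)"
      by (intro tendsto_mult tendsto_const filterlim_at_split[THEN iffD1, THEN conjunct2] euler_limit)
    thus ?thesis unfolding e[symmetric] by simp
  qed
  have uniform: "\<forall>\<epsilon>>0. \<exists>\<delta>>0. \<forall>u1 u2 r1 r2. 0 < r1 \<longrightarrow> 0 < r2
      \<longrightarrow> invertible (awt_gamma M \<psi> \<Phi> u1 r1 u2 r2)
      \<longrightarrow> 0 < coherence (awt_gamma M \<psi> \<Phi> u1 r1 u2 r2)
      \<longrightarrow> coherence (awt_gamma M \<psi> \<Phi> u1 r1 u2 r2) < \<delta>
      \<longrightarrow> \<bar>correlation M (\<lambda>\<omega>. cmod (awt \<psi> \<Phi> u1 r1 \<omega>)) (\<lambda>\<omega>. cmod (awt \<psi> \<Phi> u2 r2 \<omega>)) /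
            (inverse (16 / pi - 4) * coherence (awt_gamma M \<psi> \<Phi> u1 r1 u2 r2)) - 1\<bar> < \<epsilon>"
  proof (intro allI impI)
    fix \<epsilon> :: real assume "\<epsilon> > 0"
    with q_lim have "\<forall>\<^sub>F y in at_right 0. \<bar>q y - 1\<bar> < \<epsilon>"
      by (auto simp: tendsto_iff dist_real_def)
    then obtain \<delta> where \<delta>: "\<delta> > 0" "\<And>y. 0 < y \<Longrightarrow> y < \<delta> \<Longrightarrow> \<bar>q y - 1\<bar> < \<epsilon>"
      unfolding eventually_at_right_field by auto
    show "\<exists>\<delta>>0. \<forall>u1 u2 r1 r2. 0 < r1 \<longrightarrow> 0 < r2
      \<longrightarrow> invertible (awt_gamma M \<psi> \<Phi> u1 r1 u2 r2)
      \<longrightarrow> 0 < coherence (awt_gamma M \<psi> \<Phi> u1 r1 u2 r2)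
      \<longrightarrow> coherence (awt_gamma M \<psi> \<Phi> u1 r1 u2 r2) < \<delta>
      \<longrightarrow> \<bar>correlation M (\<lambda>\<omega>. cmod (awt \<psi> \<Phi> u1 r1 \<omega>)) (\<lambda>\<omega>. cmod (awt \<psi> \<Phi> u2 r2 \<omega>)) /
            (inverse (16 / pi - 4) * coherence (awt_gamma M \<psi> \<Phi> u1 r1 u2 r2)) - 1\<bar> < \<epsilon>"
    proof (intro exI[of _ \<delta>] conjI \<delta>(1) allI impI)
      fix u1 u2 r1 r2 :: real
      assume "0 < r1" "0 < r2" "invertible (awt_gamma M \<psi> \<Phi> u1 r1 u2 r2)"
        and c: "0 < coherence (awt_gamma M \<psi> \<Phi> u1 r1 u2 r2)" "coherence (awt_gamma M \<psi> \<Phi> u1 r1 u2 r2) < \<delta>"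
      from main(3)[OF this(1,2) refl this(3) refl] \<delta>(2)[OF c]
      show "\<bar>correlation M (\<lambda>\<omega>. cmod (awt \<psi> \<Phi> u1 r1 \<omega>)) (\<lambda>\<omega>. cmod (awt \<psi> \<Phi> u2 r2 \<omega>)) /
            (inverse (16 / pi - 4) * coherence (awt_gamma M \<psi> \<Phi> u1 r1 u2 r2)) - 1\<bar> < \<epsilon>"
        unfolding q_def by (simp only:)
    qed
  qed
  show ?thesis
    by (intro conjI main[OF scales G inv x] q_lim[unfolded q_def] uniform)
qed

end
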